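(* Let $\mathbf u\in P_3(\mathbb C)$ be generic and let $\mathcal A_{\mathbf u}$ be the quadratic algebra generated by $y_0,y_1,y_2,y_3$ with the relations given in the context, with new generators $Y_\mu$ as in the context. 1) In terms of the $Y_\mu$, the relations of $\mathcal A_{\mathbf u}$ take the form $$[Y_0,Y_k]_-=[Y_\ell,Y_m]_+,\qquad [Y_\ell,Y_m]_-=-J_{\ell m}\,[Y_0,Y_k]_+$$ for any $k\in\{1,2,3\}$, $(k,\ell,m)$ being a cyclic permutation of $(1,2,3)$. 2) The characteristic variety $E_{\mathbf u}$ of $\mathcal A_{\mathbf u}$ is the union of $F_{\mathbf u}$ with the $4$ points $e_\nu$, where $e_\nu$ ($\nu=0,1,2,3$) are the points of $P_3(\mathbb C)$ whose homogeneous coordinates $(Z_\mu)$ all vanish but one. 3) The automorphism $\sigma$ of the characteristic variety $E_{\mathbf u}$ is given by $\psi(z)\mapsto\psi(z-\eta)$ on $F_{\mathbf u}$ and $\sigma=\mathrm{Id}$ on the $4$ points $e_\nu$. 4) The automorphism $\sigma$ is the restriction to $F_{\mathbf u}$ of a birational automorphism of $P_3(\mathbb C)$ independent of $\mathbf u$ and defined over $\mathbb Q$.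
   Context: Notation: $[a,b]_\pm=ab\pm ba$; $(u_0,u_1,u_2,u_3)$ are the homogeneous coordinates of $\mathbf u\in P_3(\mathbb C)$. Algebra. $\mathcal A_{\mathbf u}=C_{\rm alg}(\mathbb C^4(\mathbf u))$ is the algebra generated by $y_0,\dots,y_3$ with relations, for every cyclic permutation $(k,\ell,m)$ of $(1,2,3)$, $$u_ky_ky_0-u_0y_0y_k+u_\ell y_\ell y_m-u_my_my_\ell=0,\qquad u_ky_0y_k-u_0y_ky_0+u_my_\ell y_m-u_\ell y_my_\ell=0.$$ The generators $Y_\mu$ are defined (for a fixed choice of square roots) by $y_0=\sqrt{u_1-u_2}\sqrt{u_2-u_3}\sqrt{u_3-u_1}\,Y_0$, $y_1=\sqrt{u_0+u_2}\sqrt{u_2-u_3}\sqrt{u_0+u_3}\,Y_1$, $y_2=\sqrt{u_0+u_3}\sqrt{u_3-u_1}\sqrt{u_0+u_1}\,Y_2$, $y_3=\sqrt{u_0+u_1}\sqrt{u_1-u_2}\sqrt{u_0+u_2}\,Y_3$. Put $\alpha=(u_0+u_1)(u_2+u_3)$, $\beta=(u_0+u_2)(u_3+u_1)$, $\gamma=(u_0+u_3)(u_1+u_2)$, and $J_{12}=\frac{\alpha-\beta}{\gamma}$, $J_{23}=\frac{\beta-\gamma}{\alpha}$, $J_{31}=\frac{\gamma-\alpha}{\beta}$. Characteristic variety. For a quadratic algebra $T(V)/(R)$, $R\subset V\otimes V$, let $\Gamma\subset P(V^* )\times P(V^* )$ be the set of pairs of lines spanned by nonzero $(a,b)$ with $\langle\omega,a\otimes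 b\rangle=0$ for all $\omega\in R$. When both projections of $\Gamma$ coincide with one set $E$ and $\Gamma$ is the graph of an automorphism $\sigma$ of $E$ (pairs $(Z,\sigma(Z))$), $E$ is called the characteristic variety. For $\mathcal A_{\mathbf u}$, $P(V^* )$ is $P_3(\mathbb C)$ with homogeneous coordinates $Z_\mu$ dual to the generators $Y_\mu$. The curve $F_{\mathbf u}$. Let $S\subset P_3(\mathbb C)$ be the 8 points $p_0=(1,0,0,0),p_1=(0,1,0,0),p_2=(0,0,1,0),p_3=(0,0,0,1)$, $q_0=(-1,1,1,1),q_1=(1,-1,1,1),q_2=(1,1,-1,1),q_3=(1,1,1,-1)$ (in the coordinates $u_\mu$), and $\Phi:P_3(\mathbb C)\setminus S\to P_2(\mathbb C)$, $\Phi(\mathbf u)=(\alpha,\beta,\gamma)$. $F_{\mathbf u}$ is the union of $S$ with the fiber of $\Phi$ through $\mathbf u$. It is viewed in the coordinates $Z_\mu$ via the involution $Z=Mu$, $M=\frac12\begin{pmatrix}1&1&1&1\\1&1&-1&-1\\1&-1&1&-1\\1&-1&-1&1\end{pmatrix}$, in which its equations are $\frac{Z_0^2-Z_1^2}{\alpha}=\frac{Z_0^2-Z_2^2}{\beta}=\frac{Z_0^2-Z_3^2}{\gamma}$. Parametrization. Let $\omega,\eta\in\mathbb C$, $\mathrm{Im}\,\omega>0$, be such that $(\alpha,\beta,\gamma)\sim\big(\frac{\theta_2(0)^2}{\theta_2(\eta)^2},\frac{\theta_3(0)^2}{\theta_3(\eta)^2},\frac{\theta_4(0)^2}{\theta_4(\eta)^2}\big)$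 projectively, where $\theta_1,\dots,\theta_4$ are the Jacobi theta functions for the lattice $L=\mathbb Z+\mathbb Z\omega$ ($\theta_1$ odd, vanishing exactly on $L$). Then $\varphi(z)=\big(\frac{\theta_1(2z)}{\theta_1(\eta)},\frac{\theta_2(2z)}{\theta_2(\eta)},\frac{\theta_3(2z)}{\theta_3(\eta)},\frac{\theta_4(2z)}{\theta_4(\eta)}\big)=(Z_0,Z_1,Z_2,Z_3)$ and $\psi(z)=\varphi(z-\eta/2)$ are isomorphisms $\mathbb C/L\to F_{\mathbf u}$. *)

theory Defs
  imports
    "HOL-Analysis.Analysis"
    "HOL-Algebra.QuotRing"
    "HOL-Library.Poly_Mapping"
begin

section \<open>Projective spaces, homogeneous polynomials, rational maps\<close>

text \<open>
  Points of projective space are the one-dimensional subspaces \<open>line v\<close>, \<open>v \<noteq> 0\<close>.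
  The coordinates of \<^typ>\<open>complex^4\<close> are indexed by \<open>0, 1, 2, 3 :: 4\<close>; since \<open>4 = 0\<close> in this type,
  the library function \<^const>\<open>vector\<close> would put the last entry at index \<open>0\<close>, so \<open>vec4\<close> is used instead.
\<close>

definition line :: "complex^'n \<Rightarrow> (complex^'n) set" where
  "line v = vec.span {v}"

definition vec4 :: "complex \<Rightarrow> complex \<Rightarrow> complex \<Rightarrow> complex \<Rightarrow> complex^4" where
  "vec4 a b c d = (\<chi> i. if i = 0 then a else if i = 1 then b else if i = 2 then c else d)"

definition homog_poly :: "complex set \<Rightarrow> nat \<Rightarrow> (complex^4 \<Rightarrow> complex) \<Rightarrow> bool" where
  "homog_poly K d f \<longleftrightarrow>
     (\<exists>c :: (4 \<Rightarrow> nat) \<Rightarrow> complex. range c \<subseteq> K \<and>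
        (\<forall>x. f x = (\<Sum>e | sum e UNIV = d. c e * (\<Prod>i\<in>UNIV. (x $ i) ^ e i))))"

lemma finite_exponents: "finite {e :: 4 \<Rightarrow> nat. sum e UNIV = d}"
proof (rule finite_subset)
  show "{e :: 4 \<Rightarrow> nat. sum e UNIV = d} \<subseteq> PiE UNIV (\<lambda>_. {..d})"
    by (auto simp: PiE_def intro: member_le_sum)
  show "finite (PiE (UNIV :: 4 set) (\<lambda>_. {..d}))"
    by (intro finite_PiE) auto
qed

text \<open>
  A rational map from the projective 3-space to itself, defined over \<open>K\<close>, is represented by a
  4-tuple of forms of equal degree with coefficients in \<open>K\<close>, not all zero.
\<close>

definition rational_map :: "complex set \<Rightarrow> (complex^4 \<Rightarrow> complex^4) \<Rightarrow> bool" where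
  "rational_map K P \<longleftrightarrow> (\<exists>d. \<forall>i. homog_poly K d (\<lambda>x. P x $ i)) \<and> (\<exists>x. P x \<noteq> 0)"

definition rational_left_inverse :: "(complex^4 \<Rightarrow> complex^4) \<Rightarrow> (complex^4 \<Rightarrow> complex^4) \<Rightarrow> bool" where
  "rational_left_inverse Q P \<longleftrightarrow>
     (\<exists>x. Q (P x) \<noteq> 0) \<and> (\<forall>x. Q (P x) \<noteq> 0 \<longrightarrow> line (Q (P x)) = line x)"

definition birational_automorphism :: "complex set \<Rightarrow> (complex^4 \<Rightarrow> complex^4) \<Rightarrow> bool" where
  "birational_automorphism K P \<longleftrightarrow> rational_map K P \<and>
     (\<exists>Q. rational_map K Q \<and> rational_left_inverse Q P \<and> rational_left_inverse P Q)"

text \<open>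
  \<open>\<sigma>\<close> is the restriction to the curve \<open>X\<close> of the rational map given by \<open>P\<close>: the forms \<open>P\<close> vanish
  simultaneously at finitely many points of \<open>X\<close> only, and \<open>\<sigma>\<close> is given by \<open>P\<close> at all other points.
\<close>

definition restriction_to_curve ::
    "(complex^4 \<Rightarrow> complex^4) \<Rightarrow> (complex^4) set set \<Rightarrow> ((complex^4) set \<Rightarrow> (complex^4) set) \<Rightarrow> bool" where
  "restriction_to_curve P X \<sigma> \<longleftrightarrow>
     finite {line x | x. x \<noteq> 0 \<and> line x \<in> X \<and> P x = 0} \<and>
     (\<forall>x. x \<noteq> 0 \<and> line x \<in> X \<and> P x \<noteq> 0 \<longrightarrow> \<sigma> (line x) = line (P x))"

definition regular_on :: "(complex^4) set set \<Rightarrow> ((complex^4) set \<Rightarrow> (complex^4) set) \<Rightarrow> bool" where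
  "regular_on E \<sigma> \<longleftrightarrow>
     (\<forall>x. x \<noteq> 0 \<and> line x \<in> E \<longrightarrow>
        (\<exists>P. rational_map UNIV P \<and> P x \<noteq> 0 \<and>
           (\<forall>y. y \<noteq> 0 \<and> line y \<in> E \<and> P y \<noteq> 0 \<longrightarrow> \<sigma> (line y) = line (P y))))"

definition variety_automorphism :: "(complex^4) set set \<Rightarrow> ((complex^4) set \<Rightarrow> (complex^4) set) \<Rightarrow> bool" where
  "variety_automorphism E \<sigma> \<longleftrightarrow>
     bij_betw \<sigma> E E \<and> regular_on E \<sigma> \<and> regular_on E (inv_into E \<sigma>)"


section \<open>The free algebra and quadratic algebras\<close>

text \<open>
  The tensor algebra \<open>T(V)\<close>, with basis \<open>y\<^sub>0, \<dots>, y\<^sub>3\<close> of \<open>V\<close>, is the algebra of the free monoid of words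
  in the letters \<open>0, 1, 2, 3\<close>: addition of words is concatenation, and multiplication of
  finitely supported functions on words is convolution.
\<close>

instantiation list :: (type) monoid_add
begin

definition zero_list :: "'a list" where "zero_list = []"

definition plus_list :: "'a list \<Rightarrow> 'a list \<Rightarrow> 'a list" where "plus_list = (@)"

instance
  by standard (simp_all add: zero_list_def plus_list_def)

end

type_synonym free_alg = "4 list \<Rightarrow>\<^sub>0 complex"

definition scalar :: "complex \<Rightarrow> free_alg" where
  "scalar c = Poly_Mapping.single [] c"

definition y_gen :: "4 \<Rightarrow> free_alg" where
  "y_gen i = Poly_Mapping.single [i] 1"

definition free_ring :: "free_alg ring" where
  "free_ring = \<lparr>carrier = UNIV, monoid.mult = (*), one = 1, zero = 0, add = (+)\<rparr>"

lemma ring_free_ring: "ring free_ring"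
proof (rule ringI)
  show "abelian_group free_ring"
  proof (rule abelian_groupI)
    fix a
    show "\<exists>b\<in>carrier free_ring. b \<oplus>\<^bsub>free_ring\<^esub> a = \<zero>\<^bsub>free_ring\<^esub>"
      by (auto simp: free_ring_def intro!: exI[of _ "- a"])
  qed (auto simp: free_ring_def algebra_simps)
  show "Group.monoid free_ring"
    by (rule monoidI) (auto simp: free_ring_def algebra_simps)
qed (auto simp: free_ring_def algebra_simps)

definition quadratic_algebra :: "free_alg set \<Rightarrow> free_alg set ring" where
  "quadratic_algebra R = free_ring Quot (Idl\<^bsub>free_ring\<^esub> R)"

definition com :: "free_alg \<Rightarrow> free_alg \<Rightarrow> free_alg" where
  "com a b = a * b - b * a"

definition anticom :: "free_alg \<Rightarrow> free_alg \<Rightarrow> free_alg" where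
  "anticom a b = a * b + b * a"

text \<open>
  A vector \<open>a\<close> stands for the linear form on \<open>V\<close> with \<open>y\<^sub>i \<mapsto> a $ i\<close>; the two pairings are
  evaluation on \<open>V\<close> and on \<open>V \<otimes> V\<close> (words of length 1 and 2).
\<close>

definition pairing1 :: "free_alg \<Rightarrow> complex^4 \<Rightarrow> complex" where
  "pairing1 v a = (\<Sum>i\<in>UNIV. Poly_Mapping.lookup v [i] * a $ i)"

definition pairing2 :: "free_alg \<Rightarrow> complex^4 \<Rightarrow> complex^4 \<Rightarrow> complex" where
  "pairing2 w a b = (\<Sum>i\<in>UNIV. \<Sum>j\<in>UNIV. Poly_Mapping.lookup w [i, j] * (a $ i * b $ j))"

text \<open>
  The set \<open>\<Gamma>\<close> for the relation space spanned by \<open>R\<close>, in the homogeneous coordinates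
  \<open>Z\<^sub>\<mu>(a) = \<langle>Y\<^sub>\<mu>, a\<rangle>\<close> dual to a basis \<open>Y\<close> of \<open>V\<close>.
\<close>

definition dual_coords :: "(4 \<Rightarrow> free_alg) \<Rightarrow> complex^4 \<Rightarrow> complex^4" where
  "dual_coords Y a = (\<chi> \<mu>. pairing1 (Y \<mu>) a)"

definition Gamma_set :: "free_alg set \<Rightarrow> (4 \<Rightarrow> free_alg) \<Rightarrow> ((complex^4) set \<times> (complex^4) set) set" where
  "Gamma_set R Y = {(line (dual_coords Y a), line (dual_coords Y b)) | a b.
      a \<noteq> 0 \<and> b \<noteq> 0 \<and> (\<forall>\<omega>\<in>R. pairing2 \<omega> a b = 0)}"

definition is_characteristic_variety ::
    "((complex^4) set \<times> (complex^4) set) set \<Rightarrow> (complex^4) set set \<Rightarrow>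
     ((complex^4) set \<Rightarrow> (complex^4) set) \<Rightarrow> bool" where
  "is_characteristic_variety \<Gamma> E \<sigma> \<longleftrightarrow>
     fst ` \<Gamma> = E \<and> snd ` \<Gamma> = E \<and> \<Gamma> = {(p, \<sigma> p) | p. p \<in> E} \<and> variety_automorphism E \<sigma>"


section \<open>The algebras \<open>A\<^sub>u\<close>\<close>

definition cyclic_triples :: "(4 \<times> 4 \<times> 4) set" where
  "cyclic_triples = {(1, 2, 3), (2, 3, 1), (3, 1, 2)}"

definition y_relations :: "complex^4 \<Rightarrow> free_alg set" where
  "y_relations u = (\<Union>(k, l, m)\<in>cyclic_triples.
     {scalar (u $ k) * y_gen k * y_gen 0 - scalar (u $ 0) * y_gen 0 * y_gen k
        + scalar (u $ l) * y_gen l * y_gen m - scalar (u $ m) * y_gen m * y_gen l,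
      scalar (u $ k) * y_gen 0 * y_gen k - scalar (u $ 0) * y_gen k * y_gen 0
        + scalar (u $ m) * y_gen l * y_gen m - scalar (u $ l) * y_gen m * y_gen l})"

definition alpha :: "complex^4 \<Rightarrow> complex" where
  "alpha u = (u $ 0 + u $ 1) * (u $ 2 + u $ 3)"

definition beta :: "complex^4 \<Rightarrow> complex" where
  "beta u = (u $ 0 + u $ 2) * (u $ 3 + u $ 1)"

definition gamma :: "complex^4 \<Rightarrow> complex" where
  "gamma u = (u $ 0 + u $ 3) * (u $ 1 + u $ 2)"

definition Phi :: "complex^4 \<Rightarrow> complex^3" where
  "Phi u = vector [alpha u, beta u, gamma u]"

definition J_coeff :: "complex^4 \<Rightarrow> 4 \<Rightarrow> 4 \<Rightarrow> complex" where
  "J_coeff u l m =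
    (if (l, m) = (1, 2) then (alpha u - beta u) / gamma u
     else if (l, m) = (2, 3) then (beta u - gamma u) / alpha u
     else if (l, m) = (3, 1) then (gamma u - alpha u) / beta u
     else 0)"

text \<open>
  Genericity is membership in the Zariski open complement of the hyperplanes \<open>u\<^sub>i = \<plusminus> u\<^sub>j\<close>.
  It says exactly that the factors relating \<open>y\<^sub>\<mu>\<close> and \<open>Y\<^sub>\<mu>\<close> do not vanish, and that
  \<open>\<alpha>, \<beta>, \<gamma>\<close> are nonzero and pairwise distinct (e.g. \<open>\<beta> - \<gamma> = (u\<^sub>1 - u\<^sub>0)(u\<^sub>2 - u\<^sub>3)\<close>).
\<close>

definition generic :: "complex^4 \<Rightarrow> bool" where
  "generic u \<longleftrightarrow> (\<forall>i j. i \<noteq> j \<longrightarrow> u $ i \<noteq> u $ j \<and> u $ i \<noteq> - u $ j)"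

text \<open>
  A choice of the six square roots: \<open>s k\<close> is a root of \<open>u\<^sub>l - u\<^sub>m\<close> and \<open>t k\<close> a root of \<open>u\<^sub>0 + u\<^sub>k\<close>,
  for \<open>(k, l, m)\<close> cyclic; the values \<open>s 0\<close> and \<open>t 0\<close> are not used.
\<close>

definition root_choice :: "complex^4 \<Rightarrow> (4 \<Rightarrow> complex) \<Rightarrow> (4 \<Rightarrow> complex) \<Rightarrow> bool" where
  "root_choice u s t \<longleftrightarrow>
     (\<forall>(k, l, m)\<in>cyclic_triples. (s k)\<^sup>2 = u $ l - u $ m \<and> (t k)\<^sup>2 = u $ 0 + u $ k)"

definition scaling :: "(4 \<Rightarrow> complex) \<Rightarrow> (4 \<Rightarrow> complex) \<Rightarrow> complex^4" where
  "scaling s t = vec4 (s 3 * s 1 * s 2) (t 2 * s 1 * t 3) (t 3 * s 2 * t 1) (t 1 * s 3 * t 2)"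

definition Y_gen :: "(4 \<Rightarrow> complex) \<Rightarrow> (4 \<Rightarrow> complex) \<Rightarrow> 4 \<Rightarrow> free_alg" where
  "Y_gen s t \<mu> = scalar (1 / scaling s t $ \<mu>) * y_gen \<mu>"

definition Y_relations :: "complex^4 \<Rightarrow> (4 \<Rightarrow> free_alg) \<Rightarrow> free_alg set" where
  "Y_relations u Y = (\<Union>(k, l, m)\<in>cyclic_triples.
     {com (Y 0) (Y k) - anticom (Y l) (Y m),
      com (Y l) (Y m) + scalar (J_coeff u l m) * anticom (Y 0) (Y k)})"


section \<open>The curve \<open>F\<^sub>u\<close> and its parametrization\<close>

definition S_points :: "(complex^4) set set" where
  "S_points = line ` {vec4 1 0 0 0, vec4 0 1 0 0, vec4 0 0 1 0, vec4 0 0 0 1,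
     vec4 (-1) 1 1 1, vec4 1 (-1) 1 1, vec4 1 1 (-1) 1, vec4 1 1 1 (-1)}"

text \<open>
  \<open>F_fiber\<close> is the curve in the coordinates \<open>u\<^sub>\<mu>\<close>, and \<open>F_curve u\<close> the same curve in the coordinates \<open>Z = M u\<close>.
\<close>

definition F_fiber :: "complex^4 \<Rightarrow> (complex^4) set set" where
  "F_fiber u = S_points \<union> {line v | v. v \<noteq> 0 \<and> line v \<notin> S_points \<and> line (Phi v) = line (Phi u)}"

definition M_matrix :: "complex^4^4" where
  "M_matrix = (\<chi> i j. if i = 0 \<or> j = 0 \<or> i = j then 1/2 else -1/2)"

definition F_curve :: "complex^4 \<Rightarrow> (complex^4) set set" where
  "F_curve u = (\<lambda>p. (*v) M_matrix ` p) ` F_fiber u"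

definition e_point :: "4 \<Rightarrow> (complex^4) set" where
  "e_point \<nu> = line (axis \<nu> 1)"

text \<open>
  Theta functions for the lattice \<open>\<int> + \<int>\<tau>\<close>, through the series with characteristics \<open>a, b\<close>
  (absolutely convergent for \<open>Im \<tau> > 0\<close>); \<open>theta1\<close> is odd and vanishes exactly on the lattice.
\<close>

definition theta_char :: "real \<Rightarrow> real \<Rightarrow> complex \<Rightarrow> complex \<Rightarrow> complex" where
  "theta_char a b \<tau> z = (\<Sum>\<^sub>\<infinity>n\<in>(UNIV :: int set).
     exp (\<i> * of_real pi * \<tau> * (of_int n + of_real a)\<^sup>2
        + 2 * \<i> * of_real pi * (of_int n + of_real a) * (z + of_real b)))"

definition theta1 :: "complex \<Rightarrow> complex \<Rightarrow> complex" where
  "theta1 \<tau> z = - theta_char (1/2) (1/2) \<tau> z"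

definition theta2 :: "complex \<Rightarrow> complex \<Rightarrow> complex" where
  "theta2 \<tau> z = theta_char (1/2) 0 \<tau> z"

definition theta3 :: "complex \<Rightarrow> complex \<Rightarrow> complex" where
  "theta3 \<tau> z = theta_char 0 0 \<tau> z"

definition theta4 :: "complex \<Rightarrow> complex \<Rightarrow> complex" where
  "theta4 \<tau> z = theta_char 0 (1/2) \<tau> z"

text \<open>
  For generic \<open>u\<close> this forces \<open>theta1, \<dots>, theta4\<close> to be nonzero at \<open>\<eta>\<close>, because \<open>\<alpha>, \<beta>, \<gamma>\<close>
  are then nonzero and not all equal; no division by zero is hidden here or in \<open>phi\<close>.
\<close>

definition theta_parameters :: "complex^4 \<Rightarrow> complex \<Rightarrow> complex \<Rightarrow> bool" where
  "theta_parameters u \<omega> \<eta> \<longleftrightarrow> Im \<omega> > 0 \<and>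
     line (Phi u) = line (vector [(theta2 \<omega> 0)\<^sup>2 / (theta2 \<omega> \<eta>)\<^sup>2,
                                  (theta3 \<omega> 0)\<^sup>2 / (theta3 \<omega> \<eta>)\<^sup>2,
                                  (theta4 \<omega> 0)\<^sup>2 / (theta4 \<omega> \<eta>)\<^sup>2] :: complex^3)"

definition phi :: "complex \<Rightarrow> complex \<Rightarrow> complex \<Rightarrow> complex^4" where
  "phi \<omega> \<eta> z = vec4 (theta1 \<omega> (2 * z) / theta1 \<omega> \<eta>) (theta2 \<omega> (2 * z) / theta2 \<omega> \<eta>)
                     (theta3 \<omega> (2 * z) / theta3 \<omega> \<eta>) (theta4 \<omega> (2 * z) / theta4 \<omega> \<eta>)"

definition psi :: "complex \<Rightarrow> complex \<Rightarrow> complex \<Rightarrow> complex^4" where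
  "psi \<omega> \<eta> z = phi \<omega> \<eta> (z - \<eta> / 2)"

end

theory Submission
  imports Defs "HOL-Complex_Analysis.Conformal_Mappings"
begin

text \<open>
  Put \<open>v = M I\<^sub>0 Z\<close> and \<open>v' = M Z'\<close>, where \<open>I\<^sub>0\<close> changes the sign of \<open>Z\<^sub>0\<close>. As \<open>2M\<close> is the character
  table of the Klein four-group, the relations \<open>[Y\<^sub>0, Y\<^sub>k]\<^sub>- = [Y\<^sub>l, Y\<^sub>m]\<^sub>+\<close> say that the four products
  \<open>v\<^sub>i v'\<^sub>i\<close> coincide, and the whole correspondence \<open>\<Gamma>\<close> becomes symmetric in \<open>v\<close> and \<open>v'\<close>. Hence \<open>\<sigma>\<close> is
  \<open>M C M I\<^sub>0\<close> with \<open>C\<close> the standard Cremona involution \<open>v\<^sub>i \<mapsto> 1 / v\<^sub>i\<close>, a birational map over the rationals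
  not depending on \<open>u\<close>. The remaining relations at \<open>v' = C v\<close> factor into a term vanishing on the \<open>e\<^sub>\<nu>\<close>
  and a term vanishing on \<open>F\<^sub>u\<close>, which in these coordinates is the curve
  \<open>(v\<^sub>0 v\<^sub>1 + v\<^sub>2 v\<^sub>3 : v\<^sub>0 v\<^sub>2 + v\<^sub>1 v\<^sub>3 : v\<^sub>0 v\<^sub>3 + v\<^sub>1 v\<^sub>2) = (a : b : c)\<close> with \<open>a = \<beta> + \<gamma> - \<alpha>\<close> and its cyclic
  analogues; genericity means that \<open>a\<^sup>2, b\<^sup>2, c\<^sup>2\<close> are distinct. At the base points of \<open>C\<close>, \<open>\<sigma>\<close> is given by the
  maximal minors of other triples of relations.

  That \<open>\<psi>(z)\<close> and \<open>\<psi>(z - \<eta>)\<close> correspond follows from addition formulas, all of them consequences of the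
  product formula expressing \<open>\<theta>(x + y) \<theta>(x - y)\<close> through theta functions for the period \<open>2\<tau>\<close>. The squares of
  the \<open>\<theta>\<^sub>i\<close> span a two-dimensional space of such functions, each member of which has a zero by Liouville's
  theorem; so \<open>\<psi>\<close> reaches every point of \<open>F\<^sub>u\<close> up to the signs of its coordinates, and the signs are adjusted
  by \<open>x \<mapsto> - x\<close>, \<open>x \<mapsto> 1 - x\<close> and \<open>x \<mapsto> \<tau> - x\<close>.
\<close>

section \<open>Lines and forms\<close>

lemma UNIV_four: "(UNIV :: 4 set) = {0, 1, 2, 3}"
proof -
  have "(4 :: 4) = 0" by simp
  then show ?thesis unfolding UNIV_4 by auto
qed

lemma forall_four: "(\<forall>i::4. P i) \<longleftrightarrow> P 0 \<and> P 1 \<and> P 2 \<and> P 3"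
proof -
  have "(\<forall>i\<in>UNIV. P i) \<longleftrightarrow> P 0 \<and> P 1 \<and> P 2 \<and> P 3"
    unfolding UNIV_four by blast
  then show ?thesis by simp
qed

lemma sum_four: "sum f (UNIV :: 4 set) = f 0 + f 1 + f 2 + f 3"
  unfolding UNIV_four by (simp add: add.assoc)

lemma vec_eq_iff_four: "(v :: 'a^4) = w \<longleftrightarrow> v $ 0 = w $ 0 \<and> v $ 1 = w $ 1 \<and> v $ 2 = w $ 2 \<and> v $ 3 = w $ 3"
  by (simp add: vec_eq_iff forall_four)

lemma vec4_nth [simp]: "vec4 a b c d $ 0 = a" "vec4 a b c d $ 1 = b" "vec4 a b c d $ 2 = c" "vec4 a b c d $ 3 = d"
  by (simp_all add: vec4_def)

lemma line_eq: "line v = range (\<lambda>c. c *s v)"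
  by (simp add: line_def vec.span_singleton)

lemma line_eq_iff: "line v = line w \<longleftrightarrow> (\<exists>c. c \<noteq> 0 \<and> w = c *s v)"
proof
  assume "line v = line w"
  moreover have "x \<in> line x" for x :: "complex^'n"
    unfolding line_eq by (rule range_eqI[of _ _ 1]) simp
  ultimately have "w \<in> line v" "v \<in> line w" by auto
  then obtain c d where c: "w = c *s v" and d: "v = d *s w"
    unfolding line_eq by blast
  show "\<exists>c. c \<noteq> 0 \<and> w = c *s v"
  \<comment> \<open>If \<open>c = 0\<close> then both vectors vanish, and the factor 1 serves
    instead.\<close>
  proof (cases "c = 0")
    case True
    then have "w = 1 *s v" using c d by simp
    then show ?thesis by (intro exI[of _ 1]) simp
  qed (use c in blast)
next
  assume "\<exists>c. c \<noteq> 0 \<and> w = c *s v"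
  then obtain c where c: "c \<noteq> 0" "w = c *s v" by blast
  have "x *s v = (x / c) *s w" "x *s w = (x * c) *s v" for x using c by (simp_all add: vector_smult_assoc)
  then have "x \<in> line v \<longleftrightarrow> x \<in> line w" for x
    unfolding line_eq image_iff by blast
  then show "line v = line w" by blast
qed

lemma line_scale: "c \<noteq> 0 \<Longrightarrow> line (c *s v) = line v"
  unfolding line_eq_iff by (intro exI[of _ "inverse c"]) (simp add: vector_smult_assoc)

section \<open>Forms with coefficients in a subring of the complex numbers\<close>

definition coeff_ring :: "complex set \<Rightarrow> bool" where
  "coeff_ring K \<longleftrightarrow> 0 \<in> K \<and> 1 \<in> K \<and> -1 \<in> K \<and> (\<forall>x\<in>K. \<forall>y\<in>K. x + y \<in> K \<and> x * y \<in> K)"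

text \<open>Rational coefficients serve for the one birational map, arbitrary complex ones for the
  local formulas of \<open>\<sigma>\<close>, whose coefficients depend on \<open>u\<close>.\<close>

lemma coeff_ring_UNIV: "coeff_ring UNIV" and coeff_ring_Rats: "coeff_ring \<rat>"
  by (auto simp: coeff_ring_def)

lemma coeff_ring_sum: "coeff_ring K \<Longrightarrow> (\<And>x. x \<in> A \<Longrightarrow> f x \<in> K) \<Longrightarrow> sum f A \<in> K"
  by (induction A rule: infinite_finite_induct) (auto simp: coeff_ring_def)

lemma homog_poly_zero:
  assumes "coeff_ring K" shows "homog_poly K d (\<lambda>x. 0)"
  unfolding homog_poly_def using assms by (intro exI[of _ "\<lambda>_. 0"]) (auto simp: coeff_ring_def)

lemma homog_poly_add:
  assumes "coeff_ring K" "homog_poly K d f" "homog_poly K d g"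
  shows "homog_poly K d (\<lambda>x. f x + g x)"
proof -
  from assms(2,3) obtain c c' where
    "range c \<subseteq> K" "range c' \<subseteq> K"
    "\<And>x. f x = (\<Sum>e | sum e UNIV = d. c e * (\<Prod>i\<in>UNIV. (x $ i) ^ e i))"
    "\<And>x. g x = (\<Sum>e | sum e UNIV = d. c' e * (\<Prod>i\<in>UNIV. (x $ i) ^ e i))"
    unfolding homog_poly_def by blast
  with assms(1) show ?thesis
    unfolding homog_poly_def coeff_ring_def
    by (intro exI[of _ "\<lambda>e. c e + c' e"]) (auto simp: sum.distrib distrib_right image_subset_iff)
qed

text \<open>The coefficients of the product are the convolution \<open>k\<close>, summed over the
  pairs of exponents with a given sum; grouping the pairs by that sum turns the double sum into a
  form of degree \<open>d + d'\<close>.\<close>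

lemma homog_poly_mult:
  assumes K: "coeff_ring K" and "homog_poly K d f" "homog_poly K d' g"
  shows "homog_poly K (d + d') (\<lambda>x. f x * g x)"
proof -
  from assms(2,3) obtain c c' where c: "range c \<subseteq> K" "range c' \<subseteq> K"
    and f: "\<And>x. f x = (\<Sum>e | sum e UNIV = d. c e * (\<Prod>i\<in>UNIV. (x $ i) ^ e i))"
    and g: "\<And>x. g x = (\<Sum>e | sum e UNIV = d'. c' e * (\<Prod>i\<in>UNIV. (x $ i) ^ e i))"
    unfolding homog_poly_def by blast
  define S where "S = {e :: 4 \<Rightarrow> nat. sum e UNIV = d} \<times> {e :: 4 \<Rightarrow> nat. sum e UNIV = d'}"
  define a where "a = (\<lambda>(e, e') (i::4). e i + e' i :: nat)"
  have fin: "finite S" unfolding S_def by (intro finite_cartesian_product finite_exponents)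
  have sub: "a ` S \<subseteq> {e. sum e UNIV = d + d'}"
    by (auto simp: S_def a_def sum.distrib)
  define k where "k = (\<lambda>h. \<Sum>p | p \<in> S \<and> a p = h. c (fst p) * c' (snd p))"
  have "k h \<in> K" for h
    unfolding k_def using c K by (intro coeff_ring_sum) (auto simp: coeff_ring_def)
  moreover have "f x * g x = (\<Sum>h | sum h UNIV = d + d'. k h * (\<Prod>i\<in>UNIV. (x $ i) ^ h i))" for x
  proof -
    have "f x * g x = (\<Sum>p\<in>S. c (fst p) * c' (snd p) * (\<Prod>i\<in>UNIV. (x $ i) ^ a p i))"
      unfolding f g sum_product sum.cartesian_product S_def
      by (rule sum.cong) (auto simp: a_def power_add prod.distrib)
    also have "\<dots> = (\<Sum>h | sum h UNIV = d + d'. \<Sum>p | p \<in> S \<and> a p = h. c (fst p) * c' (snd p) * (\<Prod>i\<in>UNIV. (x $ i) ^ a p i))"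
      by (rule sum.group[OF fin finite_exponents sub, symmetric])
    also have "\<dots> = (\<Sum>h | sum h UNIV = d + d'. k h * (\<Prod>i\<in>UNIV. (x $ i) ^ h i))"
      by (auto simp: k_def sum_distrib_right intro!: sum.cong)
    finally show ?thesis .
  qed
  ultimately show ?thesis
    unfolding homog_poly_def by (intro exI[of _ k]) auto
qed

lemma homog_poly_coord:
  assumes "coeff_ring K" shows "homog_poly K 1 (\<lambda>x. x $ i)"
proof -
  define \<delta> :: "4 \<Rightarrow> nat" where "\<delta> = (\<lambda>j. if j = i then 1 else 0)"
  have "(\<Prod>j\<in>UNIV. (x $ j) ^ \<delta> j) = x $ i" for x :: "complex^4"
  proof -
    have "(\<Prod>j\<in>UNIV. (x $ j) ^ \<delta> j) = (\<Prod>j\<in>UNIV. if j = i then x $ j else 1)"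
      by (intro prod.cong) (auto simp: \<delta>_def)
    then show ?thesis by simp
  qed
  moreover have "sum \<delta> UNIV = 1" by (simp add: \<delta>_def)
  ultimately have "x $ i = (\<Sum>e | sum e UNIV = 1. (if e = \<delta> then 1 else 0) * (\<Prod>j\<in>UNIV. (x $ j) ^ e j))" for x :: "complex^4"
    using finite_exponents[of 1] by (simp add: if_distrib[of "\<lambda>c. c * _"] cong: if_cong)
  then show ?thesis
    unfolding homog_poly_def using assms
    by (intro exI[of _ "\<lambda>e. if e = \<delta> then 1 else 0"]) (auto simp: coeff_ring_def)
qed

lemma homog_poly_const:
  assumes "k \<in> K" shows "homog_poly K 0 (\<lambda>x. k)"
proof -
  have "{e :: 4 \<Rightarrow> nat. sum e UNIV = 0} = {\<lambda>_. 0}" by auto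
  then show ?thesis
    unfolding homog_poly_def using assms by (intro exI[of _ "\<lambda>_. k"]) auto
qed

lemma homog_poly_cmult:
  assumes "coeff_ring K" "k \<in> K" "homog_poly K d f"
  shows "homog_poly K d (\<lambda>x. k * f x)"
  using homog_poly_mult[OF assms(1) homog_poly_const[OF assms(2)] assms(3)] by simp

lemma homog_poly_minus:
  assumes "coeff_ring K" "homog_poly K d f"
  shows "homog_poly K d (\<lambda>x. - f x)"
  using homog_poly_cmult[OF assms(1) _ assms(2), of "-1"] assms(1) by (simp add: coeff_ring_def)

lemma homog_poly_diff:
  assumes "coeff_ring K" "homog_poly K d f" "homog_poly K d g"
  shows "homog_poly K d (\<lambda>x. f x - g x)"
  using homog_poly_add[OF assms(1,2) homog_poly_minus[OF assms(1,3)]] by simp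

lemma homog_poly_cubic:
  assumes "coeff_ring K" "homog_poly K 1 f" "homog_poly K 1 g" "homog_poly K 1 h"
  shows "homog_poly K 3 (\<lambda>x. f x * g x * h x)"
  using homog_poly_mult[OF assms(1) homog_poly_mult[OF assms(1-3)] assms(4)] by (simp add: numeral_eq_Suc)

section \<open>The correspondence in diagonal coordinates\<close>

definition dot4 :: "complex^4 \<Rightarrow> complex^4 \<Rightarrow> complex" where
  "dot4 p w = p $ 0 * w $ 0 + p $ 1 * w $ 1 + p $ 2 * w $ 2 + p $ 3 * w $ 3"

text \<open>The signed maximal minors of the 3 by 4 matrix with rows \<open>p\<close>,
  \<open>q\<close>, \<open>r\<close>.\<close>

definition cross4 :: "complex^4 \<Rightarrow> complex^4 \<Rightarrow> complex^4 \<Rightarrow> complex^4" where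
  "cross4 p q r = vec4
    (p$1*q$2*r$3 + p$2*q$3*r$1 + p$3*q$1*r$2 - p$3*q$2*r$1 - p$2*q$1*r$3 - p$1*q$3*r$2)
    (p$3*q$2*r$0 + p$2*q$0*r$3 + p$0*q$3*r$2 - p$0*q$2*r$3 - p$2*q$3*r$0 - p$3*q$0*r$2)
    (p$0*q$1*r$3 + p$1*q$3*r$0 + p$3*q$0*r$1 - p$3*q$1*r$0 - p$1*q$0*r$3 - p$0*q$3*r$1)
    (p$2*q$1*r$0 + p$1*q$0*r$2 + p$0*q$2*r$1 - p$0*q$1*r$2 - p$1*q$2*r$0 - p$2*q$0*r$1)"

text \<open>Three independent equations in four unknowns have a one-dimensional solution space.
  Concretely, each 2 by 2 minor of the pair \<open>cross4 p q r\<close>, \<open>w\<close> is a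
  combination of \<open>dot4 p w\<close>, \<open>dot4 q w\<close>, \<open>dot4 r w\<close> whose
  coefficients are 2 by 2 minors of two of the rows.\<close>

lemma cross4_unique:
  assumes "cross4 p q r \<noteq> 0" "dot4 p w = 0" "dot4 q w = 0" "dot4 r w = 0"
  shows "\<exists>k. w = k *s cross4 p q r"
proof -
  let ?C = "cross4 p q r"
  have
    "?C $ 0 * w $ 1 - ?C $ 1 * w $ 0 =
      (q$2 * r$3 - q$3 * r$2) * dot4 p w + (r$2 * p$3 - r$3 * p$2) * dot4 q w + (p$2 * q$3 - p$3 * q$2) * dot4 r w"
    "?C $ 0 * w $ 2 - ?C $ 2 * w $ 0 =
      (q$3 * r$1 - q$1 * r$3) * dot4 p w + (r$3 * p$1 - r$1 * p$3) * dot4 q w + (p$3 * q$1 - p$1 * q$3) * dot4 r w"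
    "?C $ 0 * w $ 3 - ?C $ 3 * w $ 0 =
      (q$1 * r$2 - q$2 * r$1) * dot4 p w + (r$1 * p$2 - r$2 * p$1) * dot4 q w + (p$1 * q$2 - p$2 * q$1) * dot4 r w"
    "?C $ 1 * w $ 2 - ?C $ 2 * w $ 1 =
      (q$0 * r$3 - q$3 * r$0) * dot4 p w + (r$0 * p$3 - r$3 * p$0) * dot4 q w + (p$0 * q$3 - p$3 * q$0) * dot4 r w"
    "?C $ 1 * w $ 3 - ?C $ 3 * w $ 1 =
      (q$2 * r$0 - q$0 * r$2) * dot4 p w + (r$2 * p$0 - r$0 * p$2) * dot4 q w + (p$2 * q$0 - p$0 * q$2) * dot4 r w"
    "?C $ 2 * w $ 3 - ?C $ 3 * w $ 2 =
      (q$0 * r$1 - q$1 * r$0) * dot4 p w + (r$0 * p$1 - r$1 * p$0) * dot4 q w + (p$0 * q$1 - p$1 * q$0) * dot4 r w"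
    unfolding dot4_def cross4_def vec4_nth by (simp_all add: algebra_simps)
  then have P: "?C $ 0 * w $ 1 = ?C $ 1 * w $ 0" "?C $ 0 * w $ 2 = ?C $ 2 * w $ 0" "?C $ 0 * w $ 3 = ?C $ 3 * w $ 0"
    "?C $ 1 * w $ 2 = ?C $ 2 * w $ 1" "?C $ 1 * w $ 3 = ?C $ 3 * w $ 1" "?C $ 2 * w $ 3 = ?C $ 3 * w $ 2"
    by (simp_all add: assms(2-4))
  have sym: "?C $ i * w $ j = ?C $ j * w $ i" for i j
  proof -
    have "\<forall>i j. ?C $ i * w $ j = ?C $ j * w $ i"
      unfolding forall_four using P by simp
    then show ?thesis by blast
  qed
  obtain i where "?C $ i \<noteq> 0" using assms(1) by (auto simp: vec_eq_iff)
  then have "w = (w $ i / ?C $ i) *s ?C"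
    using sym[of i] by (simp add: vec_eq_iff field_simps)
  then show ?thesis by blast
qed

section \<open>The symmetric correspondence and its curve\<close>

definition wedge :: "complex^4 \<Rightarrow> complex^4 \<Rightarrow> 4 \<Rightarrow> 4 \<Rightarrow> complex" where
  "wedge v w i j = v $ i * w $ j - v $ j * w $ i"

text \<open>The diagonal equations are symmetric in \<open>v\<close> and \<open>w\<close>, and the
  others are homogeneous linear in the antisymmetric \<open>wedge\<close>; this makes the invariance
  under exchange visible.\<close>

definition corr :: "complex \<Rightarrow> complex \<Rightarrow> complex \<Rightarrow> complex^4 \<Rightarrow> complex^4 \<Rightarrow> bool" where
  "corr a b c v w \<longleftrightarrow>
     v $ 0 * w $ 0 = v $ 1 * w $ 1 \<and> v $ 0 * w $ 0 = v $ 2 * w $ 2 \<and> v $ 0 * w $ 0 = v $ 3 * w $ 3 \<and>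
     b * (wedge v w 2 0 + wedge v w 3 1) = c * (wedge v w 2 1 + wedge v w 3 0) \<and>
     c * (wedge v w 3 0 + wedge v w 1 2) = a * (wedge v w 3 2 + wedge v w 1 0) \<and>
     a * (wedge v w 1 0 + wedge v w 2 3) = b * (wedge v w 1 3 + wedge v w 2 0)"

lemma corr_sym: "corr a b c v w \<longleftrightarrow> corr a b c w v"
  unfolding corr_def wedge_def by (auto simp: algebra_simps)

lemma corr_scale: "corr a b c v w \<Longrightarrow> corr a b c (k *s v) (l *s w)"
proof -
  assume c: "corr a b c v w"
  have "wedge (k *s v) (l *s w) i j = k * l * wedge v w i j" for i j
    by (simp add: wedge_def algebra_simps)
  with c show ?thesis
    unfolding corr_def by (simp add: mult.left_commute[of _ "k * l"] mult.assoc flip: distrib_left)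
      (auto simp: algebra_simps)
qed

text \<open>Proportionality of two triples, stated through minors, so that points where all three
  sums vanish, such as the coordinate vertices, are included.\<close>

definition on_curve :: "complex \<Rightarrow> complex \<Rightarrow> complex \<Rightarrow> complex^4 \<Rightarrow> bool" where
  "on_curve a b c v \<longleftrightarrow>
     b * (v $ 0 * v $ 3 + v $ 1 * v $ 2) = c * (v $ 0 * v $ 2 + v $ 1 * v $ 3) \<and>
     c * (v $ 0 * v $ 1 + v $ 2 * v $ 3) = a * (v $ 0 * v $ 3 + v $ 1 * v $ 2) \<and>
     a * (v $ 0 * v $ 2 + v $ 1 * v $ 3) = b * (v $ 0 * v $ 1 + v $ 2 * v $ 3)"

text \<open>Apart from 0, the solutions are the multiples of the sign vectors with an even number of
  minus signs; \<open>is_special_had\<close> identifies them with the points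
  \<open>e_point\<close>.\<close>

definition is_special :: "complex^4 \<Rightarrow> bool" where
  "is_special v \<longleftrightarrow> v $ 0 * v $ 1 = v $ 2 * v $ 3 \<and> v $ 0 * v $ 2 = v $ 1 * v $ 3 \<and> v $ 0 * v $ 3 = v $ 1 * v $ 2 \<and>
     (v $ 1)\<^sup>2 = (v $ 0)\<^sup>2 \<and> (v $ 2)\<^sup>2 = (v $ 0)\<^sup>2 \<and> (v $ 3)\<^sup>2 = (v $ 0)\<^sup>2"

definition cremona :: "complex^4 \<Rightarrow> complex^4" where
  "cremona v = vec4 (v $ 1 * v $ 2 * v $ 3) (v $ 0 * v $ 2 * v $ 3) (v $ 0 * v $ 1 * v $ 3) (v $ 0 * v $ 1 * v $ 2)"

lemma cremona_cremona: "cremona (cremona v) = (v $ 0 * v $ 1 * v $ 2 * v $ 3)\<^sup>2 *s v"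
  by (simp add: cremona_def vec_eq_iff_four power2_eq_square)

text \<open>For \<open>w = cremona v\<close> every \<open>v $ i * w $ i\<close> is the product of
  the four coordinates, so only the wedge equations remain; each factors into a difference and one
  equation of \<open>on_curve\<close>.\<close>

lemma corr_cremona_iff:
  "corr a b c v (cremona v) \<longleftrightarrow>
     (v $ 2 * v $ 3 - v $ 0 * v $ 1) * (b * (v $ 0 * v $ 3 + v $ 1 * v $ 2) - c * (v $ 0 * v $ 2 + v $ 1 * v $ 3)) = 0 \<and>
     (v $ 3 * v $ 1 - v $ 0 * v $ 2) * (c * (v $ 0 * v $ 1 + v $ 2 * v $ 3) - a * (v $ 0 * v $ 3 + v $ 1 * v $ 2)) = 0 \<and>
     (v $ 1 * v $ 2 - v $ 0 * v $ 3) * (a * (v $ 0 * v $ 2 + v $ 1 * v $ 3) - b * (v $ 0 * v $ 1 + v $ 2 * v $ 3)) = 0"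
proof -
  let ?w = "wedge v (cremona v)"
  have "b * (?w 2 0 + ?w 3 1) - c * (?w 2 1 + ?w 3 0) =
      (v $ 2 * v $ 3 - v $ 0 * v $ 1) * (b * (v $ 0 * v $ 3 + v $ 1 * v $ 2) - c * (v $ 0 * v $ 2 + v $ 1 * v $ 3))"
    "c * (?w 3 0 + ?w 1 2) - a * (?w 3 2 + ?w 1 0) =
      (v $ 3 * v $ 1 - v $ 0 * v $ 2) * (c * (v $ 0 * v $ 1 + v $ 2 * v $ 3) - a * (v $ 0 * v $ 3 + v $ 1 * v $ 2))"
    "a * (?w 1 0 + ?w 2 3) - b * (?w 1 3 + ?w 2 0) =
      (v $ 1 * v $ 2 - v $ 0 * v $ 3) * (a * (v $ 0 * v $ 2 + v $ 1 * v $ 3) - b * (v $ 0 * v $ 1 + v $ 2 * v $ 3))"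
    unfolding wedge_def cremona_def vec4_nth by (simp_all add: algebra_simps)
  moreover have "v $ i * cremona v $ i = v $ 0 * cremona v $ 0" for i
  proof -
    have "\<forall>i. v $ i * cremona v $ i = v $ 0 * cremona v $ 0"
      unfolding forall_four by (simp add: cremona_def)
    then show ?thesis by blast
  qed
  ultimately show ?thesis
    unfolding corr_def by (metis eq_iff_diff_eq_0)
qed

locale curve_params =
  fixes a b c :: complex
  assumes ab: "a\<^sup>2 \<noteq> b\<^sup>2" and bc: "b\<^sup>2 \<noteq> c\<^sup>2" and ca: "c\<^sup>2 \<noteq> a\<^sup>2"
begin

text \<open>The three ways to pair off the coordinates give \<open>p, p'\<close>,
  \<open>q, q'\<close>, \<open>r, r'\<close> with one common product. Each factored equation leaves
  a choice between an equality such as \<open>p' = p\<close> and a curve equation. With no equality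
  \<open>v\<close> is on the curve; with exactly one, the two remaining curve equations imply the
  third; exactly two contradict the distinct squares; all three make \<open>v\<close>
  special.\<close>

lemma corr_cremona_imp_on_curve:
  assumes "corr a b c v (cremona v)" and nz: "v $ 0 \<noteq> 0" "v $ 1 \<noteq> 0" "v $ 2 \<noteq> 0" "v $ 3 \<noteq> 0"
  shows "on_curve a b c v \<or> is_special v"
proof -
  define p where "p = v $ 0 * v $ 1" define p' where "p' = v $ 2 * v $ 3"
  define q where "q = v $ 0 * v $ 2" define q' where "q' = v $ 1 * v $ 3"
  define r where "r = v $ 0 * v $ 3" define r' where "r' = v $ 1 * v $ 2"
  note defs = p_def p'_def q_def q'_def r_def r'_def
  have n: "p \<noteq> 0" "q \<noteq> 0" "r \<noteq> 0" using nz by (auto simp: defs)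
  have pqr: "p * p' = q * q'" "q * q' = r * r'" "r * r' = p * p'" by (simp_all add: defs)
  have cases: "p' = p \<or> b * (r + r') = c * (q + q')" "q' = q \<or> c * (p + p') = a * (r + r')"
    "r' = r \<or> a * (q + q') = b * (p + p')"
    using assms(1) unfolding corr_cremona_iff defs by (simp_all add: mult.commute)
  \<comment> \<open>Here \<open>x * x = y * y\<close> while \<open>A * y = B * x\<close>, so
    \<open>A\<close> and \<open>B\<close> would have equal squares.\<close>
  have two: False
    if "x' = x" "y' = y" "A * (y + y') = B * (x + x')" "x * x' = y * y'" "x \<noteq> 0" "A\<^sup>2 \<noteq> B\<^sup>2"
    for x x' y y' A B :: complex
  proof -
    have "A * y = B * x" using that by simp
    then have "A\<^sup>2 * y\<^sup>2 = B\<^sup>2 * x\<^sup>2" by (metis power_mult_distrib)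
    moreover have "y\<^sup>2 = x\<^sup>2" using that by (simp add: power2_eq_square)
    ultimately show False using that by simp
  qed
  \<comment> \<open>If \<open>A\<close> were zero, \<open>B\<close> and \<open>C\<close> would both
    vanish; cancelling \<open>A\<close> gives the third equation.\<close>
  have one: "B * z = C * y" if "C * (x + x) = A * z" "A * y = B * (x + x)" "x \<noteq> 0" "B\<^sup>2 \<noteq> C\<^sup>2"
    for x y z A B C :: complex
  proof -
    have "A \<noteq> 0" using that by auto
    moreover have "A * (B * z) = A * (C * y)" using that by (metis mult.left_commute)
    ultimately show ?thesis by simp
  qed
  have on: "on_curve a b c v \<longleftrightarrow> b * (r + r') = c * (q + q') \<and> c * (p + p') = a * (r + r') \<and> a * (q + q') = b * (p + p')"
    by (simp add: on_curve_def defs)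
  have sp: "is_special v" if "p' = p" "q' = q" "r' = r"
  proof -
    have "p * p = q * q" using pqr(1) that by simp
    moreover have "p * p = r * r" using pqr(3) that by simp
    moreover have "p * p = p' * p'" using that by simp
    moreover have "(v $ 0)\<^sup>2 * (v $ 1)\<^sup>2 = p * p" "(v $ 0)\<^sup>2 * (v $ 2)\<^sup>2 = q * q"
      "(v $ 0)\<^sup>2 * (v $ 3)\<^sup>2 = r * r" "(v $ 2)\<^sup>2 * (v $ 3)\<^sup>2 = p' * p'"
      by (simp_all add: defs power2_eq_square)
    ultimately have "(v $ 0)\<^sup>2 * (v $ 1)\<^sup>2 = (v $ 0)\<^sup>2 * (v $ 2)\<^sup>2" "(v $ 0)\<^sup>2 * (v $ 1)\<^sup>2 = (v $ 0)\<^sup>2 * (v $ 3)\<^sup>2"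
      "(v $ 0)\<^sup>2 * (v $ 1)\<^sup>2 = (v $ 2)\<^sup>2 * (v $ 3)\<^sup>2"
      by metis+
    then have e: "(v $ 1)\<^sup>2 = (v $ 2)\<^sup>2" "(v $ 1)\<^sup>2 = (v $ 3)\<^sup>2" "(v $ 0)\<^sup>2 * (v $ 1)\<^sup>2 = (v $ 2)\<^sup>2 * (v $ 3)\<^sup>2"
      using nz by simp_all
    then have "(v $ 0)\<^sup>2 * (v $ 1)\<^sup>2 = (v $ 1)\<^sup>2 * (v $ 1)\<^sup>2" by metis
    then have "(v $ 0)\<^sup>2 = (v $ 1)\<^sup>2" by (simp only: mult_cancel_right) (use nz in simp)
    then have "(v $ 1)\<^sup>2 = (v $ 0)\<^sup>2" "(v $ 2)\<^sup>2 = (v $ 0)\<^sup>2" "(v $ 3)\<^sup>2 = (v $ 0)\<^sup>2"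
      using e(1,2) by simp_all
    with that show ?thesis unfolding is_special_def defs by metis
  qed
  show ?thesis
  proof (cases "p' = p")
    case p: True
    show ?thesis
    proof (cases "q' = q")
      case q: True
      then have "r' = r" using cases(3) two[OF p q _ pqr(1) n(1) ab] by auto
      then show ?thesis using sp p q by blast
    next
      case q: False
      then have "r' \<noteq> r" using cases(2) two[of r' r p' p c a] p pqr(3) n(3) ca by auto
      then show ?thesis using cases q p one[of c p a "r + r'" "q + q'" b] n(1) bc unfolding on by simp
    qed
  next
    case p: False
    show ?thesis
    proof (cases "q' = q")
      case q: True
      then have "r' \<noteq> r" using cases(1) two[of q' q r' r b c] p pqr(2) n(2) bc by auto
      then show ?thesis using cases q p one[of a q b "p + p'" "r + r'" c] n(2) ca unfolding on by simp
    next
      case q: False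
      then show ?thesis using cases p one[of b r c "q + q'" "p + p'" a] n(3) ab unfolding on by auto
    qed
  qed
qed

text \<open>This treats a \<open>v\<close> with two zero coordinates whose partner vanishes at the
  other two: \<open>x\<close>, \<open>y\<close> are the remaining coordinates of \<open>v\<close>,
  and \<open>z\<close>, \<open>w\<close> those of the partner. Nonzero \<open>x\<close>,
  \<open>y\<close> would give \<open>B * z = C * w\<close> and \<open>B * w = C * z\<close>, hence
  equal squares.\<close>

lemma two_zero:
  assumes "B\<^sup>2 \<noteq> C\<^sup>2" "B * (x * z + y * w) = C * (x * w + y * z)" "C * (y * z) = C * (x * w)"
    "B * (y * w) = B * (x * z)" "z \<noteq> 0 \<or> w \<noteq> 0"
  shows "x * y = (0::complex)"
proof (rule ccontr)
  assume n: "x * y \<noteq> 0"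
  have s: "B * (x * z) + B * (y * w) = C * (x * w) + C * (y * z)"
    using assms(2) by (simp add: distrib_left)
  have "2 * (B * (x * z)) = 2 * (C * (x * w))" "2 * (B * (y * w)) = 2 * (C * (y * z))"
    using s unfolding assms(3,4) by simp_all
  then have "x * (B * z) = x * (C * w)" "y * (B * w) = y * (C * z)" by (simp_all add: ac_simps)
  then have 1: "B * z = C * w" "B * w = C * z" using n by simp_all
  have "B\<^sup>2 * z = B * (C * w)" "B\<^sup>2 * w = B * (C * z)" by (simp_all add: power2_eq_square mult.assoc 1)
  then have "B\<^sup>2 * z = C\<^sup>2 * z" "B\<^sup>2 * w = C\<^sup>2 * w"
    using 1 by (simp_all add: power2_eq_square mult.left_commute mult.assoc)
  then show False using assms(1,5) by simp
qed

text \<open>The common value of the products \<open>v $ i * w $ i\<close> decides. If it is nonzero,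
  \<open>w\<close> is a multiple of \<open>cremona v\<close>. If it is zero, then \<open>v\<close>
  or \<open>w\<close> vanishes at each index, and the zero coordinates of \<open>v\<close> are
  counted.\<close>

lemma corr_imp_on_curve:
  assumes c: "corr a b c v w" and v: "v \<noteq> 0" and w: "w \<noteq> 0"
  shows "on_curve a b c v \<or> is_special v"
proof (cases "v $ 0 * w $ 0 = 0")
  case False
  define l where "l = w $ 0 / (v $ 1 * v $ 2 * v $ 3)"
  have nz: "v $ 0 \<noteq> 0" "v $ 1 \<noteq> 0" "v $ 2 \<noteq> 0" "v $ 3 \<noteq> 0" "w $ 0 \<noteq> 0"
    using False c unfolding corr_def by auto
  have "w = l *s cremona v"
    using c nz unfolding vec_eq_iff_four corr_def l_def cremona_def
    by (auto simp: divide_simps) (simp_all add: ac_simps)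
  moreover have "l \<noteq> 0" using nz by (simp add: l_def)
  ultimately have "corr a b c v (cremona v)"
    using corr_scale[OF c, of 1 "1 / l"] by (simp add: vector_smult_assoc)
  then show ?thesis using corr_cremona_imp_on_curve nz by blast
next
  case True
  then have z: "v $ 0 = 0 \<or> w $ 0 = 0" "v $ 1 = 0 \<or> w $ 1 = 0" "v $ 2 = 0 \<or> w $ 2 = 0" "v $ 3 = 0 \<or> w $ 3 = 0"
    using c unfolding corr_def by auto
  have r: "b * (wedge v w 2 0 + wedge v w 3 1) = c * (wedge v w 2 1 + wedge v w 3 0)"
     "c * (wedge v w 3 0 + wedge v w 1 2) = a * (wedge v w 3 2 + wedge v w 1 0)"
     "a * (wedge v w 1 0 + wedge v w 2 3) = b * (wedge v w 1 3 + wedge v w 2 0)"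
    using c unfolding corr_def by blast+
  have n: "w $ 0 \<noteq> 0 \<or> w $ 1 \<noteq> 0 \<or> w $ 2 \<noteq> 0 \<or> w $ 3 \<noteq> 0"
    using w by (simp add: vec_eq_iff_four)
  \<comment> \<open>If two coordinates of \<open>v\<close> vanish, so does a third, and then all
    sums in \<open>on_curve\<close> are zero. The six cases are the six pairs of indices.\<close>
  have p01: "v $ 2 * v $ 3 = 0" if "v $ 0 = 0" "v $ 1 = 0"
  proof (rule ccontr)
    assume "v $ 2 * v $ 3 \<noteq> 0"
    with z n that have h: "w $ 2 = 0" "w $ 3 = 0" "w $ 0 \<noteq> 0 \<or> w $ 1 \<noteq> 0" by auto
    have "v $ 2 * v $ 3 = 0"
      by (rule two_zero[of b c "v $ 2" "w $ 0" "v $ 3" "w $ 1"])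
        (use r h that ab bc ca in \<open>auto simp: wedge_def algebra_simps\<close>)
    then show False using \<open>v $ 2 * v $ 3 \<noteq> 0\<close> by blast
  qed
  have p23: "v $ 0 * v $ 1 = 0" if "v $ 2 = 0" "v $ 3 = 0"
  proof (rule ccontr)
    assume "v $ 0 * v $ 1 \<noteq> 0"
    with z n that have h: "w $ 0 = 0" "w $ 1 = 0" "w $ 2 \<noteq> 0 \<or> w $ 3 \<noteq> 0" by auto
    have "v $ 0 * v $ 1 = 0"
      by (rule two_zero[of b c "v $ 0" "w $ 2" "v $ 1" "w $ 3"])
        (use r h that ab bc ca in \<open>auto simp: wedge_def algebra_simps\<close>)
    then show False using \<open>v $ 0 * v $ 1 \<noteq> 0\<close> by blast
  qed
  have p02: "v $ 1 * v $ 3 = 0" if "v $ 0 = 0" "v $ 2 = 0"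
  proof (rule ccontr)
    assume "v $ 1 * v $ 3 \<noteq> 0"
    with z n that have h: "w $ 1 = 0" "w $ 3 = 0" "w $ 0 \<noteq> 0 \<or> w $ 2 \<noteq> 0" by auto
    have "v $ 1 * v $ 3 = 0"
      by (rule two_zero[of a c "v $ 1" "w $ 0" "v $ 3" "w $ 2"])
        (use r h that ab bc ca in \<open>auto simp: wedge_def algebra_simps\<close>)
    then show False using \<open>v $ 1 * v $ 3 \<noteq> 0\<close> by blast
  qed
  have p13: "v $ 0 * v $ 2 = 0" if "v $ 1 = 0" "v $ 3 = 0"
  proof (rule ccontr)
    assume "v $ 0 * v $ 2 \<noteq> 0"
    with z n that have h: "w $ 0 = 0" "w $ 2 = 0" "w $ 1 \<noteq> 0 \<or> w $ 3 \<noteq> 0" by auto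
    have "v $ 0 * v $ 2 = 0"
      by (rule two_zero[of a c "v $ 0" "w $ 1" "v $ 2" "w $ 3"])
        (use r h that ab bc ca in \<open>auto simp: wedge_def algebra_simps\<close>)
    then show False using \<open>v $ 0 * v $ 2 \<noteq> 0\<close> by blast
  qed
  have p03: "v $ 1 * v $ 2 = 0" if "v $ 0 = 0" "v $ 3 = 0"
  proof (rule ccontr)
    assume "v $ 1 * v $ 2 \<noteq> 0"
    with z n that have h: "w $ 1 = 0" "w $ 2 = 0" "w $ 0 \<noteq> 0 \<or> w $ 3 \<noteq> 0" by auto
    have "v $ 1 * v $ 2 = 0"
      by (rule two_zero[of a b "v $ 1" "w $ 0" "v $ 2" "w $ 3"])
        (use r h that ab bc ca in \<open>auto simp: wedge_def algebra_simps\<close>)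
    then show False using \<open>v $ 1 * v $ 2 \<noteq> 0\<close> by blast
  qed
  have p12: "v $ 0 * v $ 3 = 0" if "v $ 1 = 0" "v $ 2 = 0"
  proof (rule ccontr)
    assume "v $ 0 * v $ 3 \<noteq> 0"
    with z n that have h: "w $ 0 = 0" "w $ 3 = 0" "w $ 1 \<noteq> 0 \<or> w $ 2 \<noteq> 0" by auto
    have "v $ 0 * v $ 3 = 0"
      by (rule two_zero[of a b "v $ 0" "w $ 1" "v $ 3" "w $ 2"])
        (use r h that ab bc ca in \<open>auto simp: wedge_def algebra_simps\<close>)
    then show False using \<open>v $ 0 * v $ 3 \<noteq> 0\<close> by blast
  qed
  \<comment> \<open>With exactly one zero coordinate in \<open>v\<close>, the partner is a multiple
    of the corresponding coordinate vector, and the wedge equations reduce to proportions between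
    the other three coordinates of \<open>v\<close>.\<close>
  have s0: "on_curve a b c v" if "v $ 0 = 0" "v $ 1 \<noteq> 0" "v $ 2 \<noteq> 0" "v $ 3 \<noteq> 0"
  proof -
    from z n that have "w $ 1 = 0" "w $ 2 = 0" "w $ 3 = 0" "w $ 0 \<noteq> 0" by auto
    with r that have "a * v $ 1 = b * v $ 2" "b * v $ 2 = c * v $ 3"
      by (simp_all add: wedge_def flip: mult.assoc)
    with that show ?thesis unfolding on_curve_def by simp
  qed
  have s1: "on_curve a b c v" if "v $ 1 = 0" "v $ 0 \<noteq> 0" "v $ 2 \<noteq> 0" "v $ 3 \<noteq> 0"
  proof -
    from z n that have "w $ 0 = 0" "w $ 2 = 0" "w $ 3 = 0" "w $ 1 \<noteq> 0" by auto
    with r that have "a * v $ 0 = b * v $ 3" "b * v $ 3 = c * v $ 2"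
      by (simp_all add: wedge_def flip: mult.assoc)
    with that show ?thesis unfolding on_curve_def by simp
  qed
  have s2: "on_curve a b c v" if "v $ 2 = 0" "v $ 0 \<noteq> 0" "v $ 1 \<noteq> 0" "v $ 3 \<noteq> 0"
  proof -
    from z n that have "w $ 0 = 0" "w $ 1 = 0" "w $ 3 = 0" "w $ 2 \<noteq> 0" by auto
    with r that have "a * v $ 3 = b * v $ 0" "b * v $ 0 = c * v $ 1"
      by (simp_all add: wedge_def flip: mult.assoc)
    with that show ?thesis unfolding on_curve_def by simp
  qed
  have s3: "on_curve a b c v" if "v $ 3 = 0" "v $ 0 \<noteq> 0" "v $ 1 \<noteq> 0" "v $ 2 \<noteq> 0"
  proof -
    from z n that have "w $ 0 = 0" "w $ 1 = 0" "w $ 2 = 0" "w $ 3 \<noteq> 0" by auto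
    with r that have "a * v $ 2 = b * v $ 1" "b * v $ 1 = c * v $ 0"
      by (simp_all add: wedge_def flip: mult.assoc)
    with that show ?thesis unfolding on_curve_def by simp
  qed
  show ?thesis
  proof (cases "v $ 0 = 0 \<and> v $ 1 = 0 \<or> v $ 2 = 0 \<and> v $ 3 = 0 \<or> v $ 0 = 0 \<and> v $ 2 = 0 \<or>
      v $ 1 = 0 \<and> v $ 3 = 0 \<or> v $ 0 = 0 \<and> v $ 3 = 0 \<or> v $ 1 = 0 \<and> v $ 2 = 0")
    case True
    then have "on_curve a b c v"
      using p01 p23 p02 p13 p03 p12 unfolding on_curve_def by auto
    then show ?thesis by blast
  next
    case False
    moreover have "v $ 0 = 0 \<or> v $ 1 = 0 \<or> v $ 2 = 0 \<or> v $ 3 = 0" using z n by auto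
    ultimately show ?thesis using s0 s1 s2 s3 by blast
  qed
qed

end

section \<open>Local formulas for the correspondence\<close>

definition diag_row :: "4 \<Rightarrow> 4 \<Rightarrow> complex^4 \<Rightarrow> complex^4" where
  "diag_row i j v = axis i (v $ i) - axis j (v $ j)"

text \<open>Like \<open>diag_row\<close>, the two wedge rows are linear in \<open>v\<close> and hold
  the coefficients of equations of \<open>corr\<close>, read as linear equations in
  \<open>w\<close>.\<close>

definition wedge_row1 :: "complex \<Rightarrow> complex \<Rightarrow> complex^4 \<Rightarrow> complex^4" where
  "wedge_row1 b c v = vec4 (b * v $ 2 - c * v $ 3) (b * v $ 3 - c * v $ 2) (c * v $ 1 - b * v $ 0) (c * v $ 0 - b * v $ 1)"

definition wedge_row2 :: "complex \<Rightarrow> complex \<Rightarrow> complex^4 \<Rightarrow> complex^4" where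
  "wedge_row2 c a v = vec4 (c * v $ 3 - a * v $ 1) (a * v $ 0 - c * v $ 2) (c * v $ 1 - a * v $ 3) (a * v $ 2 - c * v $ 0)"

text \<open>Rows of linear forms whose cross product is, on the characteristic variety, a local formula for \<open>\<sigma>\<close>.\<close>

definition charts :: "complex \<Rightarrow> complex \<Rightarrow> complex \<Rightarrow> (complex^4 \<Rightarrow> complex^4) set" where
  "charts a b c = {\<lambda>v. cross4 (diag_row 0 1 v) (diag_row 0 2 v) (diag_row 0 3 v),
     \<lambda>v. cross4 (diag_row 0 1 v) (wedge_row1 b c v) (wedge_row2 c a v),
     \<lambda>v. cross4 (diag_row 2 3 v) (wedge_row1 b c v) (wedge_row2 c a v)}"

lemma axis_nth_four [simp]:
  "axis 0 x $ (0::4) = x" "axis 0 x $ (1::4) = 0" "axis 0 x $ (2::4) = 0" "axis 0 x $ (3::4) = 0"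
  "axis 1 x $ (0::4) = 0" "axis 1 x $ (1::4) = x" "axis 1 x $ (2::4) = 0" "axis 1 x $ (3::4) = 0"
  "axis 2 x $ (0::4) = 0" "axis 2 x $ (1::4) = 0" "axis 2 x $ (2::4) = x" "axis 2 x $ (3::4) = 0"
  "axis 3 x $ (0::4) = 0" "axis 3 x $ (1::4) = 0" "axis 3 x $ (2::4) = 0" "axis 3 x $ (3::4) = x"
  by (simp_all add: axis_def)

lemma corr_imp_dot4_rows:
  assumes "corr a b c v w"
  shows "dot4 (diag_row 0 1 v) w = 0" "dot4 (diag_row 0 2 v) w = 0" "dot4 (diag_row 0 3 v) w = 0"
    "dot4 (diag_row 2 3 v) w = 0" "dot4 (wedge_row1 b c v) w = 0" "dot4 (wedge_row2 c a v) w = 0"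
proof -
  have "dot4 (diag_row 0 1 v) w = v $ 0 * w $ 0 - v $ 1 * w $ 1" "dot4 (diag_row 0 2 v) w = v $ 0 * w $ 0 - v $ 2 * w $ 2"
    "dot4 (diag_row 0 3 v) w = v $ 0 * w $ 0 - v $ 3 * w $ 3" "dot4 (diag_row 2 3 v) w = v $ 2 * w $ 2 - v $ 3 * w $ 3"
    "dot4 (wedge_row1 b c v) w = b * (wedge v w 2 0 + wedge v w 3 1) - c * (wedge v w 2 1 + wedge v w 3 0)"
    "dot4 (wedge_row2 c a v) w = c * (wedge v w 3 0 + wedge v w 1 2) - a * (wedge v w 3 2 + wedge v w 1 0)"
    unfolding dot4_def diag_row_def wedge_row1_def wedge_row2_def wedge_def
    by (simp_all add: algebra_simps)
  moreover have "v $ 1 * w $ 1 = v $ 0 * w $ 0" "v $ 2 * w $ 2 = v $ 0 * w $ 0" "v $ 3 * w $ 3 = v $ 0 * w $ 0"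
    "b * (wedge v w 2 0 + wedge v w 3 1) - c * (wedge v w 2 1 + wedge v w 3 0) = 0"
    "c * (wedge v w 3 0 + wedge v w 1 2) - a * (wedge v w 3 2 + wedge v w 1 0) = 0"
    using assms unfolding corr_def eq_iff_diff_eq_0[symmetric] by metis+
  ultimately show "dot4 (diag_row 0 1 v) w = 0" "dot4 (diag_row 0 2 v) w = 0" "dot4 (diag_row 0 3 v) w = 0"
    "dot4 (diag_row 2 3 v) w = 0" "dot4 (wedge_row1 b c v) w = 0" "dot4 (wedge_row2 c a v) w = 0"
    by (simp_all only: diff_self)
qed

lemma chart_unique:
  assumes "T \<in> charts a b c" "T v \<noteq> 0" "corr a b c v w"
  shows "\<exists>k. w = k *s T v"
  using assms(1,2) corr_imp_dot4_rows[OF assms(3)] unfolding charts_def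
  by (auto intro!: cross4_unique)

text \<open>The first chart is the Cremona map up to sign, so the other two only have to cover its
  zeros.\<close>

lemma cremona_chart: "cross4 (diag_row 0 1 v) (diag_row 0 2 v) (diag_row 0 3 v) = - cremona v"
  by (simp add: cross4_def diag_row_def cremona_def vec_eq_iff_four)

context curve_params
begin

lemma at_most_one_zero: "a * b \<noteq> 0 \<or> b * c \<noteq> 0 \<or> c * a \<noteq> 0"
  using ab bc ca by auto

text \<open>A zero of \<open>cremona\<close> has two vanishing coordinates. On the curve, the
  product of the other two is then annihilated by two of \<open>a\<close>, \<open>b\<close>,
  \<open>c\<close>, which are not both zero, so a third coordinate vanishes and only the coordinate
  vertices remain.\<close>

lemma on_curve_cremona_zero:
  assumes "on_curve a b c v \<or> is_special v" "v \<noteq> 0" "cremona v = 0"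
  shows "\<exists>i k. k \<noteq> 0 \<and> v = k *s axis i 1"
proof -
  have z: "v $ 1 * v $ 2 * v $ 3 = 0" "v $ 0 * v $ 2 * v $ 3 = 0" "v $ 0 * v $ 1 * v $ 3 = 0" "v $ 0 * v $ 1 * v $ 2 = 0"
    using assms(3) by (simp_all add: cremona_def vec_eq_iff_four)
  have nz: "v $ 0 \<noteq> 0 \<or> v $ 1 \<noteq> 0 \<or> v $ 2 \<noteq> 0 \<or> v $ 3 \<noteq> 0" using assms(2) by (simp add: vec_eq_iff_four)
  have nsp: "\<not> is_special v" using z nz unfolding is_special_def by auto
  then have on: "on_curve a b c v" using assms(1) by blast
  have ax: "v = v $ i *s axis i 1" if "\<forall>j. j \<noteq> i \<longrightarrow> v $ j = 0" for i
    using that by (auto simp: vec_eq_iff axis_def)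
  have "\<exists>i. \<forall>j. j \<noteq> i \<longrightarrow> v $ j = 0"
  proof -
    have "v $ 0 = 0 \<and> v $ 1 = 0 \<longrightarrow> v $ 2 = 0 \<or> v $ 3 = 0" "v $ 2 = 0 \<and> v $ 3 = 0 \<longrightarrow> v $ 0 = 0 \<or> v $ 1 = 0" "v $ 0 = 0 \<and> v $ 2 = 0 \<longrightarrow> v $ 1 = 0 \<or> v $ 3 = 0" "v $ 1 = 0 \<and> v $ 3 = 0 \<longrightarrow> v $ 0 = 0 \<or> v $ 2 = 0" "v $ 0 = 0 \<and> v $ 3 = 0 \<longrightarrow> v $ 1 = 0 \<or> v $ 2 = 0" "v $ 1 = 0 \<and> v $ 2 = 0 \<longrightarrow> v $ 0 = 0 \<or> v $ 3 = 0"
      using on at_most_one_zero unfolding on_curve_def by auto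
    moreover have "v $ 0 = 0 \<and> v $ 1 = 0 \<or> v $ 2 = 0 \<and> v $ 3 = 0 \<or> v $ 0 = 0 \<and> v $ 2 = 0 \<or> v $ 1 = 0 \<and> v $ 3 = 0 \<or> v $ 0 = 0 \<and> v $ 3 = 0 \<or> v $ 1 = 0 \<and> v $ 2 = 0"
      using z unfolding mult_eq_0_iff by argo
    ultimately have *: "v $ 1 = 0 \<and> v $ 2 = 0 \<and> v $ 3 = 0 \<or> v $ 0 = 0 \<and> v $ 2 = 0 \<and> v $ 3 = 0 \<or>
        v $ 0 = 0 \<and> v $ 1 = 0 \<and> v $ 3 = 0 \<or> v $ 0 = 0 \<and> v $ 1 = 0 \<and> v $ 2 = 0"
      by argo
    have "\<forall>j. j \<noteq> i \<longrightarrow> v $ j = 0" if "i = 0 \<and> v $ 1 = 0 \<and> v $ 2 = 0 \<and> v $ 3 = 0 \<or> i = 1 \<and> v $ 0 = 0 \<and> v $ 2 = 0 \<and> v $ 3 = 0 \<or>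
        i = 2 \<and> v $ 0 = 0 \<and> v $ 1 = 0 \<and> v $ 3 = 0 \<or> i = 3 \<and> v $ 0 = 0 \<and> v $ 1 = 0 \<and> v $ 2 = 0" for i
      unfolding forall_four using that by auto
    then show ?thesis using * by metis
  qed
  then obtain i where "\<forall>j. j \<noteq> i \<longrightarrow> v $ j = 0" by blast
  note v = ax[OF this]
  with assms(2) have "v $ i \<noteq> 0" by auto
  with v show ?thesis by blast
qed

text \<open>Away from the vertices the Cremona chart works; the second chart covers the vertices 0
  and 1, the third the vertices 2 and 3.\<close>

lemma chart_cover:
  assumes "on_curve a b c v \<or> is_special v" "v \<noteq> 0"
  shows "\<exists>T\<in>charts a b c. T v \<noteq> 0"
proof (cases "cremona v = 0")
  case False
  then show ?thesis unfolding charts_def cremona_chart by simp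
next
  case True
  then obtain i k where k: "k \<noteq> 0" and v: "v = k *s axis i 1"
    using on_curve_cremona_zero assms by blast
  have "\<forall>i. i = 0 \<or> i = 1 \<longrightarrow> cross4 (diag_row 0 1 (k *s axis i 1)) (wedge_row1 b c (k *s axis i 1)) (wedge_row2 c a (k *s axis i 1)) \<noteq> 0"
    using k at_most_one_zero unfolding forall_four
    by (auto simp: cross4_def diag_row_def wedge_row1_def wedge_row2_def vec_eq_iff_four)
  moreover have "\<forall>i. i = 2 \<or> i = 3 \<longrightarrow> cross4 (diag_row 2 3 (k *s axis i 1)) (wedge_row1 b c (k *s axis i 1)) (wedge_row2 c a (k *s axis i 1)) \<noteq> 0"
    using k at_most_one_zero unfolding forall_four
    by (auto simp: cross4_def diag_row_def wedge_row1_def wedge_row2_def vec_eq_iff_four)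
  moreover have "i \<in> {0, 1, 2, 3}"
    using UNIV_four by (metis UNIV_I)
  ultimately have "cross4 (diag_row 0 1 v) (wedge_row1 b c v) (wedge_row2 c a v) \<noteq> 0 \<or>
      cross4 (diag_row 2 3 v) (wedge_row1 b c v) (wedge_row2 c a v) \<noteq> 0"
    unfolding v by blast
  then show ?thesis unfolding charts_def by simp
qed

lemma corr_unique:
  assumes "corr a b c v w" "corr a b c v w'" "v \<noteq> 0" "w \<noteq> 0" "w' \<noteq> 0"
  shows "line w = line w'"
proof -
  obtain T where T: "T \<in> charts a b c" "T v \<noteq> 0"
    using chart_cover corr_imp_on_curve assms by blast
  obtain k k' where "w = k *s T v" "w' = k' *s T v"
    using chart_unique[OF T] assms by blast
  moreover from this have "k \<noteq> 0" "k' \<noteq> 0" using assms by auto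
  ultimately show ?thesis by (simp add: line_scale)
qed

lemma corr_exists:
  assumes "on_curve a b c v \<or> is_special v" "v \<noteq> 0"
  shows "\<exists>w. w \<noteq> 0 \<and> corr a b c v w"
proof (cases "cremona v = 0")
  case False
  have "corr a b c v (cremona v)"
    using assms(1) unfolding corr_cremona_iff on_curve_def is_special_def by auto
  with False show ?thesis by blast
next
  case True
  then obtain i k where k: "k \<noteq> 0" and v: "v = k *s axis i 1"
    using on_curve_cremona_zero assms by blast
  have "\<forall>i. \<exists>w. w \<noteq> 0 \<and> corr a b c (k *s axis i 1) w"
    unfolding forall_four
  proof (intro conjI)
    \<comment> \<open>The witness vanishes where the vertex does not, and \<open>a * w $ 1\<close>,
      \<open>b * w $ 2\<close>, \<open>c * w $ 3\<close> all equal \<open>a * b * c\<close>. It is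
      nonzero because at most one parameter is zero. The other vertices are analogous.\<close>
    show "\<exists>w. w \<noteq> 0 \<and> corr a b c (k *s axis 0 1) w"
      by (intro exI[of _ "vec4 0 (b * c) (c * a) (a * b)"])
        (use at_most_one_zero in \<open>auto simp: corr_def wedge_def vec_eq_iff_four\<close>)
    show "\<exists>w. w \<noteq> 0 \<and> corr a b c (k *s axis 1 1) w"
      by (intro exI[of _ "vec4 (b * c) 0 (a * b) (c * a)"])
        (use at_most_one_zero in \<open>auto simp: corr_def wedge_def vec_eq_iff_four\<close>)
    show "\<exists>w. w \<noteq> 0 \<and> corr a b c (k *s axis 2 1) w"
      by (intro exI[of _ "vec4 (c * a) (a * b) 0 (b * c)"])
        (use at_most_one_zero in \<open>auto simp: corr_def wedge_def vec_eq_iff_four\<close>)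
    show "\<exists>w. w \<noteq> 0 \<and> corr a b c (k *s axis 3 1) w"
      by (intro exI[of _ "vec4 (a * b) (c * a) (b * c) 0"])
        (use at_most_one_zero in \<open>auto simp: corr_def wedge_def vec_eq_iff_four\<close>)
  qed
  then show ?thesis unfolding v by blast
qed

end

section \<open>Generators, relations and the curve\<close>

definition flip0 :: "complex^4 \<Rightarrow> complex^4" where
  "flip0 Z = vec4 (- Z $ 0) (Z $ 1) (Z $ 2) (Z $ 3)"

definition had :: "complex^4 \<Rightarrow> complex^4" where
  "had Z = vec4 ((Z $ 0 + Z $ 1 + Z $ 2 + Z $ 3) / 2) ((Z $ 0 + Z $ 1 - Z $ 2 - Z $ 3) / 2)
     ((Z $ 0 - Z $ 1 + Z $ 2 - Z $ 3) / 2) ((Z $ 0 - Z $ 1 - Z $ 2 + Z $ 3) / 2)"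

lemma M_matrix_mult: "M_matrix *v Z = had Z"
  by (simp add: vec_eq_iff_four had_def M_matrix_def matrix_vector_mult_def sum_four field_simps)

lemma flip0_flip0 [simp]: "flip0 (flip0 Z) = Z"
  by (simp add: flip0_def vec_eq_iff_four)

lemma had_had [simp]: "had (had Z) = Z"
  by (simp add: had_def vec_eq_iff_four field_simps)

lemma flip0_scale: "flip0 (k *s Z) = k *s flip0 Z"
  by (simp add: flip0_def vec_eq_iff_four)

lemma had_scale: "had (k *s Z) = k *s had Z"
  by (simp add: had_def vec_eq_iff_four field_simps)

lemma flip0_eq_0_iff [simp]: "flip0 Z = 0 \<longleftrightarrow> Z = 0"
  by (simp add: flip0_def vec_eq_iff_four)

lemma had_eq_0_iff [simp]: "had Z = 0 \<longleftrightarrow> Z = 0"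
proof
  assume "had Z = 0"
  then have "Z = had 0" using had_had[of Z] by simp
  then show "Z = 0" by (simp add: had_def vec_eq_iff_four)
qed (simp add: had_def vec_eq_iff_four)

abbreviation coef_a :: "complex^4 \<Rightarrow> complex" where "coef_a u \<equiv> beta u + gamma u - alpha u"
abbreviation coef_b :: "complex^4 \<Rightarrow> complex" where "coef_b u \<equiv> alpha u + gamma u - beta u"
abbreviation coef_c :: "complex^4 \<Rightarrow> complex" where "coef_c u \<equiv> alpha u + beta u - gamma u"

lemma generic_imp:
  assumes "generic u"
  shows "alpha u \<noteq> 0" "beta u \<noteq> 0" "gamma u \<noteq> 0" "alpha u \<noteq> beta u" "beta u \<noteq> gamma u" "gamma u \<noteq> alpha u"
proof -
  have d: "u $ i \<noteq> u $ j" "u $ i + u $ j \<noteq> 0" if "i \<noteq> j" for i j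
    using assms that unfolding generic_def by (auto simp: add_eq_0_iff)
  show "alpha u \<noteq> 0" "beta u \<noteq> 0" "gamma u \<noteq> 0"
    unfolding alpha_def beta_def gamma_def by (simp_all add: d)
  have "alpha u - beta u = (u $ 0 - u $ 3) * (u $ 2 - u $ 1)" "beta u - gamma u = (u $ 1 - u $ 0) * (u $ 2 - u $ 3)"
    "gamma u - alpha u = (u $ 2 - u $ 0) * (u $ 3 - u $ 1)"
    unfolding alpha_def beta_def gamma_def by (simp_all add: algebra_simps)
  then have "alpha u - beta u \<noteq> 0" "beta u - gamma u \<noteq> 0" "gamma u - alpha u \<noteq> 0" by (simp_all add: d)
  then show "alpha u \<noteq> beta u" "beta u \<noteq> gamma u" "gamma u \<noteq> alpha u" by auto
qed

text \<open>A difference of two of these squares is four times one of \<open>alpha\<close>,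
  \<open>beta\<close>, \<open>gamma\<close> times the difference of the other two.\<close>

lemma curve_params_generic:
  assumes "generic u"
  shows "curve_params (coef_a u) (coef_b u) (coef_c u)"
proof
  note g = generic_imp[OF assms]
  have "(coef_a u)\<^sup>2 - (coef_b u)\<^sup>2 = 4 * gamma u * (beta u - alpha u)" "(coef_b u)\<^sup>2 - (coef_c u)\<^sup>2 = 4 * alpha u * (gamma u - beta u)"
     "(coef_c u)\<^sup>2 - (coef_a u)\<^sup>2 = 4 * beta u * (alpha u - gamma u)"
    by (simp_all add: power2_eq_square algebra_simps)
  then show "(coef_a u)\<^sup>2 \<noteq> (coef_b u)\<^sup>2" "(coef_b u)\<^sup>2 \<noteq> (coef_c u)\<^sup>2" "(coef_c u)\<^sup>2 \<noteq> (coef_a u)\<^sup>2"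
    using g by auto
qed

definition on_F :: "complex^4 \<Rightarrow> complex^4 \<Rightarrow> bool" where
  "on_F u Z \<longleftrightarrow>
    ((Z $ 0)\<^sup>2 - (Z $ 1)\<^sup>2) * beta u = ((Z $ 0)\<^sup>2 - (Z $ 2)\<^sup>2) * alpha u \<and>
    ((Z $ 0)\<^sup>2 - (Z $ 2)\<^sup>2) * gamma u = ((Z $ 0)\<^sup>2 - (Z $ 3)\<^sup>2) * beta u \<and>
    ((Z $ 0)\<^sup>2 - (Z $ 3)\<^sup>2) * alpha u = ((Z $ 0)\<^sup>2 - (Z $ 1)\<^sup>2) * gamma u"

lemma on_F_flip0: "on_F u (flip0 Z) \<longleftrightarrow> on_F u Z"
  by (simp add: on_F_def flip0_def)

text \<open>Up to the factor 1/2, the sums of products in \<open>on_curve\<close> arise from the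
  differences of squares \<open>x\<close>, \<open>y\<close>, \<open>z\<close> by the same linear map
  that produces \<open>coef_a\<close>, \<open>coef_b\<close>, \<open>coef_c\<close> from
  \<open>alpha\<close>, \<open>beta\<close>, \<open>gamma\<close>. The minors on one side are
  therefore pairwise sums of those on the other, and these vanish exactly when all the summands
  do.\<close>

lemma on_curve_had: "on_curve (coef_a u) (coef_b u) (coef_c u) (had Z) \<longleftrightarrow> on_F u Z"
proof -
  define x y z where "x = (Z $ 0)\<^sup>2 - (Z $ 1)\<^sup>2" and "y = (Z $ 0)\<^sup>2 - (Z $ 2)\<^sup>2" and "z = (Z $ 0)\<^sup>2 - (Z $ 3)\<^sup>2"
  have p: "had Z $ 0 * had Z $ 1 + had Z $ 2 * had Z $ 3 = (y + z - x) / 2"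
    "had Z $ 0 * had Z $ 2 + had Z $ 1 * had Z $ 3 = (x + z - y) / 2"
    "had Z $ 0 * had Z $ 3 + had Z $ 1 * had Z $ 2 = (x + y - z) / 2"
    unfolding x_def y_def z_def had_def vec4_nth by (simp_all add: field_simps power2_eq_square)
  define e1 e2 e3 where "e1 = y * gamma u - z * beta u" and "e2 = z * alpha u - x * gamma u" and "e3 = x * beta u - y * alpha u"
  have "coef_b u * ((x + y - z) / 2) - coef_c u * ((x + z - y) / 2) = - (e2 + e3)"
    "coef_c u * ((y + z - x) / 2) - coef_a u * ((x + y - z) / 2) = - (e3 + e1)"
    "coef_a u * ((x + z - y) / 2) - coef_b u * ((y + z - x) / 2) = - (e1 + e2)"
    unfolding e1_def e2_def e3_def by (simp_all add: field_simps)
  then have "on_curve (coef_a u) (coef_b u) (coef_c u) (had Z) \<longleftrightarrow> e2 + e3 = 0 \<and> e3 + e1 = 0 \<and> e1 + e2 = 0"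
    unfolding on_curve_def p by (metis eq_iff_diff_eq_0 neg_equal_0_iff_equal)
  also have "\<dots> \<longleftrightarrow> e1 = 0 \<and> e2 = 0 \<and> e3 = 0"
    by (auto simp: add_eq_0_iff)
  also have "\<dots> \<longleftrightarrow> on_F u Z"
    unfolding on_F_def e1_def e2_def e3_def x_def y_def z_def by auto
  finally show ?thesis .
qed

text \<open>The special vectors are, up to scale, the columns of \<open>M_matrix\<close>, so
  \<open>had\<close> turns them into multiples of the coordinate vectors.\<close>

lemma is_special_had:
  assumes "Z \<noteq> 0"
  shows "is_special (had (flip0 Z)) \<longleftrightarrow> (\<exists>\<nu> k. Z = k *s axis \<nu> 1)"
proof
  assume sp: "is_special (had (flip0 Z))"
  define v where "v = had (flip0 Z)"
  have Z: "Z = flip0 (had v)" by (simp add: v_def)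
  have s: "v $ 1 = v $ 0 \<or> v $ 1 = - v $ 0" "v $ 2 = v $ 0 \<or> v $ 2 = - v $ 0" "v $ 3 = v $ 0 \<or> v $ 3 = - v $ 0"
    "v $ 0 * v $ 1 = v $ 2 * v $ 3"
    using sp unfolding is_special_def v_def[symmetric] by (simp_all add: power2_eq_iff)
  have "v $ 0 \<noteq> 0"
  proof
    assume "v $ 0 = 0"
    then have "v = 0" using s by (simp add: vec_eq_iff_four)
    then show False using assms unfolding Z by simp
  qed
  with s have "v $ 1 = v $ 0 \<and> v $ 2 = v $ 0 \<and> v $ 3 = v $ 0 \<or> v $ 1 = v $ 0 \<and> v $ 2 = - v $ 0 \<and> v $ 3 = - v $ 0 \<or>
     v $ 1 = - v $ 0 \<and> v $ 2 = v $ 0 \<and> v $ 3 = - v $ 0 \<or> v $ 1 = - v $ 0 \<and> v $ 2 = - v $ 0 \<and> v $ 3 = v $ 0"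
    by (auto simp: equal_neg_zero neg_equal_zero)
  then have "Z = (- 2 * v $ 0) *s axis 0 1 \<or> Z = (2 * v $ 0) *s axis 1 1 \<or> Z = (2 * v $ 0) *s axis 2 1 \<or> Z = (2 * v $ 0) *s axis 3 1"
    unfolding Z by (elim disjE) (simp_all add: flip0_def had_def vec_eq_iff_four)
  then show "\<exists>\<nu> k. Z = k *s axis \<nu> 1" by blast
next
  assume "\<exists>\<nu> k. Z = k *s axis \<nu> 1"
  moreover have "\<forall>\<nu>. is_special (had (flip0 (k *s axis \<nu> 1)))" for k
    unfolding forall_four by (simp add: is_special_def had_def flip0_def power2_eq_square)
  ultimately show "is_special (had (flip0 Z))" by blast
qed

definition zcorr :: "complex^4 \<Rightarrow> complex^4 \<Rightarrow> complex^4 \<Rightarrow> bool" where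
  "zcorr u Z Z' \<longleftrightarrow> corr (coef_a u) (coef_b u) (coef_c u) (had (flip0 Z)) (had Z')"

text \<open>The symmetry of \<open>corr\<close> becomes an exchange of the two sides combined with
  \<open>flip0\<close>. Through it, every statement about left partners follows from one about right
  partners.\<close>

lemma zcorr_flip: "zcorr u Z Z' \<longleftrightarrow> zcorr u (flip0 Z') (flip0 Z)"
  unfolding zcorr_def by (subst corr_sym) simp

text \<open>The diagonal equations of \<open>corr\<close> are pairwise sums of the three relations
  \<open>[Y_0, Y_k]_- = [Y_l, Y_m]_+\<close>. The wedge sums combine the antisymmetric products
  \<open>w1, w2, w3\<close> with the symmetric \<open>s1, s2, s3\<close>; inserting the coefficients
  gives the relations with \<open>J_coeff\<close>, denominators cleared.\<close>

lemma zcorr_iff: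
  "zcorr u Z Z' \<longleftrightarrow>
    Z $ 0 * Z' $ 1 - Z $ 1 * Z' $ 0 = Z $ 2 * Z' $ 3 + Z $ 3 * Z' $ 2 \<and>
    Z $ 0 * Z' $ 2 - Z $ 2 * Z' $ 0 = Z $ 3 * Z' $ 1 + Z $ 1 * Z' $ 3 \<and>
    Z $ 0 * Z' $ 3 - Z $ 3 * Z' $ 0 = Z $ 1 * Z' $ 2 + Z $ 2 * Z' $ 1 \<and>
    alpha u * (Z $ 2 * Z' $ 3 - Z $ 3 * Z' $ 2) + (beta u - gamma u) * (Z $ 0 * Z' $ 1 + Z $ 1 * Z' $ 0) = 0 \<and>
    beta u * (Z $ 3 * Z' $ 1 - Z $ 1 * Z' $ 3) + (gamma u - alpha u) * (Z $ 0 * Z' $ 2 + Z $ 2 * Z' $ 0) = 0 \<and>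
    gamma u * (Z $ 1 * Z' $ 2 - Z $ 2 * Z' $ 1) + (alpha u - beta u) * (Z $ 0 * Z' $ 3 + Z $ 3 * Z' $ 0) = 0"
proof -
  define v w where "v = had (flip0 Z)" and "w = had Z'"
  note vw = v_def w_def had_def flip0_def vec4_nth
  define n1 n2 n3 where "n1 = Z $ 0 * Z' $ 1 - Z $ 1 * Z' $ 0 - (Z $ 2 * Z' $ 3 + Z $ 3 * Z' $ 2)"
    and "n2 = Z $ 0 * Z' $ 2 - Z $ 2 * Z' $ 0 - (Z $ 3 * Z' $ 1 + Z $ 1 * Z' $ 3)"
    and "n3 = Z $ 0 * Z' $ 3 - Z $ 3 * Z' $ 0 - (Z $ 1 * Z' $ 2 + Z $ 2 * Z' $ 1)"
  have d: "v $ 0 * w $ 0 - v $ 1 * w $ 1 = - (n2 + n3) / 2" "v $ 0 * w $ 0 - v $ 2 * w $ 2 = - (n1 + n3) / 2"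
    "v $ 0 * w $ 0 - v $ 3 * w $ 3 = - (n1 + n2) / 2"
    unfolding n1_def n2_def n3_def vw by (simp_all add: field_simps)
  define w1 w2 w3 where "w1 = Z $ 2 * Z' $ 3 - Z $ 3 * Z' $ 2" and "w2 = Z $ 3 * Z' $ 1 - Z $ 1 * Z' $ 3"
    and "w3 = Z $ 1 * Z' $ 2 - Z $ 2 * Z' $ 1"
  define s1 s2 s3 where "s1 = Z $ 0 * Z' $ 1 + Z $ 1 * Z' $ 0" and "s2 = Z $ 0 * Z' $ 2 + Z $ 2 * Z' $ 0"
    and "s3 = Z $ 0 * Z' $ 3 + Z $ 3 * Z' $ 0"
  have q: "wedge v w 2 0 + wedge v w 3 1 = w1 - s1" "wedge v w 2 1 + wedge v w 3 0 = - (w1 + s1)"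
    "wedge v w 3 0 + wedge v w 1 2 = w2 - s2" "wedge v w 3 2 + wedge v w 1 0 = - (w2 + s2)"
    "wedge v w 1 0 + wedge v w 2 3 = w3 - s3" "wedge v w 1 3 + wedge v w 2 0 = - (w3 + s3)"
    unfolding wedge_def w1_def w2_def w3_def s1_def s2_def s3_def vw by (simp_all add: field_simps)
  have e: "coef_b u * (w1 - s1) - coef_c u * - (w1 + s1) = 2 * (alpha u * w1 + (beta u - gamma u) * s1)"
    "coef_c u * (w2 - s2) - coef_a u * - (w2 + s2) = 2 * (beta u * w2 + (gamma u - alpha u) * s2)"
    "coef_a u * (w3 - s3) - coef_b u * - (w3 + s3) = 2 * (gamma u * w3 + (alpha u - beta u) * s3)"
    by (simp_all add: algebra_simps)
  have i: "v $ 0 * w $ 0 = v $ 1 * w $ 1 \<longleftrightarrow> n2 + n3 = 0" "v $ 0 * w $ 0 = v $ 2 * w $ 2 \<longleftrightarrow> n1 + n3 = 0"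
    "v $ 0 * w $ 0 = v $ 3 * w $ 3 \<longleftrightarrow> n1 + n2 = 0"
    unfolding eq_iff_diff_eq_0[of "v $ 0 * w $ 0"] d by (auto simp: add_eq_0_iff)
  have f: "coef_b u * (w1 - s1) = coef_c u * - (w1 + s1) \<longleftrightarrow> alpha u * w1 + (beta u - gamma u) * s1 = 0"
    "coef_c u * (w2 - s2) = coef_a u * - (w2 + s2) \<longleftrightarrow> beta u * w2 + (gamma u - alpha u) * s2 = 0"
    "coef_a u * (w3 - s3) = coef_b u * - (w3 + s3) \<longleftrightarrow> gamma u * w3 + (alpha u - beta u) * s3 = 0"
    unfolding eq_iff_diff_eq_0[of "_ * (_ - _)"] e mult_eq_0_iff[of 2] by simp_all
  have n: "n2 + n3 = 0 \<and> n1 + n3 = 0 \<and> n1 + n2 = 0 \<longleftrightarrow> n1 = 0 \<and> n2 = 0 \<and> n3 = 0"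
    by (auto simp: add_eq_0_iff)
  have "zcorr u Z Z' \<longleftrightarrow> (n2 + n3 = 0 \<and> n1 + n3 = 0 \<and> n1 + n2 = 0) \<and>
      alpha u * w1 + (beta u - gamma u) * s1 = 0 \<and> beta u * w2 + (gamma u - alpha u) * s2 = 0 \<and>
      gamma u * w3 + (alpha u - beta u) * s3 = 0"
    unfolding zcorr_def v_def[symmetric] w_def[symmetric] corr_def q i f by simp
  also have "\<dots> \<longleftrightarrow> n1 = 0 \<and> n2 = 0 \<and> n3 = 0 \<and>
      alpha u * w1 + (beta u - gamma u) * s1 = 0 \<and> beta u * w2 + (gamma u - alpha u) * s2 = 0 \<and>
      gamma u * w3 + (alpha u - beta u) * s3 = 0"
    unfolding n by simp
  finally show ?thesis
    unfolding n1_def n2_def n3_def w1_def w2_def w3_def s1_def s2_def s3_def right_minus_eq .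
qed

section \<open>The curve as an intersection of quadrics\<close>

lemma M_matrix_image_line: "(*v) M_matrix ` line v = line (had v)"
  unfolding line_eq image_image M_matrix_mult had_scale ..

lemma alpha_beta_gamma_had:
  "alpha v = (had v $ 0)\<^sup>2 - (had v $ 1)\<^sup>2" "beta v = (had v $ 0)\<^sup>2 - (had v $ 2)\<^sup>2"
  "gamma v = (had v $ 0)\<^sup>2 - (had v $ 3)\<^sup>2"
  by (simp_all add: alpha_def beta_def gamma_def had_def power2_eq_square field_simps)

text \<open>Each of the three forms is a product of two linear factors; choosing a vanishing factor
  in each gives eight cases, one for each point of \<open>S_points\<close>.\<close>

lemma line_in_S_points:
  assumes "v \<noteq> 0" "alpha v = 0" "beta v = 0" "gamma v = 0"
  shows "line v \<in> S_points"
proof -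
  have S: "line v \<in> S_points" if "v = k *s P" "P \<in> {vec4 1 0 0 0, vec4 0 1 0 0, vec4 0 0 1 0, vec4 0 0 0 1,
     vec4 (-1) 1 1 1, vec4 1 (-1) 1 1, vec4 1 1 (-1) 1, vec4 1 1 1 (-1)}" for k P
  proof -
    have "k \<noteq> 0" using that(1) assms(1) by auto
    then have "line v = line P" using that(1) by (simp add: line_scale)
    then show ?thesis using that(2) unfolding S_points_def by blast
  qed
  have "v $ 0 = - v $ 1 \<or> v $ 2 = - v $ 3" "v $ 0 = - v $ 2 \<or> v $ 3 = - v $ 1" "v $ 0 = - v $ 3 \<or> v $ 1 = - v $ 2"
    using assms(2-4) by (simp_all add: alpha_def beta_def gamma_def add_eq_0_iff2)
  then have "v = v $ 0 *s vec4 1 0 0 0 \<or> v = v $ 1 *s vec4 0 1 0 0 \<or> v = v $ 2 *s vec4 0 0 1 0 \<or> v = v $ 3 *s vec4 0 0 0 1 \<or>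
      v = v $ 1 *s vec4 (-1) 1 1 1 \<or> v = v $ 0 *s vec4 1 (-1) 1 1 \<or> v = v $ 0 *s vec4 1 1 (-1) 1 \<or> v = v $ 0 *s vec4 1 1 1 (-1)"
    by (elim disjE) (auto simp: vec_eq_iff_four equal_neg_zero neg_equal_zero)
  then show ?thesis by (elim disjE) (rule S, assumption, simp)+
qed

text \<open>After \<open>had\<close> the three forms are differences of squares, and equality of
  lines becomes the vanishing of the minors in \<open>on_F\<close>. At the points of
  \<open>S_points\<close> all three forms vanish, so the minors do; elsewhere the factor of
  proportionality is nonzero.\<close>

lemma F_curve_eq:
  assumes "generic u"
  shows "F_curve u = {line Z | Z. Z \<noteq> 0 \<and> on_F u Z}"
proof -
  note g = generic_imp[OF assms]
  have on: "on_F u (had v) \<longleftrightarrow> alpha v * beta u = beta v * alpha u \<and> beta v * gamma u = gamma v * beta u \<and>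
      gamma v * alpha u = alpha v * gamma u" for v
    unfolding on_F_def alpha_beta_gamma_had[of v] ..
  have "F_fiber u = {line v | v. v \<noteq> 0 \<and> on_F u (had v)}"
  proof (intro subset_antisym subsetI)
    fix p assume "p \<in> F_fiber u"
    then consider "p \<in> S_points" | v where "p = line v" "v \<noteq> 0" "line (Phi v) = line (Phi u)"
      unfolding F_fiber_def by blast
    then show "p \<in> {line v | v. v \<noteq> 0 \<and> on_F u (had v)}"
    proof cases
      case 1
      then obtain v where "p = line v" "v \<in> {vec4 1 0 0 0, vec4 0 1 0 0, vec4 0 0 1 0, vec4 0 0 0 1,
          vec4 (-1) 1 1 1, vec4 1 (-1) 1 1, vec4 1 1 (-1) 1, vec4 1 1 1 (-1)}"
        unfolding S_points_def by blast
      moreover from this have "v \<noteq> 0 \<and> on_F u (had v)"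
        unfolding on by (auto simp: alpha_def beta_def gamma_def vec_eq_iff_four)
      ultimately show ?thesis by blast
    next
      case 2
      then obtain c where "Phi u = c *s Phi v" unfolding line_eq_iff by blast
      then have "alpha u = c * alpha v" "beta u = c * beta v" "gamma u = c * gamma v"
        by (simp_all add: Phi_def vec_eq_iff forall_3)
      then have "on_F u (had v)" unfolding on by simp
      with 2 show ?thesis by blast
    qed
  next
    fix p assume "p \<in> {line v | v. v \<noteq> 0 \<and> on_F u (had v)}"
    then obtain v where v: "p = line v" "v \<noteq> 0" "on_F u (had v)" by blast
    show "p \<in> F_fiber u"
    proof (cases "line v \<in> S_points")
      case False
      define t where "t = alpha v / alpha u"
      have t: "alpha v = t * alpha u" "beta v = t * beta u" "gamma v = t * gamma u"
        using v(3) g unfolding on t_def by (simp_all add: field_simps)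
      have "t \<noteq> 0" using t line_in_S_points[OF v(2)] False by auto
      moreover have "Phi v = t *s Phi u"
        using t by (simp add: Phi_def vec_eq_iff forall_3)
      ultimately have "line (Phi v) = line (Phi u)" by (simp add: line_scale)
      then show ?thesis using v False unfolding F_fiber_def by blast
    qed (use v in \<open>auto simp: F_fiber_def\<close>)
  qed
  then have "F_curve u = (\<lambda>v. line (had v)) ` {v. v \<noteq> 0 \<and> on_F u (had v)}"
    unfolding F_curve_def by (simp add: setcompr_eq_image image_image M_matrix_image_line)
  also have "\<dots> = line ` had ` {v. had v \<noteq> 0 \<and> on_F u (had v)}"
    by (simp add: image_image)
  also have "had ` {v. had v \<noteq> 0 \<and> on_F u (had v)} = {Z. Z \<noteq> 0 \<and> on_F u Z}"
    using had_had by (intro subset_antisym subsetI) (auto intro: image_eqI[of _ had "had _"])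
  also have "line ` {Z. Z \<noteq> 0 \<and> on_F u Z} = {line Z | Z. Z \<noteq> 0 \<and> on_F u Z}"
    by blast
  finally show ?thesis .
qed

section \<open>From the relations to the correspondence\<close>

lemma scalar_y_gen_mult_eq_single:
  "scalar c * y_gen i * y_gen j = Poly_Mapping.single [i, j] c"
  by (simp add: scalar_def y_gen_def mult_single plus_list_def)

lemma pairing2_add: "pairing2 (x + y) a b = pairing2 x a b + pairing2 y a b"
  by (simp add: pairing2_def lookup_add distrib_right sum.distrib)

lemma pairing2_diff: "pairing2 (x - y) a b = pairing2 x a b - pairing2 y a b"
  by (simp add: pairing2_def lookup_minus left_diff_distrib sum_subtractf)

lemma pairing2_single: "pairing2 (Poly_Mapping.single [i, j] c) a b = c * (a $ i * b $ j)"
proof -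
  have "pairing2 (Poly_Mapping.single [i, j] c) a b =
      (\<Sum>k\<in>UNIV. if k = i then \<Sum>l\<in>UNIV. if l = j then c * (a $ k * b $ l) else 0 else 0)"
    unfolding pairing2_def lookup_single
    by (intro sum.cong refl) (auto simp: when_def if_distrib[of "\<lambda>x. x * _"] cong: if_cong)
  then show ?thesis by simp
qed

lemma cyclic_triples_ball: "(\<forall>(k, l, m)\<in>cyclic_triples. P k l m) \<longleftrightarrow> P 1 2 3 \<and> P 2 3 1 \<and> P 3 1 2"
  unfolding cyclic_triples_def by simp

lemma pairing_y_relations:
  "(\<forall>\<omega>\<in>y_relations u. pairing2 \<omega> a b = 0) \<longleftrightarrow> (\<forall>(k, l, m)\<in>cyclic_triples.
     u $ k * (a $ k * b $ 0) - u $ 0 * (a $ 0 * b $ k) + u $ l * (a $ l * b $ m) - u $ m * (a $ m * b $ l) = 0 \<and>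
     u $ k * (a $ 0 * b $ k) - u $ 0 * (a $ k * b $ 0) + u $ m * (a $ l * b $ m) - u $ l * (a $ m * b $ l) = 0)"
  unfolding y_relations_def scalar_y_gen_mult_eq_single cyclic_triples_def
  by (simp add: pairing2_add pairing2_diff pairing2_single) blast

text \<open>In \<open>c l * c m\<close> the root \<open>t k\<close> occurs squared, in
  \<open>c 0 * c k\<close> the root \<open>s k\<close>, and the other roots agree. The resulting
  identity is what brings the relations of the rescaled generators to their simple form.\<close>

lemma root_choice_scaling:
  assumes "generic u" "root_choice u s t" "(k, l, m) \<in> cyclic_triples"
  defines "c \<equiv> \<lambda>i. scaling s t $ i"
  shows "c i \<noteq> 0" "(u $ l - u $ m) * (c l * c m) = (u $ 0 + u $ k) * (c 0 * c k)"
    "u $ 0 + u $ k \<noteq> 0" "u $ l - u $ m \<noteq> 0" "u $ l + u $ m \<noteq> 0" "u $ 0 - u $ k \<noteq> 0"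
proof -
  have d: "u $ i \<noteq> u $ j" "u $ i + u $ j \<noteq> 0" if "i \<noteq> j" for i j
    using assms(1) that unfolding generic_def by (auto simp: add_eq_0_iff)
  have sq: "(s 1)\<^sup>2 = u $ 2 - u $ 3" "(s 2)\<^sup>2 = u $ 3 - u $ 1" "(s 3)\<^sup>2 = u $ 1 - u $ 2"
    "(t 1)\<^sup>2 = u $ 0 + u $ 1" "(t 2)\<^sup>2 = u $ 0 + u $ 2" "(t 3)\<^sup>2 = u $ 0 + u $ 3"
    using assms(2) unfolding root_choice_def cyclic_triples_ball by auto
  have "(s 1)\<^sup>2 \<noteq> 0" "(s 2)\<^sup>2 \<noteq> 0" "(s 3)\<^sup>2 \<noteq> 0" "(t 1)\<^sup>2 \<noteq> 0" "(t 2)\<^sup>2 \<noteq> 0" "(t 3)\<^sup>2 \<noteq> 0"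
    unfolding sq by (simp_all add: d)
  then have nz: "s 1 \<noteq> 0" "s 2 \<noteq> 0" "s 3 \<noteq> 0" "t 1 \<noteq> 0" "t 2 \<noteq> 0" "t 3 \<noteq> 0" by simp_all
  have "\<forall>i. c i \<noteq> 0" unfolding forall_four c_def scaling_def using nz by simp
  then show "c i \<noteq> 0" by blast
  show "(u $ l - u $ m) * (c l * c m) = (u $ 0 + u $ k) * (c 0 * c k)"
    using assms(3) unfolding cyclic_triples_def c_def scaling_def
    by (auto simp: sq[symmetric] power2_eq_square)
  show "u $ 0 + u $ k \<noteq> 0" "u $ l - u $ m \<noteq> 0" "u $ l + u $ m \<noteq> 0" "u $ 0 - u $ k \<noteq> 0"
    using assms(3) unfolding cyclic_triples_def by (auto simp: d)
qed

text \<open>The right-hand equations are the difference and the sum of the left-hand ones.\<close>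

lemma scaled_relations_iff:
  fixes uk u0 ul um c0 ck cl cm p q r x :: complex
  assumes c: "(ul - um) * (cl * cm) = (u0 + uk) * (c0 * ck)" and nz: "c0 \<noteq> 0" "ck \<noteq> 0" "cl \<noteq> 0" "cm \<noteq> 0" "u0 + uk \<noteq> 0"
  shows "uk * (c0 * ck * q) - u0 * (c0 * ck * p) + ul * (cl * cm * r) - um * (cl * cm * x) = 0 \<and>
     uk * (c0 * ck * p) - u0 * (c0 * ck * q) + um * (cl * cm * r) - ul * (cl * cm * x) = 0 \<longleftrightarrow>
     p - q = r + x \<and> (u0 + uk) * (ul + um) * (r - x) + (uk - u0) * (ul - um) * (p + q) = 0"
    (is "?A = 0 \<and> ?B = 0 \<longleftrightarrow> _ \<and> ?D = 0")
proof -
  have "?A - ?B = - ((u0 + uk) * (c0 * ck)) * (p - q) + ((ul - um) * (cl * cm)) * (r + x)" by (simp add: algebra_simps)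
  also have "\<dots> = (u0 + uk) * (c0 * ck) * (r + x - (p - q))" unfolding c by (simp add: algebra_simps)
  finally have 1: "?A - ?B = (u0 + uk) * (c0 * ck) * (r + x - (p - q))" .
  have "(u0 + uk) * (?A + ?B) = (uk - u0) * ((u0 + uk) * (c0 * ck)) * (p + q) + (u0 + uk) * (ul + um) * (cl * cm) * (r - x)"
    by (simp add: algebra_simps)
  also have "\<dots> = cl * cm * ?D" unfolding c[symmetric] by (simp add: algebra_simps)
  finally have 2: "(u0 + uk) * (?A + ?B) = cl * cm * ?D" .
  have "y = 0 \<and> z = 0 \<longleftrightarrow> y - z = 0 \<and> y + z = 0" for y z :: complex by auto
  then have "?A = 0 \<and> ?B = 0 \<longleftrightarrow> ?A - ?B = 0 \<and> ?A + ?B = 0" .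
  also have "\<dots> \<longleftrightarrow> (u0 + uk) * (c0 * ck) * (r + x - (p - q)) = 0 \<and> cl * cm * ?D = 0"
    unfolding 1 2[symmetric] using nz by simp
  also have "\<dots> \<longleftrightarrow> p - q = r + x \<and> ?D = 0" using nz by auto
  finally show ?thesis .
qed

text \<open>In dual coordinates a linear form \<open>a\<close> becomes \<open>Z\<close> with
  \<open>a $ i = c $ i * Z $ i\<close>; under this substitution \<open>scaled_relations_iff\<close>
  treats each cyclic triple separately.\<close>

lemma Gamma_set_eq:
  assumes "generic u" "root_choice u s t"
  shows "Gamma_set (y_relations u) (Y_gen s t) = {(line Z, line Z') | Z Z'. Z \<noteq> 0 \<and> Z' \<noteq> 0 \<and> zcorr u Z Z'}"
proof -
  define c where "c = scaling s t"
  note sc = root_choice_scaling[OF assms, folded c_def]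
  have c0: "c $ i \<noteq> 0" for i using sc(1) unfolding cyclic_triples_def by blast
  have p1: "pairing1 (Y_gen s t \<mu>) a = a $ \<mu> / c $ \<mu>" for \<mu> a
  proof -
    have "pairing1 (Y_gen s t \<mu>) a = (\<Sum>i\<in>UNIV. if i = \<mu> then a $ i / c $ \<mu> else 0)"
      unfolding pairing1_def Y_gen_def c_def scalar_def y_gen_def mult_single
      by (intro sum.cong refl) (auto simp: plus_list_def lookup_single when_def)
    then show ?thesis by simp
  qed
  define Y where "Y = dual_coords (Y_gen s t)"
  define X where "X = (\<lambda>Z :: complex^4. \<chi> i. c $ i * Z $ i)"
  have XY: "X (Y a) = a" "Y (X Z) = Z" for a Z
    by (simp_all add: X_def Y_def dual_coords_def p1 vec_eq_iff c0)
  have X0: "X Z = 0 \<longleftrightarrow> Z = 0" for Z by (simp add: X_def vec_eq_iff c0)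
  have rel: "(\<forall>\<omega>\<in>y_relations u. pairing2 \<omega> (X Z) (X Z') = 0) \<longleftrightarrow> zcorr u Z Z'" for Z Z'
  proof -
    have "(\<forall>\<omega>\<in>y_relations u. pairing2 \<omega> (X Z) (X Z') = 0) \<longleftrightarrow> (\<forall>(k, l, m)\<in>cyclic_triples.
       u $ k * (c $ 0 * c $ k * (Z $ k * Z' $ 0)) - u $ 0 * (c $ 0 * c $ k * (Z $ 0 * Z' $ k))
         + u $ l * (c $ l * c $ m * (Z $ l * Z' $ m)) - u $ m * (c $ l * c $ m * (Z $ m * Z' $ l)) = 0 \<and>
       u $ k * (c $ 0 * c $ k * (Z $ 0 * Z' $ k)) - u $ 0 * (c $ 0 * c $ k * (Z $ k * Z' $ 0))
         + u $ m * (c $ l * c $ m * (Z $ l * Z' $ m)) - u $ l * (c $ l * c $ m * (Z $ m * Z' $ l)) = 0)"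
      unfolding pairing_y_relations cyclic_triples_ball X_def vec_lambda_beta by (simp only: ac_simps)
    also have "\<dots> \<longleftrightarrow> (\<forall>(k, l, m)\<in>cyclic_triples.
       Z $ 0 * Z' $ k - Z $ k * Z' $ 0 = Z $ l * Z' $ m + Z $ m * Z' $ l \<and>
       (u $ 0 + u $ k) * (u $ l + u $ m) * (Z $ l * Z' $ m - Z $ m * Z' $ l)
         + (u $ k - u $ 0) * (u $ l - u $ m) * (Z $ 0 * Z' $ k + Z $ k * Z' $ 0) = 0)"
      by (intro ball_cong refl, clarify, rule scaled_relations_iff) (use sc c0 in blast)+
    also have "\<dots> \<longleftrightarrow> zcorr u Z Z'"
    proof -
      \<comment> \<open>These factorizations turn the coefficients of the rescaled relations into
        those of \<open>zcorr_iff\<close>.\<close>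
      have "alpha u = (u $ 0 + u $ 1) * (u $ 2 + u $ 3)" "beta u - gamma u = (u $ 1 - u $ 0) * (u $ 2 - u $ 3)"
        "beta u = (u $ 0 + u $ 2) * (u $ 3 + u $ 1)" "gamma u - alpha u = (u $ 2 - u $ 0) * (u $ 3 - u $ 1)"
        "gamma u = (u $ 0 + u $ 3) * (u $ 1 + u $ 2)" "alpha u - beta u = (u $ 3 - u $ 0) * (u $ 1 - u $ 2)"
        by (simp_all add: alpha_def beta_def gamma_def algebra_simps)
      note e = this[symmetric]
      show ?thesis unfolding cyclic_triples_ball zcorr_iff e by blast
    qed
    finally show ?thesis .
  qed
  have "Gamma_set (y_relations u) (Y_gen s t) = {(line (Y a), line (Y b)) | a b.
      a \<noteq> 0 \<and> b \<noteq> 0 \<and> (\<forall>\<omega>\<in>y_relations u. pairing2 \<omega> a b = 0)}"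
    by (simp add: Gamma_set_def Y_def)
  also have "\<dots> = {(line Z, line Z') | Z Z'. Z \<noteq> 0 \<and> Z' \<noteq> 0 \<and> zcorr u Z Z'}"
  proof (intro subset_antisym subsetI)
    fix p assume "p \<in> {(line (Y a), line (Y b)) | a b. a \<noteq> 0 \<and> b \<noteq> 0 \<and> (\<forall>\<omega>\<in>y_relations u. pairing2 \<omega> a b = 0)}"
    then obtain a b where "p = (line (Y a), line (Y b))" "a \<noteq> 0" "b \<noteq> 0" "\<forall>\<omega>\<in>y_relations u. pairing2 \<omega> a b = 0"
      by blast
    then show "p \<in> {(line Z, line Z') | Z Z'. Z \<noteq> 0 \<and> Z' \<noteq> 0 \<and> zcorr u Z Z'}"
      using rel[of "Y a" "Y b"] X0[of "Y a"] X0[of "Y b"] XY by auto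
  next
    fix p assume "p \<in> {(line Z, line Z') | Z Z'. Z \<noteq> 0 \<and> Z' \<noteq> 0 \<and> zcorr u Z Z'}"
    then obtain Z Z' where "p = (line (Y (X Z)), line (Y (X Z')))" "X Z \<noteq> 0" "X Z' \<noteq> 0" "\<forall>\<omega>\<in>y_relations u. pairing2 \<omega> (X Z) (X Z') = 0"
      using XY X0 rel by auto
    then show "p \<in> {(line (Y a), line (Y b)) | a b. a \<noteq> 0 \<and> b \<noteq> 0 \<and> (\<forall>\<omega>\<in>y_relations u. pairing2 \<omega> a b = 0)}"
      by blast
  qed
  finally show ?thesis .
qed

section \<open>Equality of the two presentations\<close>

lemma scalar_mult_single: "scalar c * Poly_Mapping.single w x = Poly_Mapping.single w (c * x)"
  by (simp add: scalar_def mult_single plus_list_def)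

lemma scalar_hom:
  "scalar 0 = 0" "scalar 1 = 1" "scalar (x + y) = scalar x + scalar y" "scalar (x - y) = scalar x - scalar y"
  "scalar (- x) = - scalar x" "scalar (x * y) = scalar x * scalar y"
  unfolding scalar_def
  by (simp_all add: single_one[where 'a = "4 list", unfolded zero_list_def] single_add single_diff single_uminus
      mult_single plus_list_def)

lemma Idl_subset_by_combinations:
  assumes "\<And>r. r \<in> R' \<Longrightarrow> \<exists>p q. \<exists>x\<in>R. \<exists>y\<in>R. r = scalar p * x + scalar q * y"
  shows "Idl\<^bsub>free_ring\<^esub> R' \<subseteq> Idl\<^bsub>free_ring\<^esub> R"
proof -
  interpret ring free_ring by (rule ring_free_ring)
  have carr: "S \<subseteq> carrier free_ring" for S by (simp add: free_ring_def)
  interpret I: ideal "Idl\<^bsub>free_ring\<^esub> R" free_ring by (rule genideal_ideal[OF carr])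
  have "r \<in> Idl\<^bsub>free_ring\<^esub> R" if r': "r \<in> R'" for r
  proof -
    obtain p q x y where "x \<in> R" "y \<in> R" and r: "r = scalar p * x + scalar q * y"
      using assms[OF r'] by blast
    then have "x \<in> Idl\<^bsub>free_ring\<^esub> R" "y \<in> Idl\<^bsub>free_ring\<^esub> R"
      using genideal_self[OF carr] by blast+
    then have "scalar p \<otimes>\<^bsub>free_ring\<^esub> x \<oplus>\<^bsub>free_ring\<^esub> scalar q \<otimes>\<^bsub>free_ring\<^esub> y \<in> Idl\<^bsub>free_ring\<^esub> R"
      by (intro I.a_closed I.I_l_closed) (auto simp: free_ring_def)
    then show ?thesis by (simp add: r free_ring_def)
  qed
  then show ?thesis
    by (intro genideal_minimal genideal_ideal carr subsetI)
qed

text \<open>For one cyclic triple, \<open>A\<close>, \<open>B\<close> are the relations in the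
  \<open>y_gen\<close> and \<open>C\<close>, \<open>D\<close> those in the \<open>Y_gen\<close>,
  where \<open>d0k\<close> and \<open>dlm\<close> are the coefficients of the monomials in the
  products of rescaled generators. \<open>C\<close> is \<open>e\<close> times \<open>B - A\<close>
  and \<open>D\<close> is \<open>f\<close> times \<open>A + B\<close>, which can be inverted because
  \<open>e\<close> and \<open>f\<close> are nonzero.\<close>

lemma relation_combinations:
  fixes uk u0 ul um e f J d0k dlm :: complex and k l m :: 4
  defines "s \<equiv> \<lambda>i j x. Poly_Mapping.single [i, j :: 4] (x :: complex)"
  defines "A \<equiv> s k 0 uk - s 0 k u0 + s l m ul - s m l um"
    and "B \<equiv> s 0 k uk - s k 0 u0 + s l m um - s m l ul"
    and "C \<equiv> s 0 k d0k - s k 0 d0k - (s l m dlm + s m l dlm)"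
    and "D \<equiv> s l m dlm - s m l dlm + (s 0 k (J * d0k) + s k 0 (J * d0k))"
  assumes e: "e \<noteq> 0" "d0k = e * (u0 + uk)" "dlm = e * (ul - um)"
    and f: "f \<noteq> 0" "J * d0k = f * (uk - u0)" "dlm = f * (ul + um)"
  shows "C = scalar (- e) * A + scalar e * B" "D = scalar f * A + scalar f * B"
    "A = scalar (- 1 / (2 * e)) * C + scalar (1 / (2 * f)) * D"
    "B = scalar (1 / (2 * e)) * C + scalar (1 / (2 * f)) * D"
proof -
  define n where "n = (\<lambda>(i::4) j w. (1::complex) when [i, j] = w)"
  have s: "Poly_Mapping.lookup (s i j x) w = x * n i j w" for i j x w
    by (simp add: s_def n_def lookup_single when_def)
  have ss: "scalar c * s i j x = s i j (c * x)" for c i j x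
    by (simp add: s_def scalar_mult_single)
  note ring = distrib_left right_diff_distrib
  have 1: "C = scalar (- e) * A + scalar e * B"
    unfolding A_def B_def C_def ring ss e(2,3)
    by (rule poly_mapping_eqI) (simp add: lookup_add lookup_minus s algebra_simps)
  have 2: "D = scalar f * A + scalar f * B"
    unfolding A_def B_def D_def ring ss f(2,3)
    by (rule poly_mapping_eqI) (simp add: lookup_add lookup_minus s algebra_simps)
  show "C = scalar (- e) * A + scalar e * B" "D = scalar f * A + scalar f * B"
    by (fact 1 2)+
  have g: "scalar x * C + scalar y * D = scalar (y * f - x * e) * A + scalar (y * f + x * e) * B" for x y
  proof -
    have h: "scalar (y * f - x * e) = scalar y * scalar f - scalar x * scalar e"
      "scalar (y * f + x * e) = scalar y * scalar f + scalar x * scalar e"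
      by (simp_all only: scalar_hom)
    show ?thesis unfolding 1 2 h by (simp add: scalar_hom(5) algebra_simps)
  qed
  show "A = scalar (- 1 / (2 * e)) * C + scalar (1 / (2 * f)) * D"
    unfolding g using e(1) f(1) by (simp add: scalar_hom)
  show "B = scalar (1 / (2 * e)) * C + scalar (1 / (2 * f)) * D"
    unfolding g using e(1) f(1) by (simp add: scalar_hom)
qed

lemma Y_gen_mult:
  "Y_gen s t i * Y_gen s t j = Poly_Mapping.single [i, j] (1 / scaling s t $ i * (1 / scaling s t $ j))"
  by (simp add: Y_gen_def scalar_def y_gen_def mult_single plus_list_def)

lemma quadratic_algebra_eq:
  assumes "generic u" "root_choice u s t"
  shows "quadratic_algebra (y_relations u) = quadratic_algebra (Y_relations u (Y_gen s t))"
proof -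
  define c where "c = (\<lambda>i. scaling s t $ i)"
  define S where "S = (\<lambda>i j x. Poly_Mapping.single [i, j :: 4] (x :: complex))"
  define A where "A = (\<lambda>k l m. S k 0 (u $ k) - S 0 k (u $ 0) + S l m (u $ l) - S m l (u $ m))"
  define B where "B = (\<lambda>k l m. S 0 k (u $ k) - S k 0 (u $ 0) + S l m (u $ m) - S m l (u $ l))"
  define d where "d = (\<lambda>i j. 1 / c i * (1 / c j))"
  define C where "C = (\<lambda>k l m. S 0 k (d 0 k) - S k 0 (d 0 k) - (S l m (d l m) + S m l (d l m)))"
  define D where "D = (\<lambda>k l m. S l m (d l m) - S m l (d l m) + (S 0 k (J_coeff u l m * d 0 k) + S k 0 (J_coeff u l m * d 0 k)))"
  have y: "y_relations u = (\<Union>(k, l, m)\<in>cyclic_triples. {A k l m, B k l m})"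
    unfolding y_relations_def scalar_y_gen_mult_eq_single A_def B_def S_def ..
  have Y: "Y_relations u (Y_gen s t) = (\<Union>(k, l, m)\<in>cyclic_triples. {C k l m, D k l m})"
    unfolding Y_relations_def com_def anticom_def Y_gen_mult distrib_left scalar_mult_single C_def D_def S_def d_def c_def
    by (simp add: mult.commute)
  \<comment> \<open>The witnesses are \<open>d 0 k / (u $ 0 + u $ k)\<close> and
    \<open>d l m / (u $ l + u $ m)\<close>. That each fits two equations follows from the scaling
    identity and the factored form of \<open>J_coeff\<close>.\<close>
  have key: "\<exists>e f. e \<noteq> 0 \<and> d 0 k = e * (u $ 0 + u $ k) \<and> d l m = e * (u $ l - u $ m) \<and>
      f \<noteq> 0 \<and> J_coeff u l m * d 0 k = f * (u $ k - u $ 0) \<and> d l m = f * (u $ l + u $ m)"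
    if T: "(k, l, m) \<in> cyclic_triples" for k l m
  proof -
    note sc = root_choice_scaling[OF assms T, folded c_def]
    have J: "J_coeff u l m = (u $ k - u $ 0) * (u $ l - u $ m) / ((u $ 0 + u $ k) * (u $ l + u $ m))"
    proof -
      have "alpha u = (u $ 0 + u $ 1) * (u $ 2 + u $ 3)" "beta u - gamma u = (u $ 1 - u $ 0) * (u $ 2 - u $ 3)"
        "beta u = (u $ 0 + u $ 2) * (u $ 3 + u $ 1)" "gamma u - alpha u = (u $ 2 - u $ 0) * (u $ 3 - u $ 1)"
        "gamma u = (u $ 0 + u $ 3) * (u $ 1 + u $ 2)" "alpha u - beta u = (u $ 3 - u $ 0) * (u $ 1 - u $ 2)"
        by (simp_all add: alpha_def beta_def gamma_def algebra_simps)
      note e = this[symmetric]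
      show ?thesis using T unfolding cyclic_triples_def J_coeff_def by (auto simp: e)
    qed
    have d: "d 0 k * (u $ l - u $ m) = d l m * (u $ 0 + u $ k)"
      using sc unfolding d_def by (simp add: field_simps)
    have frac: "x * y / (p * q) * d' = D' / q * x" if "d' * y = D' * p" "p \<noteq> 0" for x y p q d' D' :: complex
    proof -
      have "x * y / (p * q) * d' = x * (d' * y) / (p * q)" by simp
      also have "\<dots> = D' / q * x" unfolding that(1) using that(2) by simp
      finally show ?thesis .
    qed
    have "d l m = d 0 k * (u $ l - u $ m) / (u $ 0 + u $ k)"
      using d sc(3) by (simp add: nonzero_eq_divide_eq)
    then have "d l m = d 0 k / (u $ 0 + u $ k) * (u $ l - u $ m)" by simp
    moreover have "d l m = d l m / (u $ l + u $ m) * (u $ l + u $ m)" "d 0 k = d 0 k / (u $ 0 + u $ k) * (u $ 0 + u $ k)"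
      using sc(3,5) by simp_all
    moreover have "J_coeff u l m * d 0 k = d l m / (u $ l + u $ m) * (u $ k - u $ 0)"
      unfolding J by (rule frac[OF d sc(3)])
    moreover have "d 0 k / (u $ 0 + u $ k) \<noteq> 0" "d l m / (u $ l + u $ m) \<noteq> 0"
      using sc by (simp_all add: d_def)
    ultimately show ?thesis by blast
  qed
  have comb: "\<exists>p q. C k l m = scalar p * A k l m + scalar q * B k l m" "\<exists>p q. D k l m = scalar p * A k l m + scalar q * B k l m"
    "\<exists>p q. A k l m = scalar p * C k l m + scalar q * D k l m" "\<exists>p q. B k l m = scalar p * C k l m + scalar q * D k l m"
    if T: "(k, l, m) \<in> cyclic_triples" for k l m
  proof -
    obtain e f where "e \<noteq> 0" "d 0 k = e * (u $ 0 + u $ k)" "d l m = e * (u $ l - u $ m)"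
      "f \<noteq> 0" "J_coeff u l m * d 0 k = f * (u $ k - u $ 0)" "d l m = f * (u $ l + u $ m)"
      using key[OF T] by blast
    note rc = relation_combinations[OF this, where k = k and l = l and m = m]
    show "\<exists>p q. C k l m = scalar p * A k l m + scalar q * B k l m"
      unfolding A_def B_def C_def S_def by (intro exI) (rule rc(1))
    show "\<exists>p q. D k l m = scalar p * A k l m + scalar q * B k l m"
      unfolding A_def B_def D_def S_def by (intro exI) (rule rc(2))
    show "\<exists>p q. A k l m = scalar p * C k l m + scalar q * D k l m"
      unfolding A_def C_def D_def S_def by (intro exI) (rule rc(3))
    show "\<exists>p q. B k l m = scalar p * C k l m + scalar q * D k l m"
      unfolding B_def C_def D_def S_def by (intro exI) (rule rc(4))
  qed
  have "Idl\<^bsub>free_ring\<^esub> (y_relations u) \<subseteq> Idl\<^bsub>free_ring\<^esub> (Y_relations u (Y_gen s t))"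
  proof (rule Idl_subset_by_combinations)
    fix r assume "r \<in> y_relations u"
    then obtain k l m where T: "(k, l, m) \<in> cyclic_triples" and "r = A k l m \<or> r = B k l m" unfolding y by auto
    then obtain p q where "r = scalar p * C k l m + scalar q * D k l m" using comb[OF T] by metis
    moreover have "C k l m \<in> Y_relations u (Y_gen s t)" "D k l m \<in> Y_relations u (Y_gen s t)"
      unfolding Y using T by blast+
    ultimately show "\<exists>p q. \<exists>x\<in>Y_relations u (Y_gen s t). \<exists>y\<in>Y_relations u (Y_gen s t). r = scalar p * x + scalar q * y"
      by blast
  qed
  moreover have "Idl\<^bsub>free_ring\<^esub> (Y_relations u (Y_gen s t)) \<subseteq> Idl\<^bsub>free_ring\<^esub> (y_relations u)"
  proof (rule Idl_subset_by_combinations)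
    fix r assume "r \<in> Y_relations u (Y_gen s t)"
    then obtain k l m where T: "(k, l, m) \<in> cyclic_triples" and "r = C k l m \<or> r = D k l m" unfolding Y by auto
    then obtain p q where "r = scalar p * A k l m + scalar q * B k l m" using comb[OF T] by metis
    moreover have "A k l m \<in> y_relations u" "B k l m \<in> y_relations u"
      unfolding y using T by blast+
    ultimately show "\<exists>p q. \<exists>x\<in>y_relations u. \<exists>y\<in>y_relations u. r = scalar p * x + scalar q * y"
      by blast
  qed
  ultimately show ?thesis unfolding quadratic_algebra_def by simp
qed

section \<open>The characteristic variety\<close>

definition forms :: "complex set \<Rightarrow> nat \<Rightarrow> (complex^4 \<Rightarrow> complex^4) \<Rightarrow> bool" where
  "forms K d P \<longleftrightarrow> (\<forall>i. homog_poly K d (\<lambda>x. P x $ i))"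

lemma forms_rational_map: "forms K d P \<Longrightarrow> P x \<noteq> 0 \<Longrightarrow> rational_map K P"
  unfolding forms_def rational_map_def by blast

lemma forms_id: "coeff_ring K \<Longrightarrow> forms K 1 (\<lambda>x. x)"
  unfolding forms_def by (blast intro: homog_poly_coord)

lemma formsD: "forms K d P \<Longrightarrow> homog_poly K d (\<lambda>x. P x $ i)"
  unfolding forms_def by blast

lemma forms_flip0:
  assumes "coeff_ring K" "forms K d P"
  shows "forms K d (\<lambda>x. flip0 (P x))"
  unfolding forms_def forall_four flip0_def vec4_nth
  by (intro conjI homog_poly_minus formsD assms)

lemma forms_had:
  assumes K: "coeff_ring K" "1/2 \<in> K" and P: "forms K d P"
  shows "forms K d (\<lambda>x. had (P x))"
proof -
  have half: "z / 2 = inverse 2 * z" for z :: complex by simp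
  have inv: "inverse 2 \<in> K" using K(2) by (simp add: inverse_eq_divide)
  show ?thesis
    unfolding forms_def forall_four had_def vec4_nth half
    by (intro conjI homog_poly_cmult homog_poly_add homog_poly_diff formsD K inv P)
qed

lemma forms_cremona:
  assumes "coeff_ring K" "forms K 1 P"
  shows "forms K 3 (\<lambda>x. cremona (P x))"
  unfolding forms_def forall_four cremona_def vec4_nth
  by (intro conjI homog_poly_cubic formsD assms)

lemma forms_cross4:
  assumes "coeff_ring K" "forms K 1 P" "forms K 1 Q" "forms K 1 R"
  shows "forms K 3 (\<lambda>x. cross4 (P x) (Q x) (R x))"
  unfolding forms_def forall_four cross4_def vec4_nth
  by (intro conjI homog_poly_diff homog_poly_add homog_poly_cubic formsD assms)

lemma forms_diag_row:
  assumes "coeff_ring K" "forms K 1 P"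
  shows "forms K 1 (\<lambda>x. diag_row i j (P x))"
proof -
  have "homog_poly K 1 (\<lambda>x. axis i (P x $ i) $ k)" for i k
    using assms by (cases "i = k") (auto simp: forms_def axis_def intro: homog_poly_zero)
  then show ?thesis
    unfolding forms_def diag_row_def vector_minus_component by (intro allI homog_poly_diff assms)
qed

lemma forms_wedge_row:
  assumes "forms UNIV 1 P"
  shows "forms UNIV 1 (\<lambda>x. wedge_row1 b c (P x))" "forms UNIV 1 (\<lambda>x. wedge_row2 c a (P x))"
  unfolding forms_def forall_four wedge_row1_def wedge_row2_def vec4_nth
  by (intro conjI homog_poly_diff homog_poly_cmult formsD assms coeff_ring_UNIV UNIV_I)+

lemma forms_chart:
  assumes "T \<in> charts a b c" "forms UNIV 1 P"
  shows "forms UNIV 3 (\<lambda>x. T (P x))"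
  using assms unfolding charts_def
  by (auto intro!: forms_cross4 forms_diag_row forms_wedge_row coeff_ring_UNIV)

section \<open>The birational map over the rationals\<close>

definition sigma_map :: "complex^4 \<Rightarrow> complex^4" where
  "sigma_map Z = had (cremona (had (flip0 Z)))"

definition sigma_inv_map :: "complex^4 \<Rightarrow> complex^4" where
  "sigma_inv_map Z = flip0 (had (cremona (had Z)))"

text \<open>As \<open>had\<close> and \<open>flip0\<close> are involutions and
  \<open>cremona\<close> applied twice is multiplication by a scalar form, both composites multiply
  their argument by a scalar.\<close>

lemma birational_sigma_map: "birational_automorphism \<rat> sigma_map"
proof -
  note K = coeff_ring_Rats
  have half: "1/2 \<in> (\<rat> :: complex set)" by (metis Rats_1 Rats_divide Rats_number_of)
  have inv1: "sigma_inv_map (sigma_map Z) = (had (flip0 Z) $ 0 * had (flip0 Z) $ 1 * had (flip0 Z) $ 2 * had (flip0 Z) $ 3)\<^sup>2 *s Z" for Z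
    unfolding sigma_map_def sigma_inv_map_def by (simp add: cremona_cremona had_scale flip0_scale)
  have inv2: "sigma_map (sigma_inv_map Z) = (had Z $ 0 * had Z $ 1 * had Z $ 2 * had Z $ 3)\<^sup>2 *s Z" for Z
    unfolding sigma_map_def sigma_inv_map_def by (simp add: cremona_cremona had_scale)
  \<comment> \<open>The test points below are preimages of this vector; there the scalar factor
    equals 1.\<close>
  define e where "e = vec4 1 1 1 1"
  have e: "e \<noteq> 0" by (simp add: e_def vec_eq_iff_four)
  have n1: "sigma_inv_map (sigma_map (flip0 (had e))) \<noteq> 0" and n2: "sigma_map (sigma_inv_map (had e)) \<noteq> 0"
    unfolding inv1 inv2 using e by (simp_all add: e_def)
  have zero: "sigma_map 0 = 0" "sigma_inv_map 0 = 0"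
    by (simp_all add: sigma_map_def sigma_inv_map_def cremona_def flip0_def had_def vec_eq_iff_four)
  have "forms \<rat> 3 sigma_map"
    unfolding sigma_map_def[abs_def] by (intro forms_had forms_cremona forms_flip0 forms_id K half)
  then have P: "rational_map \<rat> sigma_map"
    using n1 zero by (intro forms_rational_map[of _ _ _ "flip0 (had e)"]) auto
  have "forms \<rat> 3 sigma_inv_map"
    unfolding sigma_inv_map_def[abs_def] by (intro forms_had forms_cremona forms_flip0 forms_id K half)
  then have Q: "rational_map \<rat> sigma_inv_map"
    using n2 zero by (intro forms_rational_map[of _ _ _ "had e"]) auto
  have "rational_left_inverse sigma_inv_map sigma_map"
    unfolding rational_left_inverse_def
  proof (intro conjI allI impI)
    show "line (sigma_inv_map (sigma_map Z)) = line Z" if "sigma_inv_map (sigma_map Z) \<noteq> 0" for Z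
      using that unfolding inv1 by (intro line_scale) auto
  qed (use n1 in blast)
  moreover have "rational_left_inverse sigma_map sigma_inv_map"
    unfolding rational_left_inverse_def
  proof (intro conjI allI impI)
    show "line (sigma_map (sigma_inv_map Z)) = line Z" if "sigma_map (sigma_inv_map Z) \<noteq> 0" for Z
      using that unfolding inv2 by (intro line_scale) auto
  qed (use n2 in blast)
  ultimately show ?thesis
    unfolding birational_automorphism_def using P Q by blast
qed

lemma on_F_scale: "k \<noteq> 0 \<Longrightarrow> on_F u (k *s Z) \<longleftrightarrow> on_F u Z"
  unfolding on_F_def by (simp add: power_mult_distrib flip: right_diff_distrib)

lemma zcorr_scale: "zcorr u Z Z' \<Longrightarrow> zcorr u (k *s Z) (l *s Z')"
  unfolding zcorr_def flip0_scale had_scale by (rule corr_scale)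

lemma zcorr_cong_line:
  assumes "line Z = line Y" "line Z' = line Y'" "zcorr u Z Z'"
  shows "zcorr u Y Y'"
  using assms zcorr_scale unfolding line_eq_iff by blast

lemma line_flip0: "line (flip0 Z) = line (flip0 Y) \<longleftrightarrow> line Z = line Y"
proof
  assume "line (flip0 Z) = line (flip0 Y)"
  then obtain k where k: "k \<noteq> 0" "flip0 Y = k *s flip0 Z" unfolding line_eq_iff by blast
  have "flip0 (flip0 Y) = k *s Z" unfolding k(2) flip0_scale flip0_flip0 ..
  then show "line Z = line Y" unfolding line_eq_iff using k(1) by auto
qed (auto simp: line_eq_iff flip0_scale)

section \<open>The automorphism for a fixed generic parameter\<close>

locale generic_point =
  fixes u :: "complex^4"
  assumes generic: "generic u"
begin

sublocale curve_params "coef_a u" "coef_b u" "coef_c u"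
  using generic by (rule curve_params_generic)

definition E :: "(complex^4) set set" where
  "E = F_curve u \<union> range e_point"

definition \<Gamma> :: "((complex^4) set \<times> (complex^4) set) set" where
  "\<Gamma> = {(line Z, line Z') | Z Z'. Z \<noteq> 0 \<and> Z' \<noteq> 0 \<and> zcorr u Z Z'}"

text \<open>For \<open>p\<close> in \<open>E\<close> exactly one \<open>q\<close> qualifies. By
  \<open>\<sigma>_eq\<close>, any nonzero corresponding pair then gives a value of
  \<open>\<sigma>\<close>, be it found by charts, by \<open>sigma_map\<close> or by theta
  functions.\<close>

definition \<sigma> :: "(complex^4) set \<Rightarrow> (complex^4) set" where
  "\<sigma> p = (THE q. (p, q) \<in> \<Gamma>)"

lemma line_in_F_curve_iff:
  assumes "Z \<noteq> 0" shows "line Z \<in> F_curve u \<longleftrightarrow> on_F u Z"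
proof
  assume "line Z \<in> F_curve u"
  then obtain Y where "line Z = line Y" "on_F u Y" unfolding F_curve_eq[OF generic] by blast
  then obtain k where "k \<noteq> 0" "Y = k *s Z" "on_F u Y" unfolding line_eq_iff by blast
  then show "on_F u Z" by (simp add: on_F_scale)
qed (use assms F_curve_eq[OF generic] in blast)

lemma line_in_E_iff:
  assumes "Z \<noteq> 0"
  shows "line Z \<in> E \<longleftrightarrow> on_curve (coef_a u) (coef_b u) (coef_c u) (had (flip0 Z)) \<or> is_special (had (flip0 Z))"
proof -
  have "line Z = line (axis \<nu> 1) \<longleftrightarrow> (\<exists>k. k \<noteq> 0 \<and> Z = k *s axis \<nu> 1)" for \<nu>
    by (subst eq_commute) (rule line_eq_iff)
  then have "line Z \<in> range e_point \<longleftrightarrow> (\<exists>\<nu> k. k \<noteq> 0 \<and> Z = k *s axis \<nu> 1)"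
    unfolding e_point_def image_iff by simp
  also have "\<dots> \<longleftrightarrow> (\<exists>\<nu> k. Z = k *s axis \<nu> 1)"
  proof -
    have "k \<noteq> 0" if "Z = k *s axis \<nu> 1" for \<nu> k using that assms by auto
    then show ?thesis by blast
  qed
  finally show ?thesis
    unfolding E_def Un_iff line_in_F_curve_iff[OF assms] on_curve_had on_F_flip0 is_special_had[OF assms] by blast
qed

lemma E_lineE:
  assumes "p \<in> E" obtains Z where "Z \<noteq> 0" "p = line Z"
proof -
  have "axis \<nu> (1::complex) \<noteq> 0" for \<nu> :: 4 by (simp add: axis_eq_0_iff)
  then show ?thesis
    using assms that unfolding E_def F_curve_eq[OF generic] e_point_def by blast
qed

text \<open>The equations of the curve involve only squares, and each \<open>e_point\<close> is
  fixed as a line.\<close>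

lemma E_flip0: "Z \<noteq> 0 \<Longrightarrow> line (flip0 Z) \<in> E \<longleftrightarrow> line Z \<in> E"
proof -
  have *: "line (flip0 Z) \<in> E" if "Z \<noteq> 0" "line Z \<in> E" for Z
  proof -
    have "on_F u Z \<or> (\<exists>\<nu> k. Z = k *s axis \<nu> 1)"
      using that unfolding line_in_E_iff[OF that(1)] on_curve_had on_F_flip0 is_special_had[OF that(1)] by blast
    moreover have "\<forall>\<nu>. \<exists>k'. flip0 (k *s axis \<nu> 1) = k' *s axis \<nu> 1" for k
      unfolding forall_four
      by (intro conjI exI[of _ k] exI[of _ "- k"]; simp add: flip0_def vec_eq_iff_four)
    ultimately have "on_F u (flip0 Z) \<or> (\<exists>\<nu> k. flip0 Z = k *s axis \<nu> 1)"
      unfolding on_F_flip0 by metis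
    moreover have n: "flip0 Z \<noteq> 0" using that(1) by simp
    ultimately show ?thesis
      unfolding line_in_E_iff[OF n] on_curve_had is_special_had[OF n] on_F_flip0 by blast
  qed
  show "line (flip0 Z) \<in> E \<longleftrightarrow> line Z \<in> E" if Z: "Z \<noteq> 0"
  proof
    assume "line (flip0 Z) \<in> E"
    then show "line Z \<in> E" using *[of "flip0 Z"] Z by simp
  qed (rule *[OF Z])
qed

lemma zcorr_imp_in_E:
  assumes "zcorr u Z Z'" "Z \<noteq> 0" "Z' \<noteq> 0"
  shows "line Z \<in> E" "line Z' \<in> E"
proof -
  have *: "line Z \<in> E" if "zcorr u Z Z'" "Z \<noteq> 0" "Z' \<noteq> 0" for Z Z'
    using that corr_imp_on_curve[of "had (flip0 Z)" "had Z'"] unfolding zcorr_def line_in_E_iff[OF that(2)] by simp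
  show "line Z \<in> E" using * assms by blast
  have "line (flip0 Z') \<in> E" using *[of "flip0 Z'" "flip0 Z"] assms zcorr_flip[of u Z Z'] by simp
  then show "line Z' \<in> E" using E_flip0 assms by blast
qed

lemma zcorr_unique:
  assumes "zcorr u Z Z'" "zcorr u Z Z''" "Z \<noteq> 0" "Z' \<noteq> 0" "Z'' \<noteq> 0"
  shows "line Z' = line Z''"
proof -
  have "line (had Z') = line (had Z'')"
    using corr_unique[of "had (flip0 Z)" "had Z'" "had Z''"] assms unfolding zcorr_def by simp
  then obtain k where k: "k \<noteq> 0" "had Z'' = k *s had Z'" unfolding line_eq_iff by blast
  have "had (had Z'') = k *s Z'" unfolding k(2) had_scale had_had ..
  then show ?thesis unfolding line_eq_iff using k(1) by auto
qed

lemma zcorr_unique_left: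
  assumes "zcorr u Z Z'" "zcorr u Y Z'" "Z \<noteq> 0" "Z' \<noteq> 0" "Y \<noteq> 0"
  shows "line Z = line Y"
  using zcorr_unique[of "flip0 Z'" "flip0 Z" "flip0 Y"] assms zcorr_flip[of u Z Z'] zcorr_flip[of u Y Z'] by (simp add: line_flip0)

lemma zcorr_exists:
  assumes "line Z \<in> E" "Z \<noteq> 0"
  obtains Z' where "Z' \<noteq> 0" "zcorr u Z Z'"
proof -
  obtain w where "w \<noteq> 0" "corr (coef_a u) (coef_b u) (coef_c u) (had (flip0 Z)) w"
    using corr_exists[of "had (flip0 Z)"] assms unfolding line_in_E_iff[OF assms(2)] by auto
  then show ?thesis using that[of "had w"] by (simp add: zcorr_def)
qed

lemma zcorr_exists_left:
  assumes "line Z' \<in> E" "Z' \<noteq> 0"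
  obtains Z where "Z \<noteq> 0" "zcorr u Z Z'"
proof -
  obtain Y where "Y \<noteq> 0" "zcorr u (flip0 Z') Y" using zcorr_exists[of "flip0 Z'"] assms E_flip0[of Z'] by auto
  then show ?thesis using that[of "flip0 Y"] zcorr_flip[of u "flip0 Z'" Y] by simp
qed

lemma \<sigma>_eq:
  assumes "zcorr u Z Z'" "Z \<noteq> 0" "Z' \<noteq> 0"
  shows "\<sigma> (line Z) = line Z'"
  unfolding \<sigma>_def
proof (rule the_equality)
  show "(line Z, line Z') \<in> \<Gamma>" unfolding \<Gamma>_def using assms by blast
next
  fix q assume "(line Z, q) \<in> \<Gamma>"
  then obtain Y Y' where Y: "line Z = line Y" "q = line Y'" "Y \<noteq> 0" "Y' \<noteq> 0" "zcorr u Y Y'"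
    unfolding \<Gamma>_def by blast
  have "zcorr u Z Y'" by (rule zcorr_cong_line[OF Y(1)[symmetric] refl Y(5)])
  then show "q = line Z'" using zcorr_unique Y assms by blast
qed

lemma \<Gamma>_graph: "\<Gamma> = {(p, \<sigma> p) | p. p \<in> E}"
proof (intro subset_antisym subsetI)
  fix x assume "x \<in> \<Gamma>"
  then obtain Z Z' where "x = (line Z, line Z')" "Z \<noteq> 0" "Z' \<noteq> 0" "zcorr u Z Z'" unfolding \<Gamma>_def by blast
  then show "x \<in> {(p, \<sigma> p) | p. p \<in> E}" using zcorr_imp_in_E(1)[of Z Z'] \<sigma>_eq[of Z Z'] by auto
next
  fix x assume "x \<in> {(p, \<sigma> p) | p. p \<in> E}"
  then obtain p where x: "x = (p, \<sigma> p)" "p \<in> E" by blast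
  obtain Z where Z: "Z \<noteq> 0" "p = line Z" using E_lineE x(2) by blast
  obtain Z' where "Z' \<noteq> 0" "zcorr u Z Z'" using zcorr_exists x(2) Z by blast
  then show "x \<in> \<Gamma>" unfolding x(1) Z(2) using Z(1) \<sigma>_eq[of Z Z'] unfolding \<Gamma>_def by auto
qed

lemma bij_\<sigma>: "bij_betw \<sigma> E E"
  unfolding bij_betw_def
proof
  show "inj_on \<sigma> E"
  proof (rule inj_onI)
    fix p q assume "p \<in> E" "q \<in> E" and eq: "\<sigma> p = \<sigma> q"
    obtain Y where Y: "Y \<noteq> 0" "p = line Y" using E_lineE \<open>p \<in> E\<close> by blast
    obtain Z where Z: "Z \<noteq> 0" "q = line Z" using E_lineE \<open>q \<in> E\<close> by blast
    obtain Y' where Y': "Y' \<noteq> 0" "zcorr u Y Y'" using zcorr_exists \<open>p \<in> E\<close> Y by blast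
    obtain Z' where Z': "Z' \<noteq> 0" "zcorr u Z Z'" using zcorr_exists \<open>q \<in> E\<close> Z by blast
    have "line Y' = line Z'" using eq \<sigma>_eq[of Y Y'] \<sigma>_eq[of Z Z'] Y Z Y' Z' by simp
    then have "zcorr u Y Z'" using zcorr_cong_line[OF refl _ Y'(2)] by blast
    then show "p = q" using zcorr_unique_left Y Z Z' by blast
  qed
  show "\<sigma> ` E = E"
  proof (intro subset_antisym subsetI)
    fix q assume "q \<in> \<sigma> ` E"
    then obtain p where p: "p \<in> E" "q = \<sigma> p" by blast
    obtain Z where Z: "Z \<noteq> 0" "p = line Z" using E_lineE p by blast
    obtain Z' where "Z' \<noteq> 0" "zcorr u Z Z'" using zcorr_exists p Z by blast
    then show "q \<in> E" using zcorr_imp_in_E(2)[of Z Z'] \<sigma>_eq[of Z Z'] p Z by simp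
  next
    fix q assume "q \<in> E"
    obtain Z' where Z': "Z' \<noteq> 0" "q = line Z'" using E_lineE \<open>q \<in> E\<close> by blast
    obtain Z where Z: "Z \<noteq> 0" "zcorr u Z Z'" using zcorr_exists_left \<open>q \<in> E\<close> Z' by blast
    show "q \<in> \<sigma> ` E"
      by (rule image_eqI[of _ _ "line Z"]) (use Z Z' \<sigma>_eq[of Z Z'] zcorr_imp_in_E(1)[of Z Z'] in auto)
  qed
qed

lemma zcorr_chart:
  assumes "T \<in> charts (coef_a u) (coef_b u) (coef_c u)" "T (had (flip0 Z)) \<noteq> 0" "zcorr u Z Z'" "Z' \<noteq> 0"
  shows "line Z' = line (had (T (had (flip0 Z))))"
proof -
  obtain k where k: "had Z' = k *s T (had (flip0 Z))"
    using chart_unique[OF assms(1,2)] assms(3) unfolding zcorr_def by blast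
  have "k \<noteq> 0"
  proof
    assume "k = 0"
    then have "had Z' = 0" using k by simp
    then show False using assms(4) by simp
  qed
  moreover have "had (had Z') = k *s had (T (had (flip0 Z)))" unfolding k had_scale ..
  then have "Z' = k *s had (T (had (flip0 Z)))" by simp
  ultimately show ?thesis by (simp add: line_scale)
qed

lemma half_coeff: "1/2 \<in> (UNIV :: complex set)" by simp

text \<open>A chart that is nonzero at \<open>x\<close> gives \<open>\<sigma>\<close> at every point
  of \<open>E\<close> where it does not vanish, since the partner solves the linear equations whose
  solutions the chart spans.\<close>

lemma regular_\<sigma>: "regular_on E \<sigma>"
  unfolding regular_on_def
proof (intro allI impI)
  fix x :: "complex^4" assume x: "x \<noteq> 0 \<and> line x \<in> E"
  then obtain T where T: "T \<in> charts (coef_a u) (coef_b u) (coef_c u)" "T (had (flip0 x)) \<noteq> 0"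
    using chart_cover[of "had (flip0 x)"] line_in_E_iff[of x] by auto
  define P where "P = (\<lambda>Z. had (T (had (flip0 Z))))"
  have "forms UNIV 3 P"
    unfolding P_def
    by (intro forms_had forms_chart[OF T(1)] forms_flip0 forms_id coeff_ring_UNIV half_coeff)
  moreover have "P x \<noteq> 0" using T by (simp add: P_def)
  moreover have "\<sigma> (line y) = line (P y)" if y: "y \<noteq> 0" "line y \<in> E" "P y \<noteq> 0" for y
  proof -
    obtain Z' where "Z' \<noteq> 0" "zcorr u y Z'" using zcorr_exists y by blast
    then show ?thesis using \<sigma>_eq[of y Z'] zcorr_chart[OF T(1), of y Z'] y by (simp add: P_def)
  qed
  ultimately show "\<exists>P. rational_map UNIV P \<and> P x \<noteq> 0 \<and> (\<forall>y. y \<noteq> 0 \<and> line y \<in> E \<and> P y \<noteq> 0 \<longrightarrow> \<sigma> (line y) = line (P y))"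
    using forms_rational_map by blast
qed

text \<open>By \<open>zcorr_flip\<close> the inverse is \<open>\<sigma>\<close> conjugated by
  \<open>flip0\<close>, so the same charts serve, now evaluated at \<open>had Z\<close>.\<close>

lemma regular_inv_\<sigma>: "regular_on E (inv_into E \<sigma>)"
  unfolding regular_on_def
proof (intro allI impI)
  fix x :: "complex^4" assume x: "x \<noteq> 0 \<and> line x \<in> E"
  then have "line (flip0 x) \<in> E" using E_flip0 by blast
  with x obtain T where T: "T \<in> charts (coef_a u) (coef_b u) (coef_c u)" "T (had x) \<noteq> 0"
    using chart_cover[of "had x"] line_in_E_iff[of "flip0 x"] by auto
  define P where "P = (\<lambda>Z. flip0 (had (T (had Z))))"
  have "forms UNIV 3 P"
    unfolding P_def
    by (intro forms_had forms_chart[OF T(1)] forms_flip0 forms_id coeff_ring_UNIV half_coeff)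
  moreover have "P x \<noteq> 0" using T by (simp add: P_def)
  moreover have "inv_into E \<sigma> (line y) = line (P y)" if y: "y \<noteq> 0" "line y \<in> E" "P y \<noteq> 0" for y
  proof -
    obtain Z where Z: "Z \<noteq> 0" "zcorr u Z y" using zcorr_exists_left y by blast
    then have "line Z \<in> E" "\<sigma> (line Z) = line y" using zcorr_imp_in_E(1)[of Z y] \<sigma>_eq[of Z y] y by auto
    then have "inv_into E \<sigma> (line y) = line Z"
      using bij_\<sigma> inv_into_f_f[of \<sigma> E "line Z"] unfolding bij_betw_def by simp
    moreover have "line (flip0 Z) = line (had (T (had y)))"
      using zcorr_chart[OF T(1), of "flip0 y" "flip0 Z"] Z y zcorr_flip[of u Z y] by (simp add: P_def)
    then have "line Z = line (P y)"
      unfolding P_def using line_flip0[of Z "flip0 (had (T (had y)))"] by simp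
    ultimately show ?thesis by simp
  qed
  ultimately show "\<exists>P. rational_map UNIV P \<and> P x \<noteq> 0 \<and> (\<forall>y. y \<noteq> 0 \<and> line y \<in> E \<and> P y \<noteq> 0 \<longrightarrow> inv_into E \<sigma> (line y) = line (P y))"
    using forms_rational_map by blast
qed

lemma characteristic_variety: "is_characteristic_variety \<Gamma> E \<sigma>"
proof -
  have "fst ` \<Gamma> = E" "snd ` \<Gamma> = \<sigma> ` E" unfolding \<Gamma>_graph by force+
  then show ?thesis
    using bij_\<sigma> \<Gamma>_graph regular_\<sigma> regular_inv_\<sigma>
    unfolding is_characteristic_variety_def variety_automorphism_def bij_betw_def by simp
qed

text \<open>All terms in \<open>zcorr_iff\<close> are products of coordinates with different
  indices, so a coordinate vector is its own partner.\<close>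

lemma \<sigma>_e_point: "\<sigma> (e_point \<nu>) = e_point \<nu>"
proof -
  have "\<forall>\<nu>. zcorr u (axis \<nu> 1) (axis \<nu> 1)"
    unfolding forall_four zcorr_iff by simp
  then show ?thesis
    unfolding e_point_def by (intro \<sigma>_eq) (auto simp: axis_eq_0_iff)
qed

text \<open>On the curve the forms vanish at most at the four points coming from the vertices where
  \<open>cremona\<close> is zero; elsewhere \<open>on_curve\<close> yields the wedge equations for
  the Cremona image.\<close>

lemma restriction_sigma_map: "restriction_to_curve sigma_map (F_curve u) \<sigma>"
  unfolding restriction_to_curve_def
proof (intro conjI allI impI)
  have "{line x | x. x \<noteq> 0 \<and> line x \<in> F_curve u \<and> sigma_map x = 0} \<subseteq> range (\<lambda>i. line (flip0 (had (axis i 1))))"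
  proof (clarify)
    fix x :: "complex^4" assume x: "x \<noteq> 0" "line x \<in> F_curve u" "sigma_map x = 0"
    then obtain i k where k: "k \<noteq> 0" "had (flip0 x) = k *s axis i 1"
      using on_curve_cremona_zero[of "had (flip0 x)"] line_in_E_iff[of x] unfolding sigma_map_def E_def by auto
    have "x = flip0 (had (had (flip0 x)))" by simp
    also have "\<dots> = k *s flip0 (had (axis i 1))" unfolding k by (simp add: had_scale flip0_scale)
    finally show "line x \<in> range (\<lambda>i. line (flip0 (had (axis i 1))))"
      using k(1) by (auto simp: line_scale)
  qed
  then show "finite {line x | x. x \<noteq> 0 \<and> line x \<in> F_curve u \<and> sigma_map x = 0}"
    by (rule finite_subset) simp
next
  fix x assume x: "x \<noteq> 0 \<and> line x \<in> F_curve u \<and> sigma_map x \<noteq> 0"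
  then have "on_curve (coef_a u) (coef_b u) (coef_c u) (had (flip0 x))"
    unfolding on_curve_had on_F_flip0 using line_in_F_curve_iff by blast
  then have "zcorr u x (sigma_map x)"
    unfolding zcorr_def sigma_map_def had_had corr_cremona_iff on_curve_def by simp
  then show "\<sigma> (line x) = line (sigma_map x)" using \<sigma>_eq x by blast
qed

end

section \<open>Theta functions\<close>

lemma abs_summable_product_Times:
  fixes f :: "'a \<Rightarrow> complex" and g :: "'b \<Rightarrow> complex"
  assumes "(\<lambda>x. norm (f x)) summable_on A" and "(\<lambda>y. norm (g y)) summable_on B"
  shows "(\<lambda>(x, y). f x * g y) summable_on (A \<times> B)"
    and "infsum (\<lambda>(x, y). f x * g y) (A \<times> B) = infsum f A * infsum g B"
proof -
  have "(\<lambda>p. norm (case p of (x, y) \<Rightarrow> f x * g y)) summable_on (A \<times> B)"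
  proof (rule summable_on_SigmaI)
    show "((\<lambda>y. norm (case (x, y) of (x, y) \<Rightarrow> f x * g y)) has_sum (norm (f x) * (\<Sum>\<^sub>\<infinity>y\<in>B. norm (g y)))) B" for x
      using assms(2) by (auto simp: norm_mult intro!: has_sum_cmult_right has_sum_infsum)
    show "(\<lambda>x. norm (f x) * (\<Sum>\<^sub>\<infinity>y\<in>B. norm (g y))) summable_on A"
      using assms(1) by (intro summable_on_cmult_left)
  qed auto
  then show s: "(\<lambda>(x, y). f x * g y) summable_on (A \<times> B)"
    by (rule abs_summable_summable)
  have "infsum (\<lambda>(x, y). f x * g y) (A \<times> B) = (\<Sum>\<^sub>\<infinity>x\<in>A. \<Sum>\<^sub>\<infinity>y\<in>B. f x * g y)"
    using infsum_Sigma'_banach[of "\<lambda>x y. f x * g y" A "\<lambda>_. B"] s by simp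
  also have "\<dots> = infsum f A * infsum g B"
    unfolding infsum_cmult_right' infsum_cmult_left' ..
  finally show "infsum (\<lambda>(x, y). f x * g y) (A \<times> B) = infsum f A * infsum g B" .
qed

lemma summable_on_exp_neg_abs_int: "(\<lambda>n::int. exp (- \<bar>real_of_int n\<bar>)) summable_on UNIV"
proof -
  have g: "(\<lambda>n::nat. exp (- real n)) summable_on UNIV"
  proof -
    have "summable (\<lambda>n::nat. (exp (-1::real)) ^ n)" by (rule summable_geometric) simp
    then have "summable (\<lambda>n::nat. exp (- real n))" by (simp flip: exp_of_nat_mult)
    then show ?thesis by (simp add: summable_on_UNIV_nonneg_real_iff)
  qed
  have U: "UNIV = range int \<union> range (\<lambda>n. - int n)"
  proof (rule UNIV_eq_I)
    show "n \<in> range int \<union> range (\<lambda>n. - int n)" for n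
      by (cases n rule: int_cases2) auto
  qed
  have "(\<lambda>n::int. exp (- \<bar>real_of_int n\<bar>)) summable_on range int"
    using g by (subst summable_on_reindex) (auto simp: o_def)
  moreover have "(\<lambda>n::int. exp (- \<bar>real_of_int n\<bar>)) summable_on range (\<lambda>n. - int n)"
    using g by (subst summable_on_reindex) (auto simp: o_def inj_on_def)
  ultimately show ?thesis
    by (subst U) (rule summable_on_union)
qed

definition theta_term :: "real \<Rightarrow> real \<Rightarrow> complex \<Rightarrow> complex \<Rightarrow> int \<Rightarrow> complex" where
  "theta_term a b \<tau> z n = exp (\<i> * of_real pi * \<tau> * (of_int n + of_real a)\<^sup>2
        + 2 * \<i> * of_real pi * (of_int n + of_real a) * (z + of_real b))"

lemma theta_char_eq: "theta_char a b \<tau> z = (\<Sum>\<^sub>\<infinity>n. theta_term a b \<tau> z n)"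
  by (simp add: theta_char_def theta_term_def)

text \<open>The Gaussian factor beats the exponential growth in \<open>n\<close>. As the bound
  depends on \<open>z\<close> only through \<open>R\<close>, it gives absolute summability as well
  as locally uniform convergence.\<close>

lemma norm_theta_term_le:
  assumes "Im \<tau> > 0" and "\<bar>Im z\<bar> \<le> R"
  shows "norm (theta_term a b \<tau> z n)
     \<le> exp (\<bar>a\<bar> + (2 * pi * R + 1)\<^sup>2 / (4 * pi * Im \<tau>)) * exp (- \<bar>real_of_int n\<bar>)"
proof -
  define m where "m = real_of_int n + a"
  have m: "of_int n + of_real a = complex_of_real m" by (simp add: m_def)
  have 1: "norm (theta_term a b \<tau> z n) = exp (- (pi * Im \<tau> * m\<^sup>2) - 2 * pi * m * Im z)"
    unfolding theta_term_def m norm_exp_eq_Re by (simp add: power2_eq_square algebra_simps)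
  define c where "c = pi * Im \<tau>"
  have c: "c > 0" using assms by (simp add: c_def)
  \<comment> \<open>The growth rate is at most \<open>r - 1\<close>; the extra 1 leaves a decaying
    factor in \<open>n\<close> after completing the square in \<open>\<bar>m\<bar>\<close>.\<close>
  define r where "r = 2 * pi * R + 1"
  have "0 \<le> (2 * c * \<bar>m\<bar> - r)\<^sup>2" by simp
  then have "4 * c * (r * \<bar>m\<bar> - c * m\<^sup>2) \<le> r\<^sup>2"
    by (simp add: power2_eq_square algebra_simps)
  then have "r * \<bar>m\<bar> - c * m\<^sup>2 \<le> r\<^sup>2 / (4 * c)"
    using c by (simp add: field_simps)
  moreover have "- (m * Im z) \<le> \<bar>m\<bar> * R"
    using abs_ge_minus_self[of "m * Im z"] mult_left_mono[OF assms(2), of "\<bar>m\<bar>"] by (simp add: abs_mult)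
  then have "- (2 * pi * m * Im z) \<le> (r - 1) * \<bar>m\<bar>"
    using mult_left_mono[of "- (m * Im z)" "\<bar>m\<bar> * R" "2 * pi"] by (simp add: r_def algebra_simps)
  ultimately have "- (c * m\<^sup>2) - 2 * pi * m * Im z \<le> r\<^sup>2 / (4 * c) - \<bar>m\<bar>"
    by (simp add: algebra_simps)
  moreover have "\<bar>real_of_int n\<bar> \<le> \<bar>m\<bar> + \<bar>a\<bar>" by (simp add: m_def)
  ultimately have "- (c * m\<^sup>2) - 2 * pi * m * Im z \<le> \<bar>a\<bar> + r\<^sup>2 / (4 * c) - \<bar>real_of_int n\<bar>"
    by simp
  then show ?thesis
    unfolding 1 by (simp add: c_def r_def mult.assoc flip: exp_add)
qed

lemma summable_on_norm_theta_term:
  assumes "Im \<tau> > 0"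
  shows "(\<lambda>n. norm (theta_term a b \<tau> z n)) summable_on UNIV"
  by (rule summable_on_comparison_test[OF summable_on_cmult_right[OF summable_on_exp_neg_abs_int]
        norm_theta_term_le[OF assms order_refl]]) auto

text \<open>The Weierstrass test applies on each ball about 0, and these balls exhaust the
  plane.\<close>

lemma holomorphic_theta_char:
  assumes "Im \<tau> > 0"
  shows "theta_char a b \<tau> holomorphic_on UNIV"
proof -
  have "theta_char a b \<tau> holomorphic_on ball 0 R" for R
  proof (rule holomorphic_uniform_limit)
    show "\<forall>\<^sub>F X in finite_subsets_at_top UNIV.
        continuous_on (cball 0 R) (\<lambda>z. \<Sum>n\<in>X. theta_term a b \<tau> z n) \<and>
        (\<lambda>z. \<Sum>n\<in>X. theta_term a b \<tau> z n) holomorphic_on ball 0 R"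
      unfolding theta_term_def
      by (intro always_eventually allI conjI continuous_intros holomorphic_intros)
    show "uniform_limit (cball 0 R) (\<lambda>X z. \<Sum>n\<in>X. theta_term a b \<tau> z n) (theta_char a b \<tau>)
        (finite_subsets_at_top UNIV)"
      unfolding theta_char_eq[abs_def]
    proof (rule Weierstrass_m_test_general)
      show "norm (theta_term a b \<tau> z n)
        \<le> exp (\<bar>a\<bar> + (2 * pi * R + 1)\<^sup>2 / (4 * pi * Im \<tau>)) * exp (- \<bar>real_of_int n\<bar>)"
        if "z \<in> cball 0 R" for z n
        using that abs_Im_le_cmod[of z] by (intro norm_theta_term_le assms) auto
    qed (intro summable_on_cmult_right summable_on_exp_neg_abs_int)
  qed (auto simp: finite_subsets_at_top_neq_bot)
  then have "theta_char a b \<tau> holomorphic_on (\<Union>n::nat. ball 0 (real n))"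
    by (intro holomorphic_on_UN_open) auto
  moreover have "(\<Union>n::nat. ball 0 (real n)) = (UNIV :: complex set)"
    by (auto simp: reals_Archimedean2)
  ultimately show ?thesis by simp
qed

section \<open>Transformation rules\<close>

lemma theta_char_add_one_left: "theta_char (a + 1) b \<tau> z = theta_char a b \<tau> z"
  unfolding theta_char_eq
  by (rule infsum_reindex_bij_witness[of _ "\<lambda>n. n - 1" "\<lambda>n. n + 1"]) (auto simp: theta_term_def algebra_simps)

lemma theta_char_add_right: "theta_char a (b + of_int k) \<tau> z = exp (2 * \<i> * pi * a * of_int k) * theta_char a b \<tau> z"
proof -
  have "exp (2 * \<i> * pi * of_int (n * k)) = 1" for n
    using exp_integer_2pi[of "of_int (n * k)"] by (simp add: ac_simps)
  moreover have "theta_term a (b + of_int k) \<tau> z n =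
      exp (2 * \<i> * pi * a * of_int k) * theta_term a b \<tau> z n * exp (2 * \<i> * pi * of_int (n * k))" for n
    unfolding theta_term_def exp_add[symmetric]
    by (rule arg_cong[of _ _ exp]) (simp add: algebra_simps)
  ultimately have "theta_term a (b + of_int k) \<tau> z n = exp (2 * \<i> * pi * a * of_int k) * theta_term a b \<tau> z n" for n
    by simp
  then show ?thesis
    unfolding theta_char_eq infsum_cmult_right'[symmetric] by (rule infsum_cong)
qed

lemma theta_char_minus: "theta_char (-a) (-b) \<tau> (-z) = theta_char a b \<tau> z"
  unfolding theta_char_eq
  by (rule infsum_reindex_bij_witness[of _ uminus uminus])
     (auto simp: theta_term_def algebra_simps power2_eq_square)

text \<open>Adding the period completes the square for the index \<open>n + 1\<close>, so the series
  is only shifted.\<close>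

lemma theta_char_add_period:
  "theta_char a b \<tau> (z + \<tau>) = exp (- (\<i> * pi * (\<tau> + 2 * z + 2 * b))) * theta_char a b \<tau> z"
proof -
  have "theta_term a b \<tau> (z + \<tau>) n = exp (- (\<i> * pi * (\<tau> + 2 * z + 2 * b))) * theta_term a b \<tau> z (n + 1)" for n
    unfolding theta_term_def exp_add[symmetric]
    by (rule arg_cong[of _ _ exp]) (simp add: algebra_simps power2_eq_square)
  then have "theta_char a b \<tau> (z + \<tau>) = exp (- (\<i> * pi * (\<tau> + 2 * z + 2 * b))) * (\<Sum>\<^sub>\<infinity>n. theta_term a b \<tau> z (n + 1))"
    unfolding theta_char_eq infsum_cmult_right'[symmetric] by (rule infsum_cong)
  also have "(\<Sum>\<^sub>\<infinity>n. theta_term a b \<tau> z (n + 1)) = theta_char a b \<tau> z"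
    unfolding theta_char_eq
    by (rule infsum_reindex_bij_witness[of _ "\<lambda>n. n - 1" "\<lambda>n. n + 1"]) auto
  finally show ?thesis .
qed

lemma theta_char_add_one: "theta_char a b \<tau> (z + 1) = exp (2 * \<i> * pi * a) * theta_char a b \<tau> z"
  using theta_char_add_right[of a b 1 \<tau> z] by (simp add: theta_char_def add_ac)

text \<open>The pairs of integers split according to the parity of their sum; both classes are
  parametrized by half sum and half difference.\<close>

lemma theta_char_mult:
  assumes "Im \<tau> > 0"
  shows "theta_char a b \<tau> (x + y) * theta_char a' b' \<tau> (x - y) =
    theta_char ((a + a') / 2) (b + b') (2 * \<tau>) (2 * x) * theta_char ((a - a') / 2) (b - b') (2 * \<tau>) (2 * y) +
    theta_char ((a + a' + 1) / 2) (b + b') (2 * \<tau>) (2 * x) * theta_char ((a - a' + 1) / 2) (b - b') (2 * \<tau>) (2 * y)"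
proof -
  define f where "f = (\<lambda>(n, m). theta_term a b \<tau> (x + y) n * theta_term a' b' \<tau> (x - y) m)"
  define g where "g = (\<lambda>e (s, d). theta_term ((a + a' + of_int e) / 2) (b + b') (2 * \<tau>) (2 * x) s *
      theta_term ((a - a' + of_int e) / 2) (b - b') (2 * \<tau>) (2 * y) d)"
  define h where "h = (\<lambda>e (s::int, d). (s + d + e, s - d))"
  have im2: "Im (2 * \<tau>) > 0" using assms by simp
  note p1 = abs_summable_product_Times[OF summable_on_norm_theta_term[OF assms] summable_on_norm_theta_term[OF assms]]
  note p2 = abs_summable_product_Times[OF summable_on_norm_theta_term[OF im2] summable_on_norm_theta_term[OF im2]]
  have "f summable_on UNIV" using p1(1) unfolding f_def by simp
  then have fs: "f summable_on X" for X by (rule summable_on_subset_banach) simp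
  have inj: "inj_on (h e) UNIV" for e
    by (auto simp: h_def inj_on_def)
  have fg: "f \<circ> h e = g e" for e
  proof (rule ext, clarify)
    fix s d
    \<comment> \<open>With \<open>S\<close> and \<open>D\<close> the shifted indices of the
      right-hand side, the shifted indices on the left are \<open>S + D\<close> and
      \<open>S - D\<close>. Their squares add up to twice the squares of \<open>S\<close> and
      \<open>D\<close>, which doubles the period.\<close>
    have "theta_term a b \<tau> (x + y) (s + d + e) * theta_term a' b' \<tau> (x - y) (s - d) =
       theta_term ((a + a' + of_int e) / 2) (b + b') (2 * \<tau>) (2 * x) s *
      theta_term ((a - a' + of_int e) / 2) (b - b') (2 * \<tau>) (2 * y) d"
      unfolding theta_term_def exp_add[symmetric]
      by (rule arg_cong[of _ _ exp]) (simp add: field_simps power2_eq_square)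
    then show "(f \<circ> h e) (s, d) = g e (s, d)"
      by (simp add: f_def g_def h_def)
  qed
  have U: "UNIV = range (h 0) \<union> range (h 1)"
  proof (rule UNIV_eq_I)
    fix p :: "int \<times> int"
    obtain n m where p: "p = (n, m)" by (cases p)
    show "p \<in> range (h 0) \<union> range (h 1)"
    proof (cases "even (n + m)")
      case True
      then obtain s where s: "n + m = 2 * s" by (elim evenE)
      then have "p = h 0 (s, n - s)" by (simp add: h_def p)
      then show ?thesis by blast
    next
      case False
      then obtain s where s: "n + m = 2 * s + 1" by (elim oddE)
      then have "p = h 1 (s, n - s - 1)" by (simp add: h_def p)
      then show ?thesis by blast
    qed
  qed
  have disj: "range (h 0) \<inter> range (h 1) = {}"
    by (auto simp: h_def) presburger
  have "theta_char a b \<tau> (x + y) * theta_char a' b' \<tau> (x - y) = infsum f UNIV"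
    using p1(2) by (simp add: theta_char_eq f_def)
  also have "\<dots> = infsum f (range (h 0) \<union> range (h 1))"
    by (rule arg_cong[OF U])
  also have "\<dots> = infsum f (range (h 0)) + infsum f (range (h 1))"
    by (rule infsum_Un_disjoint[OF fs fs disj])
  also have "\<dots> = infsum (g 0) UNIV + infsum (g 1) UNIV"
    using infsum_reindex[OF inj, of f] by (simp add: fg)
  also have "\<dots> = theta_char ((a + a') / 2) (b + b') (2 * \<tau>) (2 * x) * theta_char ((a - a') / 2) (b - b') (2 * \<tau>) (2 * y) +
    theta_char ((a + a' + 1) / 2) (b + b') (2 * \<tau>) (2 * x) * theta_char ((a - a' + 1) / 2) (b - b') (2 * \<tau>) (2 * y)"
    using p2(2) by (simp add: g_def theta_char_eq)
  finally show ?thesis .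
qed

section \<open>Entire functions and lattices\<close>

lemma periodic_add_of_int:
  fixes f :: "complex \<Rightarrow> 'a"
  assumes "\<And>z. f (z + p) = f z"
  shows "f (z + of_int n * p) = f z"
proof (induction n rule: int_induct[of _ 0])
  case base
  then show ?case by simp
next
  case (step1 i)
  then show ?case using assms[of "z + of_int i * p"] by (simp add: algebra_simps)
next
  case (step2 i)
  then show ?case using assms[of "z + of_int (i - 1) * p"] by (simp add: algebra_simps)
qed

text \<open>Removing the integer parts of the coordinates with respect to 1 and
  \<open>\<tau>\<close> moves every argument into a compact parallelogram, so \<open>f\<close> is
  bounded.\<close>

lemma doubly_periodic_entire_constant:
  assumes hol: "f holomorphic_on UNIV" and im: "Im \<tau> > 0"
    and per: "\<And>z. f (z + 1) = f z" "\<And>z. f (z + \<tau>) = f z"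
  shows "f constant_on UNIV"
proof (rule Liouville_theorem[OF hol])
  define K where "K = (\<lambda>(s, t). of_real s + of_real t * \<tau>) ` ({0..1::real} \<times> {0..1::real})"
  have "compact K"
    unfolding K_def case_prod_unfold
    by (intro compact_continuous_image compact_Times compact_Icc continuous_intros)
  then have "bounded (f ` K)"
    by (intro compact_imp_bounded compact_continuous_image holomorphic_on_imp_continuous_on
          holomorphic_on_subset[OF hol]) auto
  moreover have "f z \<in> f ` K" for z
  proof -
    define t where "t = Im z / Im \<tau>"
    define s where "s = Re z - t * Re \<tau>"
    have z: "z = of_real s + of_real t * \<tau>"
      using im by (simp add: complex_eq_iff s_def t_def)
    have "f z = f (z + of_int (- \<lfloor>s\<rfloor>) * 1 + of_int (- \<lfloor>t\<rfloor>) * \<tau>)"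
      using periodic_add_of_int[of f 1] periodic_add_of_int[of f \<tau>] per by metis
    also have "z + of_int (- \<lfloor>s\<rfloor>) * 1 + of_int (- \<lfloor>t\<rfloor>) * \<tau> = of_real (frac s) + of_real (frac t) * \<tau>"
      by (simp add: z frac_def algebra_simps)
    finally have "f z = f (of_real (frac s) + of_real (frac t) * \<tau>)" .
    moreover have "of_real (frac s) + of_real (frac t) * \<tau> \<in> K"
      unfolding K_def by (rule image_eqI[of _ _ "(frac s, frac t)"]) (auto simp: frac_lt_1 less_imp_le)
    ultimately show ?thesis by blast
  qed
  then have "range f \<subseteq> f ` K" by blast
  ultimately show "bounded (range f)" by (rule bounded_subset)
qed

text \<open>If \<open>g\<close> had no zero, the derivative of \<open>g' / g\<close> would be entire and doubly periodic, so
  \<open>g' / g\<close> would be affine; its increment along the period \<open>1\<close> vanishes, that along \<open>\<tau>\<close> does not.\<close>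

lemma quasi_periodic_entire_has_zero:
  assumes hol: "g holomorphic_on UNIV" and im: "Im \<tau> > 0"
    and per: "\<And>z. g (z + 1) = g z" "\<And>z. g (z + \<tau>) = exp (c + d * z) * g z" and "d \<noteq> 0"
  shows "\<exists>z. g z = 0"
proof (rule ccontr)
  assume "\<nexists>z. g z = 0"
  then have nz: "g z \<noteq> 0" for z by blast
  define h where "h = (\<lambda>z. deriv g z / g z)"
  have gd: "(g has_field_derivative deriv g z) (at z)" for z
    using hol by (simp add: holomorphic_derivI)
  have hh: "h holomorphic_on UNIV"
    unfolding h_def using nz by (intro holomorphic_intros holomorphic_deriv hol) auto
  have hd: "(h has_field_derivative deriv h z) (at z)" for z
    using hh by (simp add: holomorphic_derivI)
  have shift: "((\<lambda>z. f (z + p)) has_field_derivative deriv f (z + p)) (at z)"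
    if "\<And>z. (f has_field_derivative deriv f z) (at z)" for f :: "complex \<Rightarrow> complex" and p z
    using that[of "z + p"] by (simp add: DERIV_shift)
  have h1: "h (z + 1) = h z" for z
    using DERIV_unique[OF shift[OF gd, of 1 z]] gd[of z] per(1) by (simp add: h_def)
  have ht: "h (z + \<tau>) = h z + d" for z
  proof -
    have "((\<lambda>z. exp (c + d * z) * g z) has_field_derivative
        exp (c + d * z) * deriv g z + exp (c + d * z) * d * g z) (at z)"
      by (rule derivative_eq_intros gd refl | simp)+
    then have "deriv g (z + \<tau>) = exp (c + d * z) * deriv g z + exp (c + d * z) * d * g z"
      using DERIV_unique[OF shift[OF gd, of \<tau> z]] by (simp add: per(2))
    then show ?thesis
      using nz[of z] unfolding h_def per(2) by (simp add: divide_simps) (simp add: algebra_simps)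
  qed
  have "deriv h constant_on UNIV"
  proof (rule doubly_periodic_entire_constant[OF _ im])
    show "deriv h holomorphic_on UNIV" by (intro holomorphic_deriv hh) auto
    show "deriv h (z + 1) = deriv h z" for z
      using DERIV_unique[OF shift[OF hd, of 1 z]] hd[of z] h1 by simp
    have "((\<lambda>z. h z + d) has_field_derivative deriv h z) (at z)" for z
      by (rule derivative_eq_intros hd refl | simp)+
    then show "deriv h (z + \<tau>) = deriv h z" for z
      using DERIV_unique[OF shift[OF hd, of \<tau> z]] by (simp add: ht)
  qed
  then obtain a where a: "\<And>z. deriv h z = a" by (auto simp: constant_on_def)
  have "((\<lambda>z. h z - a * z) has_field_derivative 0) (at z)" for z
    by (rule derivative_eq_intros hd refl | simp add: a)+
  then have "\<exists>b. \<forall>z\<in>UNIV. h z - a * z = b"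
    by (intro has_field_derivative_zero_constant) auto
  then obtain b where b: "\<And>z. h z = a * z + b" by (auto simp: algebra_simps)
  have "a = 0" using h1[of 0] by (simp add: b)
  then show False using ht[of 0] \<open>d \<noteq> 0\<close> by (simp add: b)
qed

section \<open>Theta functions for the doubled period\<close>

definition dtheta :: "real \<Rightarrow> real \<Rightarrow> complex \<Rightarrow> complex \<Rightarrow> complex" where
  "dtheta a b \<tau> x = theta_char a b (2 * \<tau>) (2 * x)"

lemma holomorphic_dtheta:
  assumes "Im \<tau> > 0"
  shows "dtheta a b \<tau> holomorphic_on UNIV"
proof -
  have "theta_char a b (2 * \<tau>) \<circ> (\<lambda>x. 2 * x) holomorphic_on UNIV"
    using assms by (intro holomorphic_on_compose holomorphic_intros
        holomorphic_on_subset[OF holomorphic_theta_char]) auto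
  then show ?thesis by (simp add: dtheta_def[abs_def] o_def)
qed

text \<open>The fractions stay under \<open>complex_of_real\<close>, the shape in which the shift
  rules produce these exponents.\<close>

lemma exp_quarter_turns:
  "exp (2 * \<i> * pi * complex_of_real (1/2)) = -1"
  "exp (- (2 * \<i> * pi * complex_of_real (1/2))) = -1"
  "exp (2 * \<i> * pi * complex_of_real (1/4)) = \<i>"
  "exp (- (2 * \<i> * pi * complex_of_real (1/4))) = -\<i>"
proof -
  show 1: "exp (2 * \<i> * pi * complex_of_real (1/2)) = -1"
    using exp_pi_i' by (simp add: ac_simps)
  have "exp (\<i> * (complex_of_real pi / 2)) = \<i>"
    using cis_pi_half by (simp add: cis_conv_exp)
  then show 2: "exp (2 * \<i> * pi * complex_of_real (1/4)) = \<i>" by simp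
  show "exp (- (2 * \<i> * pi * complex_of_real (1/2))) = -1" "exp (- (2 * \<i> * pi * complex_of_real (1/4))) = -\<i>"
    unfolding exp_minus 1 2 by simp_all
qed

text \<open>Both functions have period 1 and the same multiplier under adding \<open>\<tau>\<close>,
  whose exponent has the nonzero slope \<open>- 4 * \<i> * pi\<close>; the combination inherits
  this.\<close>

lemma dtheta_combination_has_zero:
  assumes "Im \<tau> > 0"
  shows "\<exists>x. p * dtheta 0 0 \<tau> x + q * dtheta (1/2) 0 \<tau> x = 0"
proof (rule quasi_periodic_entire_has_zero[OF _ assms])
  show "(\<lambda>x. p * dtheta 0 0 \<tau> x + q * dtheta (1/2) 0 \<tau> x) holomorphic_on UNIV"
    by (intro holomorphic_intros holomorphic_dtheta assms)
  have "dtheta a 0 \<tau> (x + 1) = exp (2 * \<i> * pi * a) * (exp (2 * \<i> * pi * a) * dtheta a 0 \<tau> x)" for a x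
    using theta_char_add_one[of a 0 "2 * \<tau>" "2 * x"] theta_char_add_one[of a 0 "2 * \<tau>" "2 * x + 1"]
    by (simp add: dtheta_def algebra_simps)
  from this[of 0] this[of "1/2", unfolded exp_quarter_turns]
  show "p * dtheta 0 0 \<tau> (x + 1) + q * dtheta (1/2) 0 \<tau> (x + 1)
      = p * dtheta 0 0 \<tau> x + q * dtheta (1/2) 0 \<tau> x" for x
    by simp
  have shift: "dtheta a 0 \<tau> (x + \<tau>) = exp (- (2 * \<i> * pi * \<tau>) + (- 4 * \<i> * pi) * x) * dtheta a 0 \<tau> x" for a x
    using theta_char_add_period[of a 0 "2 * \<tau>" "2 * x"]
    by (simp add: dtheta_def algebra_simps)
  then show "p * dtheta 0 0 \<tau> (x + \<tau>) + q * dtheta (1/2) 0 \<tau> (x + \<tau>)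
      = exp (- (2 * \<i> * pi * \<tau>) + (- 4 * \<i> * pi) * x) * (p * dtheta 0 0 \<tau> x + q * dtheta (1/2) 0 \<tau> x)" for x
    unfolding shift by (simp add: algebra_simps)
qed simp

lemma dtheta_shift:
  shows dtheta_one_left: "dtheta 1 b \<tau> x = dtheta 0 b \<tau> x"
    and dtheta_one_right: "dtheta a 1 \<tau> x = exp (2 * \<i> * pi * a) * dtheta a 0 \<tau> x"
    and dtheta_neg_half: "dtheta a (- (1/2)) \<tau> x = exp (- (2 * \<i> * pi * a)) * dtheta a (1/2) \<tau> x"
    and dtheta_three_quarters: "dtheta (3/4) b \<tau> x = dtheta (1/4) (- b) \<tau> (- x)"
    and dtheta_neg_quarter: "dtheta (- (1/4)) b \<tau> x = dtheta (1/4) (- b) \<tau> (- x)"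
  using theta_char_add_one_left[of 0 b "2 * \<tau>" "2 * x"]
    theta_char_add_right[of a 0 1 "2 * \<tau>" "2 * x"]
    theta_char_add_right[of a "1/2" "-1" "2 * \<tau>" "2 * x"]
    theta_char_add_one_left[of "-1/4" b "2 * \<tau>" "2 * x"]
    theta_char_minus[of "1/4" "-b" "2 * \<tau>" "- (2 * x)"]
  by (simp_all add: dtheta_def)

text \<open>The product formula yields characteristics outside the chosen representatives; this
  table brings them back, where 3/4 and -1/4 reflect to 1/4 at \<open>- x\<close>.\<close>

lemma dtheta_reduce:
  "dtheta 0 1 \<tau> x = dtheta 0 0 \<tau> x"
  "dtheta (1/2) 1 \<tau> x = - dtheta (1/2) 0 \<tau> x"
  "dtheta 1 1 \<tau> x = dtheta 0 0 \<tau> x"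
  "dtheta 1 b \<tau> x = dtheta 0 b \<tau> x"
  "dtheta (1/4) 1 \<tau> x = \<i> * dtheta (1/4) 0 \<tau> x"
  "dtheta (3/4) 1 \<tau> x = - \<i> * dtheta (1/4) 0 \<tau> (- x)"
  "dtheta (3/4) 0 \<tau> x = dtheta (1/4) 0 \<tau> (- x)"
  "dtheta 0 (- (1/2)) \<tau> x = dtheta 0 (1/2) \<tau> x"
  "dtheta (1/2) (- (1/2)) \<tau> x = - dtheta (1/2) (1/2) \<tau> x"
  "dtheta (3/4) (1/2) \<tau> x = - \<i> * dtheta (1/4) (1/2) \<tau> (- x)"
  "dtheta (- (1/4)) (1/2) \<tau> x = - \<i> * dtheta (1/4) (1/2) \<tau> (- x)"
proof -
  show one: "dtheta 1 b \<tau> x = dtheta 0 b \<tau> x" for b by (rule dtheta_one_left)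
  show zo: "dtheta 0 1 \<tau> x = dtheta 0 0 \<tau> x" using dtheta_one_right[of 0] by simp
  show "dtheta 1 1 \<tau> x = dtheta 0 0 \<tau> x" unfolding one zo ..
  show "dtheta (1/2) 1 \<tau> x = - dtheta (1/2) 0 \<tau> x"
    unfolding dtheta_one_right exp_quarter_turns by simp
  show "dtheta (1/4) 1 \<tau> x = \<i> * dtheta (1/4) 0 \<tau> x"
    unfolding dtheta_one_right exp_quarter_turns ..
  have neg: "dtheta (1/4) (-1) \<tau> y = - \<i> * dtheta (1/4) 0 \<tau> y" for y
    using theta_char_add_right[of "1/4" 0 "-1" "2 * \<tau>" "2 * y"] exp_quarter_turns(4)
    by (simp add: dtheta_def del: of_real_divide)
  show "dtheta (3/4) 1 \<tau> x = - \<i> * dtheta (1/4) 0 \<tau> (- x)"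
    unfolding dtheta_three_quarters neg ..
  show "dtheta (3/4) 0 \<tau> x = dtheta (1/4) 0 \<tau> (- x)"
    unfolding dtheta_three_quarters by simp
  show "dtheta 0 (- (1/2)) \<tau> x = dtheta 0 (1/2) \<tau> x"
    unfolding dtheta_neg_half by simp
  show "dtheta (1/2) (- (1/2)) \<tau> x = - dtheta (1/2) (1/2) \<tau> x"
    unfolding dtheta_neg_half exp_quarter_turns by simp
  show "dtheta (3/4) (1/2) \<tau> x = - \<i> * dtheta (1/4) (1/2) \<tau> (- x)"
    unfolding dtheta_three_quarters dtheta_neg_half exp_quarter_turns ..
  show "dtheta (- (1/4)) (1/2) \<tau> x = - \<i> * dtheta (1/4) (1/2) \<tau> (- x)"
    unfolding dtheta_neg_quarter dtheta_neg_half exp_quarter_turns ..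
qed

lemma dtheta_minus: "dtheta a b \<tau> (- x) = dtheta (- a) (- b) \<tau> x"
  using theta_char_minus[of "-a" "-b" "2 * \<tau>" "2 * x"] by (simp add: dtheta_def)

context
  fixes \<tau> :: complex
  assumes im_pos: "Im \<tau> > 0"
begin

lemma dtheta_mult:
  "theta_char a b \<tau> (x + y) * theta_char a' b' \<tau> (x - y) =
    dtheta ((a + a') / 2) (b + b') \<tau> x * dtheta ((a - a') / 2) (b - b') \<tau> y +
    dtheta ((a + a' + 1) / 2) (b + b') \<tau> x * dtheta ((a - a' + 1) / 2) (b - b') \<tau> y"
  using theta_char_mult[OF im_pos] by (simp add: dtheta_def)

text \<open>All four products are bilinear in the values of the two functions
  \<open>dtheta 0 0\<close> and \<open>dtheta (1/2) 0\<close> at \<open>x\<close> and at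
  \<open>y\<close>; the one for \<open>theta1\<close> is their determinant.\<close>

lemma theta_mult_same:
  "theta3 \<tau> (x + y) * theta3 \<tau> (x - y) = dtheta 0 0 \<tau> x * dtheta 0 0 \<tau> y + dtheta (1/2) 0 \<tau> x * dtheta (1/2) 0 \<tau> y"
  "theta4 \<tau> (x + y) * theta4 \<tau> (x - y) = dtheta 0 0 \<tau> x * dtheta 0 0 \<tau> y - dtheta (1/2) 0 \<tau> x * dtheta (1/2) 0 \<tau> y"
  "theta2 \<tau> (x + y) * theta2 \<tau> (x - y) = dtheta (1/2) 0 \<tau> x * dtheta 0 0 \<tau> y + dtheta 0 0 \<tau> x * dtheta (1/2) 0 \<tau> y"
  "theta1 \<tau> (x + y) * theta1 \<tau> (x - y) = dtheta 0 0 \<tau> x * dtheta (1/2) 0 \<tau> y - dtheta (1/2) 0 \<tau> x * dtheta 0 0 \<tau> y"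
  unfolding theta1_def theta2_def theta3_def theta4_def minus_mult_minus dtheta_mult
  by (simp_all add: dtheta_reduce)

lemma theta_mult_12_34:
  "theta1 \<tau> (x + y) * theta2 \<tau> (x - y) =
    - (dtheta (1/2) (1/2) \<tau> x * dtheta 0 (1/2) \<tau> y + dtheta 0 (1/2) \<tau> x * dtheta (1/2) (1/2) \<tau> y)"
  "theta3 \<tau> (x + y) * theta4 \<tau> (x - y) =
    dtheta 0 (1/2) \<tau> x * dtheta 0 (1/2) \<tau> y - dtheta (1/2) (1/2) \<tau> x * dtheta (1/2) (1/2) \<tau> y"
  unfolding theta1_def theta2_def theta3_def theta4_def mult_minus_left dtheta_mult
  by (simp_all add: dtheta_reduce)

lemma theta_mult_13_42:
  "theta1 \<tau> (x + y) * theta3 \<tau> (x - y) =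
    - (dtheta (1/4) (1/2) \<tau> x * dtheta (1/4) (1/2) \<tau> y - dtheta (1/4) (1/2) \<tau> (- x) * dtheta (1/4) (1/2) \<tau> (- y))"
  "theta4 \<tau> (x + y) * theta2 \<tau> (x - y) =
    - \<i> * (dtheta (1/4) (1/2) \<tau> x * dtheta (1/4) (1/2) \<tau> (- y) + dtheta (1/4) (1/2) \<tau> (- x) * dtheta (1/4) (1/2) \<tau> y)"
  unfolding theta1_def theta2_def theta3_def theta4_def mult_minus_left dtheta_mult
  by (simp_all add: dtheta_reduce algebra_simps)

lemma theta_mult_14_23:
  "theta1 \<tau> (x + y) * theta4 \<tau> (x - y) =
    - \<i> * (dtheta (1/4) 0 \<tau> x * dtheta (1/4) 0 \<tau> y - dtheta (1/4) 0 \<tau> (- x) * dtheta (1/4) 0 \<tau> (- y))"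
  "theta2 \<tau> (x + y) * theta3 \<tau> (x - y) =
    dtheta (1/4) 0 \<tau> x * dtheta (1/4) 0 \<tau> y + dtheta (1/4) 0 \<tau> (- x) * dtheta (1/4) 0 \<tau> (- y)"
  unfolding theta1_def theta2_def theta3_def theta4_def mult_minus_left dtheta_mult
  by (simp_all add: dtheta_reduce algebra_simps)

end

section \<open>Addition formulas\<close>

context
  fixes \<tau> :: complex
  assumes im_pos: "Im \<tau> > 0"
begin

lemma theta_squares:
  "(theta3 \<tau> x)\<^sup>2 = dtheta 0 0 \<tau> x * dtheta 0 0 \<tau> 0 + dtheta (1/2) 0 \<tau> x * dtheta (1/2) 0 \<tau> 0"
  "(theta4 \<tau> x)\<^sup>2 = dtheta 0 0 \<tau> x * dtheta 0 0 \<tau> 0 - dtheta (1/2) 0 \<tau> x * dtheta (1/2) 0 \<tau> 0"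
  "(theta2 \<tau> x)\<^sup>2 = dtheta (1/2) 0 \<tau> x * dtheta 0 0 \<tau> 0 + dtheta 0 0 \<tau> x * dtheta (1/2) 0 \<tau> 0"
  "(theta1 \<tau> x)\<^sup>2 = dtheta 0 0 \<tau> x * dtheta (1/2) 0 \<tau> 0 - dtheta (1/2) 0 \<tau> x * dtheta 0 0 \<tau> 0"
  using theta_mult_same[OF im_pos, of x 0] by (simp_all add: power2_eq_square)

text \<open>Each left-hand side is alternating in the values of the pair \<open>dtheta 0 0\<close>,
  \<open>dtheta (1/2) 0\<close> at \<open>x\<close> and \<open>y\<close>, hence a multiple of their
  determinant, which is the product of the two \<open>theta1\<close> values. These identities put
  \<open>phi\<close> on the curve.\<close>

lemma theta_addition_squares:
  "(theta1 \<tau> x)\<^sup>2 * (theta2 \<tau> y)\<^sup>2 - (theta2 \<tau> x)\<^sup>2 * (theta1 \<tau> y)\<^sup>2 = theta1 \<tau> (x + y) * theta1 \<tau> (x - y) * (theta2 \<tau> 0)\<^sup>2"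
  "(theta1 \<tau> x)\<^sup>2 * (theta3 \<tau> y)\<^sup>2 - (theta3 \<tau> x)\<^sup>2 * (theta1 \<tau> y)\<^sup>2 = theta1 \<tau> (x + y) * theta1 \<tau> (x - y) * (theta3 \<tau> 0)\<^sup>2"
  "(theta1 \<tau> x)\<^sup>2 * (theta4 \<tau> y)\<^sup>2 - (theta4 \<tau> x)\<^sup>2 * (theta1 \<tau> y)\<^sup>2 = theta1 \<tau> (x + y) * theta1 \<tau> (x - y) * (theta4 \<tau> 0)\<^sup>2"
  unfolding theta_squares theta_mult_same[OF im_pos] by (simp_all add: algebra_simps)

text \<open>The same determinant argument at 0 and \<open>y\<close>. Applied to
  \<open>\<eta>\<close>, it evaluates the differences of \<open>alpha\<close>, \<open>beta\<close>,
  \<open>gamma\<close>.\<close>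

lemma theta_null_squares:
  "(theta3 \<tau> 0)\<^sup>2 * (theta4 \<tau> y)\<^sup>2 - (theta4 \<tau> 0)\<^sup>2 * (theta3 \<tau> y)\<^sup>2 = (theta2 \<tau> 0)\<^sup>2 * (theta1 \<tau> y)\<^sup>2"
  "(theta4 \<tau> 0)\<^sup>2 * (theta2 \<tau> y)\<^sup>2 - (theta2 \<tau> 0)\<^sup>2 * (theta4 \<tau> y)\<^sup>2 = - ((theta3 \<tau> 0)\<^sup>2 * (theta1 \<tau> y)\<^sup>2)"
  "(theta2 \<tau> 0)\<^sup>2 * (theta3 \<tau> y)\<^sup>2 - (theta3 \<tau> 0)\<^sup>2 * (theta2 \<tau> y)\<^sup>2 = (theta4 \<tau> 0)\<^sup>2 * (theta1 \<tau> y)\<^sup>2"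
  unfolding theta_squares by (simp_all add: algebra_simps)

lemma dtheta_parity: 
  "dtheta 0 (1/2) \<tau> (- x) = dtheta 0 (1/2) \<tau> x"
  "dtheta (1/2) (1/2) \<tau> (- x) = - dtheta (1/2) (1/2) \<tau> x"
proof -
  show "dtheta 0 (1/2) \<tau> (- x) = dtheta 0 (1/2) \<tau> x"
    unfolding dtheta_minus using dtheta_reduce(8) by simp
  have "dtheta (- (1/2)) b \<tau> x = dtheta (1/2) b \<tau> x" for b
    using theta_char_add_one_left[of "-1/2" b "2 * \<tau>" "2 * x"] by (simp add: dtheta_def)
  then show "dtheta (1/2) (1/2) \<tau> (- x) = - dtheta (1/2) (1/2) \<tau> x"
    unfolding dtheta_minus by (simp add: dtheta_reduce)
qed

text \<open>With \<open>y = \<eta>\<close>, the first identity becomes the relation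
  \<open>[Y_0, Y_1]_- = [Y_2, Y_3]_+\<close> and the second the one with \<open>J_coeff\<close>. The
  exchanged products come from replacing \<open>y\<close> by \<open>- y\<close>, those at
  \<open>y\<close> alone from setting the second argument to 0.\<close>

lemma theta_bilinear_12_34:
  "(theta1 \<tau> (x + y) * theta2 \<tau> (x - y) - theta2 \<tau> (x + y) * theta1 \<tau> (x - y)) * (theta3 \<tau> y * theta4 \<tau> y) =
   (theta3 \<tau> (x + y) * theta4 \<tau> (x - y) + theta4 \<tau> (x + y) * theta3 \<tau> (x - y)) * (theta1 \<tau> y * theta2 \<tau> y)"
  "(theta3 \<tau> (x + y) * theta4 \<tau> (x - y) - theta4 \<tau> (x + y) * theta3 \<tau> (x - y)) * (theta3 \<tau> y * theta4 \<tau> y) =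
   - ((theta1 \<tau> (x + y) * theta2 \<tau> (x - y) + theta2 \<tau> (x + y) * theta1 \<tau> (x - y)) * (theta1 \<tau> y * theta2 \<tau> y))"
proof -
  let ?C = "dtheta 0 (1/2) \<tau>" and ?D = "dtheta (1/2) (1/2) \<tau>"
  note m = theta_mult_12_34[OF im_pos]
  have D0: "?D 0 = 0" using dtheta_parity(2)[of 0] by simp
  have e: "theta1 \<tau> (x + y) * theta2 \<tau> (x - y) = - (?D x * ?C y + ?C x * ?D y)"
    "theta2 \<tau> (x + y) * theta1 \<tau> (x - y) = - (?D x * ?C y - ?C x * ?D y)"
    "theta3 \<tau> (x + y) * theta4 \<tau> (x - y) = ?C x * ?C y - ?D x * ?D y"
    "theta4 \<tau> (x + y) * theta3 \<tau> (x - y) = ?C x * ?C y + ?D x * ?D y"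
    "theta1 \<tau> y * theta2 \<tau> y = - (?D y * ?C 0)"
    "theta3 \<tau> y * theta4 \<tau> y = ?C y * ?C 0"
    using m[of x y] m[of x "-y"] m[of y 0] by (simp_all add: dtheta_parity D0 mult.commute)
  show "(theta1 \<tau> (x + y) * theta2 \<tau> (x - y) - theta2 \<tau> (x + y) * theta1 \<tau> (x - y)) * (theta3 \<tau> y * theta4 \<tau> y) =
   (theta3 \<tau> (x + y) * theta4 \<tau> (x - y) + theta4 \<tau> (x + y) * theta3 \<tau> (x - y)) * (theta1 \<tau> y * theta2 \<tau> y)"
   "(theta3 \<tau> (x + y) * theta4 \<tau> (x - y) - theta4 \<tau> (x + y) * theta3 \<tau> (x - y)) * (theta3 \<tau> y * theta4 \<tau> y) =
   - ((theta1 \<tau> (x + y) * theta2 \<tau> (x - y) + theta2 \<tau> (x + y) * theta1 \<tau> (x - y)) * (theta1 \<tau> y * theta2 \<tau> y))"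
    unfolding e by (simp_all add: algebra_simps)
qed

text \<open>The second identity has the opposite sign to that of the other two pairs, which matches
  the minus sign of \<open>gamma u - alpha u\<close> in \<open>differences\<close>.\<close>

lemma theta_bilinear_13_42:
  "(theta1 \<tau> (x + y) * theta3 \<tau> (x - y) - theta3 \<tau> (x + y) * theta1 \<tau> (x - y)) * (theta4 \<tau> y * theta2 \<tau> y) =
   (theta4 \<tau> (x + y) * theta2 \<tau> (x - y) + theta2 \<tau> (x + y) * theta4 \<tau> (x - y)) * (theta1 \<tau> y * theta3 \<tau> y)"
  "(theta4 \<tau> (x + y) * theta2 \<tau> (x - y) - theta2 \<tau> (x + y) * theta4 \<tau> (x - y)) * (theta4 \<tau> y * theta2 \<tau> y) =
   (theta1 \<tau> (x + y) * theta3 \<tau> (x - y) + theta3 \<tau> (x + y) * theta1 \<tau> (x - y)) * (theta1 \<tau> y * theta3 \<tau> y)"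
proof -
  let ?R = "dtheta (1/4) (1/2) \<tau>"
  note m = theta_mult_13_42[OF im_pos]
  have e: "theta1 \<tau> (x + y) * theta3 \<tau> (x - y) = - (?R x * ?R y - ?R (- x) * ?R (- y))"
    "theta3 \<tau> (x + y) * theta1 \<tau> (x - y) = - (?R x * ?R (- y) - ?R (- x) * ?R y)"
    "theta4 \<tau> (x + y) * theta2 \<tau> (x - y) = - \<i> * (?R x * ?R (- y) + ?R (- x) * ?R y)"
    "theta2 \<tau> (x + y) * theta4 \<tau> (x - y) = - \<i> * (?R x * ?R y + ?R (- x) * ?R (- y))"
    "theta1 \<tau> y * theta3 \<tau> y = - (?R y - ?R (- y)) * ?R 0"
    "theta4 \<tau> y * theta2 \<tau> y = - \<i> * (?R y + ?R (- y)) * ?R 0"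
    using m[of x y] m[of x "-y"] m[of y 0] by (simp_all add: algebra_simps)
  show "(theta1 \<tau> (x + y) * theta3 \<tau> (x - y) - theta3 \<tau> (x + y) * theta1 \<tau> (x - y)) * (theta4 \<tau> y * theta2 \<tau> y) =
   (theta4 \<tau> (x + y) * theta2 \<tau> (x - y) + theta2 \<tau> (x + y) * theta4 \<tau> (x - y)) * (theta1 \<tau> y * theta3 \<tau> y)"
  "(theta4 \<tau> (x + y) * theta2 \<tau> (x - y) - theta2 \<tau> (x + y) * theta4 \<tau> (x - y)) * (theta4 \<tau> y * theta2 \<tau> y) =
   (theta1 \<tau> (x + y) * theta3 \<tau> (x - y) + theta3 \<tau> (x + y) * theta1 \<tau> (x - y)) * (theta1 \<tau> y * theta3 \<tau> y)"
    unfolding e by (simp_all add: algebra_simps)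
qed

lemma theta_bilinear_14_23:
  "(theta1 \<tau> (x + y) * theta4 \<tau> (x - y) - theta4 \<tau> (x + y) * theta1 \<tau> (x - y)) * (theta2 \<tau> y * theta3 \<tau> y) =
   (theta2 \<tau> (x + y) * theta3 \<tau> (x - y) + theta3 \<tau> (x + y) * theta2 \<tau> (x - y)) * (theta1 \<tau> y * theta4 \<tau> y)"
  "(theta2 \<tau> (x + y) * theta3 \<tau> (x - y) - theta3 \<tau> (x + y) * theta2 \<tau> (x - y)) * (theta2 \<tau> y * theta3 \<tau> y) =
   - ((theta1 \<tau> (x + y) * theta4 \<tau> (x - y) + theta4 \<tau> (x + y) * theta1 \<tau> (x - y)) * (theta1 \<tau> y * theta4 \<tau> y))"
proof -
  let ?R = "dtheta (1/4) 0 \<tau>"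
  note m = theta_mult_14_23[OF im_pos]
  have e: "theta1 \<tau> (x + y) * theta4 \<tau> (x - y) = - \<i> * (?R x * ?R y - ?R (- x) * ?R (- y))"
    "theta4 \<tau> (x + y) * theta1 \<tau> (x - y) = - \<i> * (?R x * ?R (- y) - ?R (- x) * ?R y)"
    "theta2 \<tau> (x + y) * theta3 \<tau> (x - y) = ?R x * ?R y + ?R (- x) * ?R (- y)"
    "theta3 \<tau> (x + y) * theta2 \<tau> (x - y) = ?R x * ?R (- y) + ?R (- x) * ?R y"
    "theta1 \<tau> y * theta4 \<tau> y = - \<i> * (?R y - ?R (- y)) * ?R 0"
    "theta2 \<tau> y * theta3 \<tau> y = (?R y + ?R (- y)) * ?R 0"
    using m[of x y] m[of x "-y"] m[of y 0] by (simp_all add: algebra_simps)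
  show "(theta1 \<tau> (x + y) * theta4 \<tau> (x - y) - theta4 \<tau> (x + y) * theta1 \<tau> (x - y)) * (theta2 \<tau> y * theta3 \<tau> y) =
   (theta2 \<tau> (x + y) * theta3 \<tau> (x - y) + theta3 \<tau> (x + y) * theta2 \<tau> (x - y)) * (theta1 \<tau> y * theta4 \<tau> y)"
  "(theta2 \<tau> (x + y) * theta3 \<tau> (x - y) - theta3 \<tau> (x + y) * theta2 \<tau> (x - y)) * (theta2 \<tau> y * theta3 \<tau> y) =
   - ((theta1 \<tau> (x + y) * theta4 \<tau> (x - y) + theta4 \<tau> (x + y) * theta1 \<tau> (x - y)) * (theta1 \<tau> y * theta4 \<tau> y))"
    unfolding e by (simp_all add: algebra_simps)
qed

text \<open>A common zero at \<open>x\<close> makes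
  \<open>theta3 \<tau> (x + y) * theta3 \<tau> (x - y)\<close> vanish for all \<open>y\<close>. As
  \<open>theta3\<close> has no zeros near 0, it vanishes near \<open>2 * x\<close>, hence everywhere
  by the identity theorem, contrary to its value at 0.\<close>

lemma dtheta_no_common_zero:
  assumes "theta3 \<tau> 0 \<noteq> 0"
  shows "dtheta 0 0 \<tau> x \<noteq> 0 \<or> dtheta (1/2) 0 \<tau> x \<noteq> 0"
proof (rule ccontr)
  assume "\<not> ?thesis"
  then have prod0: "theta3 \<tau> (x + y) * theta3 \<tau> (x - y) = 0" for y
    unfolding theta_mult_same[OF im_pos] by simp
  have hol: "theta3 \<tau> holomorphic_on UNIV"
    unfolding theta3_def[abs_def] using im_pos by (rule holomorphic_theta_char)
  then have "isCont (theta3 \<tau>) 0"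
    using continuous_on_eq_continuous_at holomorphic_on_imp_continuous_on open_UNIV by blast
  then obtain e where e: "e > 0" "\<And>w. dist 0 w < e \<Longrightarrow> theta3 \<tau> w \<noteq> 0"
    using continuous_at_avoid[of 0 "theta3 \<tau>" 0] assms by auto
  have "theta3 \<tau> w = 0" if "w \<in> ball (2 * x) e" for w
    using prod0[of "w - x"] e(2)[of "2 * x - w"] that by (auto simp: dist_norm norm_minus_commute)
  then have "theta3 \<tau> 0 = 0"
    using analytic_continuation_open[of "ball (2 * x) e" UNIV "theta3 \<tau>" "\<lambda>_. 0" 0] e(1) hol by auto
  then show False using assms by simp
qed

lemma theta_add_one:
  "theta1 \<tau> (x + 1) = - theta1 \<tau> x" "theta2 \<tau> (x + 1) = - theta2 \<tau> x"
  "theta3 \<tau> (x + 1) = theta3 \<tau> x" "theta4 \<tau> (x + 1) = theta4 \<tau> x"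
  unfolding theta1_def theta2_def theta3_def theta4_def theta_char_add_one exp_quarter_turns
  by simp_all

lemma theta_add_tau:
  "theta1 \<tau> (x + \<tau>) = - (exp (- (\<i> * pi * (\<tau> + 2 * x))) * theta1 \<tau> x)"
  "theta2 \<tau> (x + \<tau>) = exp (- (\<i> * pi * (\<tau> + 2 * x))) * theta2 \<tau> x"
  "theta3 \<tau> (x + \<tau>) = exp (- (\<i> * pi * (\<tau> + 2 * x))) * theta3 \<tau> x"
  "theta4 \<tau> (x + \<tau>) = - (exp (- (\<i> * pi * (\<tau> + 2 * x))) * theta4 \<tau> x)"
proof -
  have e: "- (\<i> * pi * (\<tau> + 2 * x + 2 * complex_of_real (1/2))) = - (\<i> * pi * (\<tau> + 2 * x)) + - (2 * \<i> * pi * complex_of_real (1/2))"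
    by (simp add: algebra_simps)
  have "exp (- (\<i> * pi * (\<tau> + 2 * x + 2 * complex_of_real (1/2)))) = - exp (- (\<i> * pi * (\<tau> + 2 * x)))"
    unfolding e exp_add exp_quarter_turns by simp
  then show "theta1 \<tau> (x + \<tau>) = - (exp (- (\<i> * pi * (\<tau> + 2 * x))) * theta1 \<tau> x)"
    "theta4 \<tau> (x + \<tau>) = - (exp (- (\<i> * pi * (\<tau> + 2 * x))) * theta4 \<tau> x)"
    unfolding theta1_def theta4_def theta_char_add_period by simp_all
qed (simp_all add: theta2_def theta3_def theta_char_add_period)

lemma theta_neg:
  "theta1 \<tau> (- x) = - theta1 \<tau> x" "theta2 \<tau> (- x) = theta2 \<tau> x"
  "theta3 \<tau> (- x) = theta3 \<tau> x" "theta4 \<tau> (- x) = theta4 \<tau> x"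
proof -
  have l: "theta_char (- (1/2)) b \<tau> x = theta_char (1/2) b \<tau> x" for b x
    using theta_char_add_one_left[of "-1/2" b \<tau> x] by simp
  have r: "theta_char a (- (1/2)) \<tau> x = exp (- (2 * \<i> * pi * a)) * theta_char a (1/2) \<tau> x" for a x
    using theta_char_add_right[of a "1/2" "-1" \<tau> x] by simp
  have m: "theta_char a b \<tau> (- x) = theta_char (- a) (- b) \<tau> x" for a b
    using theta_char_minus[of "-a" "-b" \<tau> x] by simp
  show "theta1 \<tau> (- x) = - theta1 \<tau> x"
    unfolding theta1_def m l r exp_quarter_turns by simp
  show "theta2 \<tau> (- x) = theta2 \<tau> x" "theta3 \<tau> (- x) = theta3 \<tau> x" 
    unfolding theta2_def theta3_def m by (simp_all add: l)
  show "theta4 \<tau> (- x) = theta4 \<tau> x"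
    unfolding theta4_def m using r[of 0] by simp
qed

end

section \<open>The parametrization by theta functions\<close>

lemma frac_cross:
  fixes C D :: complex
  assumes "C * p = D * q" "p \<noteq> 0" "q \<noteq> 0"
  shows "C / q = D / p"
  using assms by (simp add: frac_eq_eq)

section \<open>Theta values at the parameters\<close>

locale theta_point = generic_point +
  fixes \<omega> \<eta> :: complex
  assumes params: "theta_parameters u \<omega> \<eta>"
begin

abbreviation "t1 \<equiv> theta1 \<omega> \<eta>"
abbreviation "t2 \<equiv> theta2 \<omega> \<eta>"
abbreviation "t3 \<equiv> theta3 \<omega> \<eta>"
abbreviation "t4 \<equiv> theta4 \<omega> \<eta>"

lemma im_pos: "Im \<omega> > 0"
  using params unfolding theta_parameters_def by blast

lemma scale_factor:
  "\<exists>\<kappa>. \<kappa> \<noteq> 0 \<and> alpha u = \<kappa> * ((theta2 \<omega> 0)\<^sup>2 / t2\<^sup>2) \<and> beta u = \<kappa> * ((theta3 \<omega> 0)\<^sup>2 / t3\<^sup>2) \<and> gamma u = \<kappa> * ((theta4 \<omega> 0)\<^sup>2 / t4\<^sup>2)"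
proof -
  have "line (vector [(theta2 \<omega> 0)\<^sup>2 / t2\<^sup>2, (theta3 \<omega> 0)\<^sup>2 / t3\<^sup>2, (theta4 \<omega> 0)\<^sup>2 / t4\<^sup>2] :: complex^3) = line (Phi u)"
    using params unfolding theta_parameters_def by simp
  then obtain \<kappa> where "\<kappa> \<noteq> 0" "Phi u = \<kappa> *s (vector [(theta2 \<omega> 0)\<^sup>2 / t2\<^sup>2, (theta3 \<omega> 0)\<^sup>2 / t3\<^sup>2, (theta4 \<omega> 0)\<^sup>2 / t4\<^sup>2] :: complex^3)"
    unfolding line_eq_iff by blast
  then show ?thesis
    unfolding Phi_def vec_eq_iff forall_3 by (intro exI[of _ \<kappa>]) simp
qed

definition \<kappa> :: complex where
  "\<kappa> = (SOME \<kappa>. \<kappa> \<noteq> 0 \<and> alpha u = \<kappa> * ((theta2 \<omega> 0)\<^sup>2 / t2\<^sup>2) \<and> beta u = \<kappa> * ((theta3 \<omega> 0)\<^sup>2 / t3\<^sup>2) \<and> gamma u = \<kappa> * ((theta4 \<omega> 0)\<^sup>2 / t4\<^sup>2))"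

lemma \<kappa>: "\<kappa> \<noteq> 0" "alpha u = \<kappa> * ((theta2 \<omega> 0)\<^sup>2 / t2\<^sup>2)" "beta u = \<kappa> * ((theta3 \<omega> 0)\<^sup>2 / t3\<^sup>2)"
  "gamma u = \<kappa> * ((theta4 \<omega> 0)\<^sup>2 / t4\<^sup>2)"
  using someI_ex[OF scale_factor] unfolding \<kappa>_def[symmetric] by blast+

lemma theta_nonzero:
  "theta2 \<omega> 0 \<noteq> 0" "theta3 \<omega> 0 \<noteq> 0" "theta4 \<omega> 0 \<noteq> 0" "t1 \<noteq> 0" "t2 \<noteq> 0" "t3 \<noteq> 0" "t4 \<noteq> 0"
proof -
  note g = generic_imp[OF generic]
  \<comment> \<open>Since \<open>x / 0 = 0\<close>, a vanishing denominator, like a vanishing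
    numerator, would make \<open>alpha u\<close>, \<open>beta u\<close> or \<open>gamma u\<close>
    zero.\<close>
  show n: "theta2 \<omega> 0 \<noteq> 0" "theta3 \<omega> 0 \<noteq> 0" "theta4 \<omega> 0 \<noteq> 0" "t2 \<noteq> 0" "t3 \<noteq> 0" "t4 \<noteq> 0"
    using g(1-3) \<kappa> by auto
  \<comment> \<open>Otherwise \<open>theta_null_squares\<close> would give
    \<open>beta u = gamma u\<close>.\<close>
  show "t1 \<noteq> 0"
  proof
    assume "t1 = 0"
    then have "(theta3 \<omega> 0)\<^sup>2 * t4\<^sup>2 = (theta4 \<omega> 0)\<^sup>2 * t3\<^sup>2"
      using theta_null_squares(1)[OF im_pos, of \<eta>] by simp
    then have "(theta3 \<omega> 0)\<^sup>2 / t3\<^sup>2 = (theta4 \<omega> 0)\<^sup>2 / t4\<^sup>2"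
      using n by (intro frac_cross) auto
    then show False using g(5) \<kappa> by simp
  qed
qed

lemma differences:
  "beta u - gamma u = \<kappa> * ((theta2 \<omega> 0)\<^sup>2 * t1\<^sup>2 / (t3\<^sup>2 * t4\<^sup>2))"
  "gamma u - alpha u = - (\<kappa> * ((theta3 \<omega> 0)\<^sup>2 * t1\<^sup>2 / (t4\<^sup>2 * t2\<^sup>2)))"
  "alpha u - beta u = \<kappa> * ((theta4 \<omega> 0)\<^sup>2 * t1\<^sup>2 / (t2\<^sup>2 * t3\<^sup>2))"
proof -
  have d: "p / x - q / y = (p * y - q * x) / (x * y)" if "x \<noteq> 0" "y \<noteq> 0" for p q x y :: complex
    using that by (simp add: diff_frac_eq)
  note n = theta_nonzero theta_null_squares[OF im_pos]
  show "beta u - gamma u = \<kappa> * ((theta2 \<omega> 0)\<^sup>2 * t1\<^sup>2 / (t3\<^sup>2 * t4\<^sup>2))"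
    "gamma u - alpha u = - (\<kappa> * ((theta3 \<omega> 0)\<^sup>2 * t1\<^sup>2 / (t4\<^sup>2 * t2\<^sup>2)))"
    "alpha u - beta u = \<kappa> * ((theta4 \<omega> 0)\<^sup>2 * t1\<^sup>2 / (t2\<^sup>2 * t3\<^sup>2))"
    unfolding \<kappa> right_diff_distrib[symmetric] by (subst d; simp add: n)+
qed

text \<open>The six equations of \<open>zcorr_iff\<close> are the six bilinear theta identities at
  \<open>x\<close> and \<open>\<eta>\<close>, divided by theta values at
  \<open>\<eta>\<close>.\<close>

lemma zcorr_phi:
  assumes "2 * z = x + \<eta>" "2 * z' = x - \<eta>"
  shows "zcorr u (phi \<omega> \<eta> z) (phi \<omega> \<eta> z')"
proof -
  note n = theta_nonzero
  have lin: "A / p * (B' / q) - A' / q * (B / p) = C / r * (D' / s) + C' / s * (D / r)"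
    if "(A * B' - A' * B) * (r * s) = (C * D' + C' * D) * (p * q)" "p \<noteq> 0" "q \<noteq> 0" "r \<noteq> 0" "s \<noteq> 0"
    for A B C D A' B' C' D' p q r s :: complex
  proof -
    have "A / p * (B' / q) - A' / q * (B / p) = (A * B' - A' * B) / (p * q)" by (simp add: diff_divide_distrib mult.commute)
    also have "\<dots> = (C * D' + C' * D) / (r * s)" using that by (intro frac_cross) auto
    also have "\<dots> = C / r * (D' / s) + C' / s * (D / r)" by (simp add: add_divide_distrib mult.commute)
    finally show ?thesis .
  qed
  \<comment> \<open>Here \<open>\<kappa> * (m / k\<^sup>2)\<close> stands for one of
    \<open>alpha u\<close>, \<open>beta u\<close>, \<open>gamma u\<close>, and \<open>e\<close> for
    the sign, 1 or -1, in the matching line of \<open>differences\<close>.\<close>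
  have quad: "\<kappa> * (m / k\<^sup>2) * (C / r * (D' / s) - C' / s * (D / r)) + e * (\<kappa> * (m * p\<^sup>2 / (r\<^sup>2 * s\<^sup>2))) * (A / p * (B' / k) + A' / k * (B / p)) = 0"
    if h: "(C * D' - C' * D) * (r * s) = - e * ((A * B' + A' * B) * (p * k))" and nz: "p \<noteq> 0" "k \<noteq> 0" "r \<noteq> 0" "s \<noteq> 0"
    for A B C D A' B' C' D' p r s k m e :: complex
  proof -
    have "C / r * (D' / s) - C' / s * (D / r) = (C * D' - C' * D) / (r * s)" by (simp add: diff_divide_distrib mult.commute)
    also have "\<dots> = - e * ((A * B' + A' * B) * (p * k)) / (r * s)\<^sup>2"
      unfolding h[symmetric] using nz by (simp add: power2_eq_square)
    finally have 1: "C / r * (D' / s) - C' / s * (D / r) = - e * ((A * B' + A' * B) * (p * k)) / (r * s)\<^sup>2" .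
    have 2: "A / p * (B' / k) + A' / k * (B / p) = (A * B' + A' * B) / (p * k)" by (simp add: add_divide_distrib mult.commute)
    show ?thesis unfolding 1 2 using nz by (simp add: field_simps power2_eq_square)
  qed
  show ?thesis
    unfolding zcorr_iff phi_def vec4_nth assms
  proof (intro conjI)
    note b1 = theta_bilinear_12_34[OF im_pos, of x \<eta>] and b2 = theta_bilinear_13_42[OF im_pos, of x \<eta>]
      and b3 = theta_bilinear_14_23[OF im_pos, of x \<eta>]
    show "theta1 \<omega> (x + \<eta>) / t1 * (theta2 \<omega> (x - \<eta>) / t2) - theta2 \<omega> (x + \<eta>) / t2 * (theta1 \<omega> (x - \<eta>) / t1) =
      theta3 \<omega> (x + \<eta>) / t3 * (theta4 \<omega> (x - \<eta>) / t4) + theta4 \<omega> (x + \<eta>) / t4 * (theta3 \<omega> (x - \<eta>) / t3)"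
      by (rule lin[OF b1(1)]) (fact n)+
    show "theta1 \<omega> (x + \<eta>) / t1 * (theta3 \<omega> (x - \<eta>) / t3) - theta3 \<omega> (x + \<eta>) / t3 * (theta1 \<omega> (x - \<eta>) / t1) =
      theta4 \<omega> (x + \<eta>) / t4 * (theta2 \<omega> (x - \<eta>) / t2) + theta2 \<omega> (x + \<eta>) / t2 * (theta4 \<omega> (x - \<eta>) / t4)"
      by (rule lin[OF b2(1)]) (fact n)+
    show "theta1 \<omega> (x + \<eta>) / t1 * (theta4 \<omega> (x - \<eta>) / t4) - theta4 \<omega> (x + \<eta>) / t4 * (theta1 \<omega> (x - \<eta>) / t1) =
      theta2 \<omega> (x + \<eta>) / t2 * (theta3 \<omega> (x - \<eta>) / t3) + theta3 \<omega> (x + \<eta>) / t3 * (theta2 \<omega> (x - \<eta>) / t2)"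
      by (rule lin[OF b3(1)]) (fact n)+
    show "alpha u * (theta3 \<omega> (x + \<eta>) / t3 * (theta4 \<omega> (x - \<eta>) / t4) - theta4 \<omega> (x + \<eta>) / t4 * (theta3 \<omega> (x - \<eta>) / t3)) +
      (beta u - gamma u) * (theta1 \<omega> (x + \<eta>) / t1 * (theta2 \<omega> (x - \<eta>) / t2) + theta2 \<omega> (x + \<eta>) / t2 * (theta1 \<omega> (x - \<eta>) / t1)) = 0"
      unfolding differences unfolding \<kappa>
      using quad[of "theta3 \<omega> (x + \<eta>)" "theta4 \<omega> (x - \<eta>)" "theta4 \<omega> (x + \<eta>)" "theta3 \<omega> (x - \<eta>)" t3 t4 1
          "theta1 \<omega> (x + \<eta>)" "theta2 \<omega> (x - \<eta>)" "theta2 \<omega> (x + \<eta>)" "theta1 \<omega> (x - \<eta>)" t1 t2 "(theta2 \<omega> 0)\<^sup>2"] b1(2) n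
      by simp
    show "beta u * (theta4 \<omega> (x + \<eta>) / t4 * (theta2 \<omega> (x - \<eta>) / t2) - theta2 \<omega> (x + \<eta>) / t2 * (theta4 \<omega> (x - \<eta>) / t4)) +
      (gamma u - alpha u) * (theta1 \<omega> (x + \<eta>) / t1 * (theta3 \<omega> (x - \<eta>) / t3) + theta3 \<omega> (x + \<eta>) / t3 * (theta1 \<omega> (x - \<eta>) / t1)) = 0"
      unfolding differences unfolding \<kappa>
      using quad[of "theta4 \<omega> (x + \<eta>)" "theta2 \<omega> (x - \<eta>)" "theta2 \<omega> (x + \<eta>)" "theta4 \<omega> (x - \<eta>)" t4 t2 "-1"
          "theta1 \<omega> (x + \<eta>)" "theta3 \<omega> (x - \<eta>)" "theta3 \<omega> (x + \<eta>)" "theta1 \<omega> (x - \<eta>)" t1 t3 "(theta3 \<omega> 0)\<^sup>2"] b2(2) n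
      by simp
    show "gamma u * (theta2 \<omega> (x + \<eta>) / t2 * (theta3 \<omega> (x - \<eta>) / t3) - theta3 \<omega> (x + \<eta>) / t3 * (theta2 \<omega> (x - \<eta>) / t2)) +
      (alpha u - beta u) * (theta1 \<omega> (x + \<eta>) / t1 * (theta4 \<omega> (x - \<eta>) / t4) + theta4 \<omega> (x + \<eta>) / t4 * (theta1 \<omega> (x - \<eta>) / t1)) = 0"
      unfolding differences unfolding \<kappa>
      using quad[of "theta2 \<omega> (x + \<eta>)" "theta3 \<omega> (x - \<eta>)" "theta3 \<omega> (x + \<eta>)" "theta2 \<omega> (x - \<eta>)" t2 t3 1
          "theta1 \<omega> (x + \<eta>)" "theta4 \<omega> (x - \<eta>)" "theta4 \<omega> (x + \<eta>)" "theta1 \<omega> (x - \<eta>)" t1 t4 "(theta4 \<omega> 0)\<^sup>2"] b3(2) n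
      by simp
  qed
qed

lemma dtheta_zero_nonzero: "dtheta 0 0 \<omega> 0 \<noteq> 0" "dtheta (1/2) 0 \<omega> 0 \<noteq> 0"
  using theta_squares(3)[OF im_pos, of 0] theta_nonzero(1) by auto

text \<open>A zero would make \<open>theta3\<close> and \<open>theta4\<close> vanish together; the
  sum and difference of their squares then force a common zero of the two \<open>dtheta\<close>
  functions.\<close>

lemma phi_nonzero: "phi \<omega> \<eta> z \<noteq> 0"
proof
  assume "phi \<omega> \<eta> z = 0"
  then have z: "theta3 \<omega> (2 * z) = 0" "theta4 \<omega> (2 * z) = 0"
    using theta_nonzero by (simp_all add: phi_def vec_eq_iff_four)
  have "dtheta 0 0 \<omega> (2 * z) * dtheta 0 0 \<omega> 0 + dtheta (1/2) 0 \<omega> (2 * z) * dtheta (1/2) 0 \<omega> 0 = 0"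
    "dtheta 0 0 \<omega> (2 * z) * dtheta 0 0 \<omega> 0 - dtheta (1/2) 0 \<omega> (2 * z) * dtheta (1/2) 0 \<omega> 0 = 0"
    using theta_squares(1,2)[OF im_pos, of "2 * z"] z by simp_all
  then have "dtheta 0 0 \<omega> (2 * z) * dtheta 0 0 \<omega> 0 = 0" "dtheta (1/2) 0 \<omega> (2 * z) * dtheta (1/2) 0 \<omega> 0 = 0"
    by auto
  then show False
    using dtheta_no_common_zero[OF im_pos theta_nonzero(2), of "2 * z"] dtheta_zero_nonzero by simp
qed

section \<open>Surjectivity onto the curve\<close>

definition sq_factor :: "complex \<Rightarrow> complex" where
  "sq_factor z = theta1 \<omega> (2 * z + \<eta>) * theta1 \<omega> (2 * z - \<eta>) / (t1\<^sup>2 * \<kappa>)"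

text \<open>\<open>sq_factor z\<close> is the common ratio in the equations of the curve at
  \<open>phi \<omega> \<eta> z\<close>. Together with the square of the coordinate 0 it determines
  the squares of all coordinates.\<close>

lemma phi_squares:
  "(phi \<omega> \<eta> z $ 0)\<^sup>2 - (phi \<omega> \<eta> z $ 1)\<^sup>2 = sq_factor z * alpha u"
  "(phi \<omega> \<eta> z $ 0)\<^sup>2 - (phi \<omega> \<eta> z $ 2)\<^sup>2 = sq_factor z * beta u"
  "(phi \<omega> \<eta> z $ 0)\<^sup>2 - (phi \<omega> \<eta> z $ 3)\<^sup>2 = sq_factor z * gamma u"
proof -
  note n = theta_nonzero
  have "(A / t1)\<^sup>2 - (B / k)\<^sup>2 = X / (t1\<^sup>2 * \<kappa>) * (\<kappa> * (m / k\<^sup>2))" if "A\<^sup>2 * k\<^sup>2 - B\<^sup>2 * t1\<^sup>2 = X * m" "k \<noteq> 0" for A B k X m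
  proof -
    have "(A / t1)\<^sup>2 - (B / k)\<^sup>2 = (A\<^sup>2 * k\<^sup>2 - B\<^sup>2 * t1\<^sup>2) / (t1\<^sup>2 * k\<^sup>2)"
      using n that(2) by (simp add: power_divide diff_frac_eq)
    then show ?thesis unfolding that(1) using \<kappa>(1) by simp
  qed
  from this[OF theta_addition_squares(1)[OF im_pos]] this[OF theta_addition_squares(2)[OF im_pos]] this[OF theta_addition_squares(3)[OF im_pos]]
  show "(phi \<omega> \<eta> z $ 0)\<^sup>2 - (phi \<omega> \<eta> z $ 1)\<^sup>2 = sq_factor z * alpha u"
    "(phi \<omega> \<eta> z $ 0)\<^sup>2 - (phi \<omega> \<eta> z $ 2)\<^sup>2 = sq_factor z * beta u"
    "(phi \<omega> \<eta> z $ 0)\<^sup>2 - (phi \<omega> \<eta> z $ 3)\<^sup>2 = sq_factor z * gamma u"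
    unfolding phi_def vec4_nth sq_factor_def \<kappa> using n by simp_all
qed

lemma on_F_phi: "on_F u (phi \<omega> \<eta> z)"
  unfolding on_F_def phi_squares by simp

text \<open>Both sides are linear combinations of \<open>dtheta 0 0\<close> and
  \<open>dtheta (1/2) 0\<close> at \<open>2 * z\<close>, so their difference has a zero.\<close>

lemma phi_ratio_surj:
  "\<exists>z. p * sq_factor z = q * (phi \<omega> \<eta> z $ 0)\<^sup>2"
proof -
  let ?A = "dtheta 0 0 \<omega>" and ?B = "dtheta (1/2) 0 \<omega>"
  obtain x where x: "(p * ?B \<eta> - q * \<kappa> * ?B 0) * ?A x + (q * \<kappa> * ?A 0 - p * ?A \<eta>) * ?B x = 0"
    using dtheta_combination_has_zero[OF im_pos] by blast
  have "p * (theta1 \<omega> (x + \<eta>) * theta1 \<omega> (x - \<eta>)) = q * \<kappa> * (theta1 \<omega> x)\<^sup>2"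
    unfolding theta_mult_same[OF im_pos] theta_squares[OF im_pos] using x by (simp add: algebra_simps)
  then have "p * sq_factor (x / 2) = q * (phi \<omega> \<eta> (x / 2) $ 0)\<^sup>2"
    using \<kappa>(1) theta_nonzero(4) by (simp add: sq_factor_def phi_def power_divide field_simps)
  then show ?thesis by blast
qed

definition in_phi_cone :: "complex^4 \<Rightarrow> bool" where
  "in_phi_cone w \<longleftrightarrow> (\<exists>z k. k \<noteq> 0 \<and> phi \<omega> \<eta> z = k *s w)"

text \<open>Substitutions in \<open>z\<close> realize the sign change of the coordinates 0, 1 and 3;
  the one for 2 is their product up to an overall sign, which does not change the projective
  point.\<close>

lemma in_phi_cone_neg:
  assumes "in_phi_cone w"
  shows "in_phi_cone (\<chi> j. if j = i then - w $ j else w $ j)"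
proof -
  define neg where "neg = (\<lambda>i (w :: complex^4). \<chi> j. if j = i then - w $ j else w $ j)"
  have scale: "in_phi_cone (k *s w)" if w: "in_phi_cone w" and k: "k \<noteq> 0" for k w
  proof -
    obtain z l where l: "l \<noteq> 0" "phi \<omega> \<eta> z = l *s w" using w unfolding in_phi_cone_def by blast
    have "phi \<omega> \<eta> z = (l / k) *s (k *s w)" using l k by (simp add: vector_smult_assoc)
    moreover have "l / k \<noteq> 0" using l k by simp
    ultimately show ?thesis unfolding in_phi_cone_def by blast
  qed
  have step: "in_phi_cone (neg i w)" if w: "in_phi_cone w" and neg: "\<And>z. \<exists>z' m. m \<noteq> 0 \<and> phi \<omega> \<eta> z' = m *s neg i (phi \<omega> \<eta> z)" for i w
  proof -
    obtain z k where k: "k \<noteq> 0" "phi \<omega> \<eta> z = k *s w" using w unfolding in_phi_cone_def by blast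
    obtain z' m where m: "m \<noteq> 0" "phi \<omega> \<eta> z' = m *s neg i (phi \<omega> \<eta> z)" using neg by blast
    have "phi \<omega> \<eta> z' = (m * k) *s neg i w" unfolding m k by (simp add: neg_def vec_eq_iff)
    then show ?thesis unfolding in_phi_cone_def using k m by (metis mult_eq_0_iff)
  qed
  have n0: "in_phi_cone (neg 0 w)" if "in_phi_cone w" for w
  proof (rule step[OF that])
    have "phi \<omega> \<eta> (- z) = 1 *s neg 0 (phi \<omega> \<eta> z)" for z
      by (simp add: phi_def neg_def vec_eq_iff_four theta_neg[OF im_pos])
    then show "\<exists>z' m. m \<noteq> 0 \<and> phi \<omega> \<eta> z' = m *s neg 0 (phi \<omega> \<eta> z)" for z
      using zero_neq_one[symmetric] by blast
  qed
  have n1: "in_phi_cone (neg 1 w)" if "in_phi_cone w" for w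
  proof (rule step[OF that])
    \<comment> \<open>Reflection negates \<open>theta1\<close> and adding 1 negates
      \<open>theta1\<close> and \<open>theta2\<close>, so only the coordinate 1 changes
      sign.\<close>
    have e: "2 * (- z + 1/2) = - (2 * z) + 1" for z :: complex by simp
    have "phi \<omega> \<eta> (- z + 1/2) = 1 *s neg 1 (phi \<omega> \<eta> z)" for z
      unfolding phi_def e theta_add_one[OF im_pos] theta_neg[OF im_pos]
      by (simp add: neg_def vec_eq_iff_four)
    then show "\<exists>z' m. m \<noteq> 0 \<and> phi \<omega> \<eta> z' = m *s neg 1 (phi \<omega> \<eta> z)" for z
      using zero_neq_one[symmetric] by blast
  qed
  have n3: "in_phi_cone (neg 3 w)" if "in_phi_cone w" for w
  proof (rule step[OF that])
    \<comment> \<open>Adding the period negates \<open>theta1\<close> and \<open>theta4\<close> up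
      to a common exponential factor; with the reflection only the coordinate 3 changes
      sign.\<close>
    have e: "2 * (- z + \<omega> / 2) = - (2 * z) + \<omega>" for z :: complex by simp
    have "phi \<omega> \<eta> (- z + \<omega> / 2) = exp (- (\<i> * pi * (\<omega> + 2 * (- (2 * z))))) *s neg 3 (phi \<omega> \<eta> z)" for z
      unfolding phi_def e theta_add_tau[OF im_pos] theta_neg[OF im_pos]
      by (simp add: neg_def vec_eq_iff_four)
    then show "\<exists>z' m. m \<noteq> 0 \<and> phi \<omega> \<eta> z' = m *s neg 3 (phi \<omega> \<eta> z)" for z
      using exp_not_eq_zero by blast
  qed
  have n2: "in_phi_cone (neg 2 w)" if "in_phi_cone w" for w
  proof -
    have "in_phi_cone ((-1) *s neg 3 (neg 1 (neg 0 w)))"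
      by (intro scale n0 n1 n3 that) simp
    also have "(-1) *s neg 3 (neg 1 (neg 0 w)) = neg 2 w"
      by (simp add: neg_def vec_eq_iff_four)
    finally show ?thesis .
  qed
  have "i \<in> {0, 1, 2, 3}" using UNIV_four by (metis UNIV_I)
  then have "in_phi_cone (neg i w)" using n0 n1 n2 n3 assms by blast
  then show ?thesis by (simp add: neg_def)
qed

text \<open>The coordinates are corrected one at a time, from \<open>v0\<close> to
  \<open>v3\<close>.\<close>

lemma in_phi_cone_cong_squares:
  assumes "in_phi_cone w" "\<And>i. (w' $ i)\<^sup>2 = (w $ i)\<^sup>2"
  shows "in_phi_cone w'"
proof -
  have step: "in_phi_cone (\<chi> j. if j = i then w' $ j else v $ j)" if "in_phi_cone v" "v $ i = w $ i" for v i
  proof (cases "w' $ i = w $ i")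
    case True
    then have "(\<chi> j. if j = i then w' $ j else v $ j) = v" using that(2) by (simp add: vec_eq_iff)
    then show ?thesis using that(1) by simp
  next
    case False
    then have "w' $ i = - w $ i" using assms(2)[of i] by (simp add: power2_eq_iff)
    then have "(\<chi> j. if j = i then w' $ j else v $ j) = (\<chi> j. if j = i then - v $ j else v $ j)"
      using that(2) by (simp add: vec_eq_iff)
    then show ?thesis using in_phi_cone_neg[OF that(1)] by simp
  qed
  define v0 where "v0 = (\<chi> j. if j = 0 then w' $ j else w $ j)"
  define v1 where "v1 = (\<chi> j. if j = 1 then w' $ j else v0 $ j)"
  define v2 where "v2 = (\<chi> j. if j = 2 then w' $ j else v1 $ j)"
  define v3 where "v3 = (\<chi> j. if j = 3 then w' $ j else v2 $ j)"
  have "in_phi_cone v0" unfolding v0_def by (rule step[OF assms(1) refl])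
  then have "in_phi_cone v1" unfolding v1_def by (rule step) (simp add: v0_def)
  then have "in_phi_cone v2" unfolding v2_def by (rule step) (simp add: v0_def v1_def)
  then have "in_phi_cone v3" unfolding v3_def by (rule step) (simp add: v0_def v1_def v2_def)
  moreover have "v3 = w'" by (simp add: vec_eq_iff_four v0_def v1_def v2_def v3_def)
  ultimately show ?thesis by simp
qed

text \<open>A point of the curve is known up to signs of its coordinates from the ratio of its
  squared coordinate 0 to \<open>t\<close>. By \<open>phi_ratio_surj\<close> some
  \<open>phi \<omega> \<eta> z\<close> has the same ratio, and the signs are then adjusted.\<close>

lemma phi_surj:
  assumes "Z \<noteq> 0" "on_F u Z"
  shows "\<exists>z. line Z = line (phi \<omega> \<eta> z)"
proof -
  note g = generic_imp[OF generic]
  define t where "t = ((Z $ 0)\<^sup>2 - (Z $ 1)\<^sup>2) / alpha u"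
  have t: "(Z $ 0)\<^sup>2 - (Z $ 1)\<^sup>2 = t * alpha u" "(Z $ 0)\<^sup>2 - (Z $ 2)\<^sup>2 = t * beta u" "(Z $ 0)\<^sup>2 - (Z $ 3)\<^sup>2 = t * gamma u"
    using assms(2) g(1) unfolding on_F_def t_def by (simp_all add: field_simps)
  obtain z where z: "(Z $ 0)\<^sup>2 * sq_factor z = t * (phi \<omega> \<eta> z $ 0)\<^sup>2" using phi_ratio_surj by blast
  define f where "f = phi \<omega> \<eta> z"
  have sq: "(f $ 1)\<^sup>2 = (f $ 0)\<^sup>2 - sq_factor z * alpha u" "(f $ 2)\<^sup>2 = (f $ 0)\<^sup>2 - sq_factor z * beta u" "(f $ 3)\<^sup>2 = (f $ 0)\<^sup>2 - sq_factor z * gamma u"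
    using phi_squares[of z] unfolding f_def by (simp_all add: algebra_simps)
  have sqZ: "(Z $ 1)\<^sup>2 = (Z $ 0)\<^sup>2 - t * alpha u" "(Z $ 2)\<^sup>2 = (Z $ 0)\<^sup>2 - t * beta u" "(Z $ 3)\<^sup>2 = (Z $ 0)\<^sup>2 - t * gamma u"
    using t by (simp_all add: algebra_simps)
  have f0: "(f $ 0)\<^sup>2 \<noteq> 0 \<or> sq_factor z \<noteq> 0"
    using sq phi_nonzero[of z] unfolding f_def[symmetric] vec_eq_iff_four by auto
  have Z0: "(Z $ 0)\<^sup>2 \<noteq> 0 \<or> t \<noteq> 0"
    using sqZ assms(1) unfolding vec_eq_iff_four by auto
  \<comment> \<open>Neither pair of squared coordinate and ratio is zero, by \<open>f0\<close> and
    \<open>Z0\<close>, so the vanishing cross product in \<open>z\<close> makes them proportional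
    with a nonzero factor.\<close>
  have "\<exists>c. c \<noteq> 0 \<and> (Z $ 0)\<^sup>2 = c * (f $ 0)\<^sup>2 \<and> t = c * sq_factor z"
  proof (cases "(f $ 0)\<^sup>2 = 0")
    case True
    then show ?thesis using z f0 Z0 unfolding f_def[symmetric] by (intro exI[of _ "t / sq_factor z"]) auto
  next
    case False
    then have "t = (Z $ 0)\<^sup>2 / (f $ 0)\<^sup>2 * sq_factor z" using z unfolding f_def[symmetric] by (simp add: field_simps)
    then show ?thesis using False Z0 by (intro exI[of _ "(Z $ 0)\<^sup>2 / (f $ 0)\<^sup>2"]) auto
  qed
  then obtain c where c: "c \<noteq> 0" "(Z $ 0)\<^sup>2 = c * (f $ 0)\<^sup>2" "t = c * sq_factor z" by blast
  define r where "r = csqrt c"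
  have r: "r\<^sup>2 = c" "r \<noteq> 0" using c(1) by (auto simp: r_def)
  have "\<forall>i. (Z $ i)\<^sup>2 = ((r *s f) $ i)\<^sup>2"
    unfolding forall_four vector_smult_component power_mult_distrib r(1) sq sqZ
    using c by (simp add: algebra_simps)
  moreover have "in_phi_cone (r *s f)"
    unfolding in_phi_cone_def f_def using r(2) by (intro exI[of _ z] exI[of _ "1 / r"]) (simp add: vector_smult_assoc)
  ultimately have "in_phi_cone Z" using in_phi_cone_cong_squares by blast
  then show ?thesis unfolding in_phi_cone_def line_eq_iff by blast
qed

lemma F_curve_range_psi: "F_curve u = range (\<lambda>z. line (psi \<omega> \<eta> z))"
proof (intro subset_antisym subsetI)
  fix p assume "p \<in> F_curve u"
  then obtain Z where "p = line Z" "Z \<noteq> 0" "on_F u Z" unfolding F_curve_eq[OF generic] by blast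
  then obtain z where "p = line (phi \<omega> \<eta> z)" using phi_surj by blast
  then have "p = line (psi \<omega> \<eta> (z + \<eta> / 2))" by (simp add: psi_def)
  then show "p \<in> range (\<lambda>z. line (psi \<omega> \<eta> z))" by blast
next
  fix p assume "p \<in> range (\<lambda>z. line (psi \<omega> \<eta> z))"
  then show "p \<in> F_curve u"
    unfolding psi_def using line_in_F_curve_iff[OF phi_nonzero] on_F_phi by auto
qed

lemma \<sigma>_psi: "\<sigma> (line (psi \<omega> \<eta> z)) = line (psi \<omega> \<eta> (z - \<eta>))"
  unfolding psi_def
  \<comment> \<open>The midpoint \<open>x = 2 * z - 2 * \<eta>\<close> makes
    \<open>x + \<eta>\<close> and \<open>x - \<eta>\<close> the doubled arguments of
    \<open>phi\<close> on the two sides.\<close>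
  by (rule \<sigma>_eq[OF zcorr_phi[of _ "2 * z - 2 * \<eta>"] phi_nonzero phi_nonzero]) (simp_all add: algebra_simps)

end

theorem theorem5:
  shows "\<exists>P. birational_automorphism \<rat> P \<and>
    (\<forall>u s t. generic u \<and> root_choice u s t \<longrightarrow>
      quadratic_algebra (y_relations u) = quadratic_algebra (Y_relations u (Y_gen s t)) \<and>
      (\<exists>\<sigma>. is_characteristic_variety (Gamma_set (y_relations u) (Y_gen s t)) (F_curve u \<union> range e_point) \<sigma> \<and>
        (\<forall>\<omega> \<eta>. theta_parameters u \<omega> \<eta> \<longrightarrow>
           F_curve u = range (\<lambda>z. line (psi \<omega> \<eta> z)) \<and>
           (\<forall>z. \<sigma> (line (psi \<omega> \<eta> z)) = line (psi \<omega> \<eta> (z - \<eta>)))) \<and>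
        (\<forall>\<nu>. \<sigma> (e_point \<nu>) = e_point \<nu>) \<and>
        restriction_to_curve P (F_curve u) \<sigma>))"
proof (intro exI[of _ sigma_map] conjI allI impI birational_sigma_map; elim conjE)
  fix u s t assume u: "generic u" "root_choice u s t"
  then show "quadratic_algebra (y_relations u) = quadratic_algebra (Y_relations u (Y_gen s t))"
    by (rule quadratic_algebra_eq)
  interpret generic_point u by standard (rule u(1))
  have "is_characteristic_variety (Gamma_set (y_relations u) (Y_gen s t)) (F_curve u \<union> range e_point) \<sigma>"
    using characteristic_variety unfolding \<Gamma>_def E_def Gamma_set_eq[OF u] .
  \<comment> \<open>The automorphism was obtained from \<open>u\<close> alone, so one
    \<open>\<sigma>\<close> serves all admissible \<open>\<omega>\<close> and
    \<open>\<eta>\<close>.\<close>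
  moreover have "F_curve u = range (\<lambda>z. line (psi \<omega> \<eta> z)) \<and> (\<forall>z. \<sigma> (line (psi \<omega> \<eta> z)) = line (psi \<omega> \<eta> (z - \<eta>)))"
    if "theta_parameters u \<omega> \<eta>" for \<omega> \<eta>
  proof -
    interpret theta_point u \<omega> \<eta> by standard (rule that)
    show ?thesis using F_curve_range_psi \<sigma>_psi by blast
  qed
  ultimately show "\<exists>\<sigma>. is_characteristic_variety (Gamma_set (y_relations u) (Y_gen s t)) (F_curve u \<union> range e_point) \<sigma> \<and>
        (\<forall>\<omega> \<eta>. theta_parameters u \<omega> \<eta> \<longrightarrow>
           F_curve u = range (\<lambda>z. line (psi \<omega> \<eta> z)) \<and>
           (\<forall>z. \<sigma> (line (psi \<omega> \<eta> z)) = line (psi \<omega> \<eta> (z - \<eta>)))) \<and>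
        (\<forall>\<nu>. \<sigma> (e_point \<nu>) = e_point \<nu>) \<and>
        restriction_to_curve sigma_map (F_curve u) \<sigma>"
    using \<sigma>_e_point restriction_sigma_map by (intro exI[of _ \<sigma>]) blast
qed

end
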